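(* Assume the Riemann hypothesis and assume that $$ \liminf_{\gamma'\to\infty}(\beta'-\tfrac{1}{2})(\log\gamma')(\log\log\gamma')^{2}=0 . $$ Then $$ \liminf_{n\to\infty}(\gamma_{n+1}-\gamma_n)(\log\gamma_n)=0 . $$
   Context: $\zeta(s)$ is the Riemann zeta-function and $\zeta'(s)$ its derivative. The non-real zeros of $\zeta'(s)$ are denoted $\rho'=\beta'+i\gamma'$ (with $\beta',\gamma'$ real), and $\liminf_{\gamma'\to\infty}$ is the lower limit taken over these zeros as $\gamma'\to\infty$. The non-trivial zeros of $\zeta(s)$ are those in the critical strip $0\le\Re s\le 1$; the Riemann hypothesis asserts that they all have real part $\frac12$. The non-trivial zeros of $\zeta(s)$ in the upper half-plane are written $\rho_n=\beta_n+i\gamma_n$ and indexed so that $0<\gamma_1\le\gamma_2\le\ldots$, where the ordinate of a zero of multiplicity $m$ appears $m$ times consecutively in the sequence. *)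

theory Defs
  imports "HOL-Complex_Analysis.Complex_Analysis" "HOL-Library.Going_To_Filter"
begin

lemma gbinomial_Suc_fact:
  fixes a :: complex
  shows "fact (Suc i) * (a gchoose Suc i) = fact i * (a gchoose i) * (a - of_nat i)"
  unfolding gbinomial_mult_fact by simp

lemma powr_taylor_bound:
  fixes a :: complex
  assumes "Re a \<le> real N + 1"
  shows "norm (of_nat (Suc (Suc n)) powr a - (\<Sum>i\<le>N. (a gchoose i) * of_nat (Suc n) powr (a - of_nat i)))
     \<le> norm (a gchoose Suc N) * (fact (Suc N) / fact N) * real (Suc n) powr (Re a - real N - 1)"
proof -
  define S where "S = closed_segment (complex_of_real (real (Suc n))) (complex_of_real (real (Suc (Suc n))))"
  define f where "f = (\<lambda>i (u::complex). fact i * (a gchoose i) * u powr (a - of_nat i))"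
  define B where "B = fact (Suc N) * norm (a gchoose Suc N) * real (Suc n) powr (Re a - real N - 1)"
  have S: "\<exists>t. z = complex_of_real t \<and> t \<ge> real (Suc n)" if "z \<in> S" for z
    using that unfolding S_def closed_segment_of_real by (auto simp: closed_segment_eq_real_ivl)
  have deriv: "(f i has_field_derivative f (Suc i) x) (at x within S)" if "x \<in> S" for i x
  proof -
    from S[OF that] obtain t where t: "x = complex_of_real t" "t \<ge> real (Suc n)" by blast
    then have x: "x \<notin> \<real>\<^sub>\<le>\<^sub>0" by (simp add: complex_nonpos_Reals_iff)
    have "(f i has_field_derivative
            (fact i * (a gchoose i)) * ((a - of_nat i) * x powr (a - of_nat i - 1))) (at x within S)"
      unfolding f_def
      by (intro DERIV_cmult has_field_derivative_at_within[OF has_field_derivative_powr[OF x]])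
    also have "(fact i * (a gchoose i)) * ((a - of_nat i) * x powr (a - of_nat i - 1)) = f (Suc i) x"
      unfolding f_def gbinomial_Suc_fact by (simp add: algebra_simps)
    finally show ?thesis .
  qed
  have bound: "norm (f (Suc N) x) \<le> B" if "x \<in> S" for x
  proof -
    from S[OF that] obtain t where t: "x = complex_of_real t" "t \<ge> real (Suc n)" by blast
    have "norm (x powr (a - of_nat (Suc N))) = t powr (Re a - real N - 1)"
      using t by (subst norm_powr_real_powr) (auto simp: algebra_simps)
    also have "\<dots> \<le> real (Suc n) powr (Re a - real N - 1)"
      using t assms by (intro powr_mono2') auto
    finally show ?thesis
      unfolding f_def B_def norm_mult norm_fact by (intro mult_left_mono) auto
  qed
  have "norm (f 0 (of_nat (Suc (Suc n))) - (\<Sum>i\<le>N. f i (of_nat (Suc n)) * (of_nat (Suc (Suc n)) - of_nat (Suc n)) ^ i / fact i))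
     \<le> B * norm ((of_nat (Suc (Suc n)) :: complex) - of_nat (Suc n)) ^ Suc N / fact N"
    by (rule complex_Taylor[of S]) (use deriv bound in \<open>auto simp: S_def simp del: of_nat_Suc\<close>)
  also have "(of_nat (Suc (Suc n)) :: complex) - of_nat (Suc n) = 1" by simp
  finally show ?thesis by (simp add: f_def B_def mult_ac del: of_nat_Suc)
qed

lemma summable_Suc_powr:
  assumes "e < -1"
  shows "summable (\<lambda>n. real (Suc n) powr e)"
  using assms by (subst summable_Suc_iff) (simp add: summable_real_powr_iff)

lemma open_Re_gt: "open {s. Re s > c}"
  by (simp add: open_halfspace_Re_gt)

lemma dirichlet_series:
  obtains Z where "Z holomorphic_on {s. Re s > 1}"
    "\<And>s. Re s > 1 \<Longrightarrow> (\<lambda>n. of_nat (Suc n) powr (-s)) sums Z s"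
proof -
  have fd: "(\<lambda>s. of_nat (Suc n) powr (-s)) field_differentiable (at x)" for n and x :: complex
    by (rule holomorphic_on_imp_differentiable_at[of _ UNIV]) (auto intro!: holomorphic_intros)
  have loc: "\<exists>d h. 0 < d \<and> summable h \<and> range h \<subseteq> \<real>\<^sub>\<ge>\<^sub>0 \<and>
      (\<forall>\<^sub>F n in sequentially. \<forall>y\<in>ball x d \<inter> {s. Re s > 1}.
         norm (of_nat (Suc n) powr (-y) :: complex) \<le> cmod (h n))" if "x \<in> {s. Re s > 1}" for x
  proof -
    define d where "d = (Re x - 1) / 2"
    define h where "h = (\<lambda>n. complex_of_real (real (Suc n) powr (- 1 - d)))"
    have d: "d > 0" using that by (simp add: d_def)
    have "summable h" unfolding h_def
      by (intro summable_of_real summable_Suc_powr) (use d in auto)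
    moreover have "norm (of_nat (Suc n) powr (-y) :: complex) \<le> cmod (h n)" if "y \<in> ball x d" for n y
    proof -
      have "\<bar>Re (x - y)\<bar> < d"
        using that abs_Re_le_cmod[of "x - y"] by (simp add: dist_norm)
      then have "Re x - Re y < d" by simp
      then have *: "- Re y \<le> - 1 - d" by (simp add: d_def field_simps)
      have "norm (of_nat (Suc n) powr (-y) :: complex) = real (Suc n) powr (- Re y)"
        by (subst norm_powr_real_powr) auto
      also have "\<dots> \<le> real (Suc n) powr (- 1 - d)" using * by (intro powr_mono) auto
      finally show ?thesis by (simp add: h_def del: of_nat_Suc)
    qed
    moreover have "range h \<subseteq> \<real>\<^sub>\<ge>\<^sub>0" by (auto simp: h_def)
    ultimately show ?thesis using d by (intro exI[of _ d] exI[of _ h]) auto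
  qed
  obtain Z where "\<forall>x \<in> {s. Re s > 1}. ((\<lambda>n. of_nat (Suc n) powr (-x)) sums Z x) \<and> Z field_differentiable (at x)"
    using series_differentiable_comparison_complex[OF open_Re_gt[of 1] fd loc] by blast
  then show ?thesis
    by (intro that[of Z]) (auto simp: holomorphic_on_def field_differentiable_at_within)
qed

lemma gbinomial_holomorphic: "(\<lambda>s. (1 - s) gchoose k) holomorphic_on A"
  unfolding gbinomial_prod_rev by (intro holomorphic_intros) auto

lemma remainder_series:
  fixes K :: nat
  obtains R where "R holomorphic_on {s. Re s > - real K}"
    "\<And>s. Re s > - real K \<Longrightarrow>
      (\<lambda>n. of_nat (Suc (Suc n)) powr (1 - s) -
        (\<Sum>i\<le>Suc K. ((1 - s) gchoose i) * of_nat (Suc n) powr (1 - s - of_nat i))) sums R s"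
proof -
  define r where "r = (\<lambda>n (s::complex). of_nat (Suc (Suc n)) powr (1 - s) -
        (\<Sum>i\<le>Suc K. ((1 - s) gchoose i) * of_nat (Suc n) powr (1 - s - of_nat i)))"
  have "r n holomorphic_on UNIV" for n
    unfolding r_def by (intro holomorphic_intros gbinomial_holomorphic)
  then have fd: "r n field_differentiable (at x)" for n x
    by (rule holomorphic_on_imp_differentiable_at) auto
  have loc: "\<exists>d h. 0 < d \<and> summable h \<and> range h \<subseteq> \<real>\<^sub>\<ge>\<^sub>0 \<and>
      (\<forall>\<^sub>F n in sequentially. \<forall>y\<in>ball x d \<inter> {s. Re s > - real K}.
         norm (r n y) \<le> cmod (h n))" if "x \<in> {s. Re s > - real K}" for x
  proof -
    define d where "d = (Re x + real K) / 2"
    have d: "d > 0" using that by (simp add: d_def)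
    have "continuous_on (cball x d) (\<lambda>s. (1 - s) gchoose Suc (Suc K))"
      by (rule holomorphic_on_imp_continuous_on[OF gbinomial_holomorphic])
    then have "bounded ((\<lambda>s. (1 - s) gchoose Suc (Suc K)) ` cball x d)"
      by (intro compact_imp_bounded compact_continuous_image) auto
    then obtain C where C: "\<And>s. s \<in> cball x d \<Longrightarrow> norm ((1 - s) gchoose Suc (Suc K)) \<le> C"
      unfolding bounded_iff by blast
    have C0: "C \<ge> 0" using C[of x] d by (meson centre_in_cball less_imp_le norm_ge_zero order_trans)
    define h where "h = (\<lambda>n. complex_of_real (C * (fact (Suc (Suc K)) / fact (Suc K)) * real (Suc n) powr (- 1 - d)))"
    have "summable h" unfolding h_def
      by (intro summable_of_real summable_mult summable_Suc_powr) (use d in auto)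
    moreover have "norm (r n y) \<le> cmod (h n)" if y: "y \<in> ball x d" for n y
    proof -
      have "\<bar>Re (x - y)\<bar> < d"
        using y abs_Re_le_cmod[of "x - y"] by (simp add: dist_norm)
      then have "Re x - Re y < d" by simp
      then have *: "- Re y - real K \<le> - d" by (simp add: d_def field_simps)
      have "norm (r n y) \<le> norm ((1 - y) gchoose Suc (Suc K)) * (fact (Suc (Suc K)) / fact (Suc K)) *
              real (Suc n) powr (Re (1 - y) - real (Suc K) - 1)"
        unfolding r_def using * d by (intro powr_taylor_bound) auto
      also have "\<dots> \<le> C * (fact (Suc (Suc K)) / fact (Suc K)) * real (Suc n) powr (- 1 - d)"
        using C[of y] y C0 * by (intro mult_mono powr_mono) auto
      also have "\<dots> = cmod (h n)"
        unfolding h_def norm_of_real using C0 by (intro abs_of_nonneg[symmetric] mult_nonneg_nonneg) auto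
      finally show ?thesis .
    qed
    moreover have "range h \<subseteq> \<real>\<^sub>\<ge>\<^sub>0"
      unfolding h_def using C0 by (auto intro!: mult_nonneg_nonneg simp del: of_real_mult of_real_divide)
    ultimately show ?thesis using d by (intro exI[of _ d] exI[of _ h]) auto
  qed
  obtain R where "\<forall>x \<in> {s. Re s > - real K}. ((\<lambda>n. r n x) sums R x) \<and> R field_differentiable (at x)"
    using series_differentiable_comparison_complex[OF open_Re_gt[of "- real K"] fd loc] by blast
  then show ?thesis
    by (intro that[of R]) (auto simp: holomorphic_on_def field_differentiable_at_within r_def)
qed

lemma tendsto_Suc_powr_zero:
  assumes "Re s > 1"
  shows "(\<lambda>n. of_nat (Suc n) powr (1 - s) :: complex) \<longlonglongrightarrow> 0"
proof (rule tendsto_norm_zero_cancel)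
  have "(\<lambda>n. real (Suc n) powr (1 - Re s)) \<longlonglongrightarrow> 0"
    by (rule tendsto_neg_powr[OF _ filterlim_compose[OF filterlim_real_sequentially filterlim_Suc]])
       (use assms in simp)
  then show "(\<lambda>n. norm (of_nat (Suc n) powr (1 - s) :: complex)) \<longlonglongrightarrow> 0"
    by (subst norm_powr_real_powr) auto
qed

lemma gbinomial_shift:
  fixes s :: complex
  shows "((1 - s) gchoose Suc (Suc i)) = - ((1 - s) gchoose Suc i) / of_nat (Suc (Suc i)) * (s + of_nat (Suc i) - 1)"
proof -
  have "of_nat (Suc (Suc i)) * ((1 - s) gchoose Suc (Suc i)) = ((1 - s) gchoose Suc i) * (1 - s - of_nat (Suc i))"
    using gbinomial_Suc_fact[of "Suc i" "1 - s"] by (simp del: of_nat_Suc add: fact_Suc mult_ac)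
  then have "((1 - s) gchoose Suc (Suc i)) = ((1 - s) gchoose Suc i) * (1 - s - of_nat (Suc i)) / of_nat (Suc (Suc i))"
    by (simp del: of_nat_Suc add: field_simps)
  then show ?thesis by (simp del: of_nat_Suc add: field_simps)
qed

lemma zeta_continuation_halfplane:
  fixes K :: nat
  assumes Z: "Z holomorphic_on {s. Re s > 1}"
    "\<And>s. Re s > 1 \<Longrightarrow> (\<lambda>n. of_nat (Suc n) powr (-s)) sums Z s"
  shows "\<exists>g. g holomorphic_on {s. Re s > 1 - real K} \<and> (\<forall>s. Re s > 1 \<longrightarrow> g s = (s - 1) * Z s)"
proof (induction K)
  case 0
  show ?case by (intro exI[of _ "\<lambda>s. (s - 1) * Z s"]) (auto intro!: holomorphic_intros Z)
next
  case (Suc K)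
  then obtain g where g: "g holomorphic_on {s. Re s > 1 - real K}" "\<And>s. Re s > 1 \<Longrightarrow> g s = (s - 1) * Z s"
    by blast
  obtain R where R: "R holomorphic_on {s. Re s > - real K}"
    "\<And>s. Re s > - real K \<Longrightarrow>
      (\<lambda>n. of_nat (Suc (Suc n)) powr (1 - s) -
        (\<Sum>i\<le>Suc K. ((1 - s) gchoose i) * of_nat (Suc n) powr (1 - s - of_nat i))) sums R s"
    using remainder_series by blast
  define G where "G = (\<lambda>s. 1 + R s + (\<Sum>i<K. - ((1 - s) gchoose Suc i) / of_nat (Suc (Suc i)) * g (s + of_nat (Suc i))))"
  have "(\<lambda>s. g (s + of_nat (Suc i))) holomorphic_on {s. Re s > - real K}" for i
    by (rule holomorphic_on_compose_gen[OF _ g(1), unfolded o_def]) (auto intro!: holomorphic_intros)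
  then have "G holomorphic_on {s. Re s > - real K}"
    unfolding G_def by (intro holomorphic_intros R gbinomial_holomorphic) auto
  moreover have "G s = (s - 1) * Z s" if s: "Re s > 1" for s
  proof -
    let ?a = "\<lambda>n. of_nat (Suc n) powr (1 - s) :: complex"
    have "(\<lambda>n. ?a (Suc n) - ?a n) sums (0 - ?a 0)"
      by (rule telescope_sums[OF tendsto_Suc_powr_zero[OF s]])
    then have t: "(\<lambda>n. ?a (Suc n) - ?a n) sums (-1)" by simp
    have "(\<lambda>n. (?a (Suc n) - ?a n) - (1 - s) * of_nat (Suc n) powr (-s)
            - (\<Sum>i<K. ((1 - s) gchoose Suc (Suc i)) * of_nat (Suc n) powr (-(s + of_nat (Suc i)))))
       sums (-1 - (1 - s) * Z s - (\<Sum>i<K. ((1 - s) gchoose Suc (Suc i)) * Z (s + of_nat (Suc i))))"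
      by (intro sums_diff sums_sum sums_mult t Z) (use s in auto)
    also have "(\<lambda>n. (?a (Suc n) - ?a n) - (1 - s) * of_nat (Suc n) powr (-s)
            - (\<Sum>i<K. ((1 - s) gchoose Suc (Suc i)) * of_nat (Suc n) powr (-(s + of_nat (Suc i)))))
       = (\<lambda>n. of_nat (Suc (Suc n)) powr (1 - s) -
        (\<Sum>i\<le>Suc K. ((1 - s) gchoose i) * of_nat (Suc n) powr (1 - s - of_nat i)))"
      unfolding lessThan_Suc_atMost[symmetric] sum.lessThan_Suc_shift
      by (simp add: algebra_simps)
    finally have "R s = -1 - (1 - s) * Z s - (\<Sum>i<K. ((1 - s) gchoose Suc (Suc i)) * Z (s + of_nat (Suc i)))"
      using R(2)[of s] s sums_unique2 by fastforce
    moreover have "((1 - s) gchoose Suc (Suc i)) * Z (s + of_nat (Suc i)) =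
         - ((1 - s) gchoose Suc i) / of_nat (Suc (Suc i)) * g (s + of_nat (Suc i))" for i
    proof -
      have "g (s + of_nat (Suc i)) = (s + of_nat (Suc i) - 1) * Z (s + of_nat (Suc i))"
        by (rule g(2)) (use s in auto)
      then show ?thesis by (simp only: gbinomial_shift mult.assoc)
    qed
    ultimately show ?thesis unfolding G_def by (simp add: algebra_simps)
  qed
  ultimately show ?case by (intro exI[of _ G]) auto
qed

lemma holomorphic_eq_of_eq_Re_gt_1:
  assumes "f holomorphic_on S" "g holomorphic_on S" "open S" "connected S" "{s. Re s > 1} \<subseteq> S"
    and "\<And>s. Re s > 1 \<Longrightarrow> f s = g s" and "z \<in> S"
  shows "f z = g z"
proof (rule analytic_continuation_open[of "{s. Re s > 1}" S f g])
  have "2 \<in> {s. Re s > 1}" by simp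
  then show "{s. Re s > 1} \<noteq> {}" by blast
qed (use assms open_Re_gt in auto)

lemma zeta_ex1:
  "\<exists>!f. f holomorphic_on - {1} \<and> (\<forall>s. Re s > 1 \<longrightarrow> f s = (\<Sum>n. 1 / of_nat (Suc n) powr s)) \<and> f 1 = 0"
proof (rule ex_ex1I)
  obtain Z where Z: "Z holomorphic_on {s. Re s > 1}"
    "\<And>s. Re s > 1 \<Longrightarrow> (\<lambda>n. of_nat (Suc n) powr (-s)) sums Z s"
    using dirichlet_series by blast
  obtain g where g: "\<And>K::nat. g K holomorphic_on {s. Re s > 1 - real K}"
     "\<And>K s. Re s > 1 \<Longrightarrow> g K s = (s - 1) * Z s"
    using zeta_continuation_halfplane[OF Z] by metis
  have le: "g K z = g L z" if "K \<le> L" "Re z > 1 - real K" for K L z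
  proof (rule holomorphic_eq_of_eq_Re_gt_1[of "g K" "{s. Re s > 1 - real K}" "g L"])
    show "g K holomorphic_on {s. Re s > 1 - real K}" by (rule g(1))
    show "g L holomorphic_on {s. Re s > 1 - real K}"
      by (rule holomorphic_on_subset[OF g(1)]) (use that in auto)
    show "connected {s. Re s > 1 - real K}"
      by (intro convex_connected convex_halfspace_Re_gt)
  qed (use that g(2) open_Re_gt in auto)
  have eq: "g K z = g L z" if "Re z > 1 - real K" "Re z > 1 - real L" for K L z
  proof (cases "K \<le> L")
    case True
    then show ?thesis using that(1) by (rule le)
  next
    case False
    then have "L \<le> K" by simp
    then show ?thesis using that(2) by (rule le[symmetric])
  qed
  define k where "k = (\<lambda>s. nat \<lceil>2 - Re s\<rceil>)"
  have k: "Re s > 1 - real (k s)" for s unfolding k_def by linarith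
  define G where "G = (\<lambda>s. g (k s) s)"
  have "G holomorphic_on UNIV"
  proof (subst holomorphic_on_open)
    show "\<forall>x\<in>UNIV. \<exists>f'. (G has_field_derivative f') (at x)"
    proof
      fix x :: complex
      obtain f' where f': "(g (k x) has_field_derivative f') (at x)"
        using g(1)[of "k x"] k[of x] open_Re_gt holomorphic_on_open by blast
      have "(G has_field_derivative f') (at x)"
      proof (rule has_field_derivative_transform_within_open[OF f' open_Re_gt[of "1 - real (k x)"]])
        show "x \<in> {s. Re s > 1 - real (k x)}" using k[of x] by simp
      next
        fix y assume "y \<in> {s. Re s > 1 - real (k x)}"
        then have "Re y > 1 - real (k x)" by simp
        then show "g (k x) y = G y" unfolding G_def using k[of y] by (rule eq)
      qed
      then show "\<exists>f'. (G has_field_derivative f') (at x)" by blast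
    qed
  qed auto
  then have "G holomorphic_on - {1}" by (rule holomorphic_on_subset) simp
  then have hol: "(\<lambda>s. G s / (s - 1)) holomorphic_on - {1}"
    by (intro holomorphic_intros) auto
  have ser: "G s / (s - 1) = (\<Sum>n. 1 / of_nat (Suc n) powr s)" if "Re s > 1" for s
  proof -
    have "s \<noteq> 1" using that by auto
    then have "G s / (s - 1) = Z s" using g(2)[OF that] by (simp add: G_def)
    also have "\<dots> = (\<Sum>n. 1 / of_nat (Suc n) powr s)"
      using sums_unique[OF Z(2)[OF that]] by (simp add: powr_minus divide_inverse del: of_nat_Suc)
    finally show ?thesis .
  qed
  show "\<exists>f. f holomorphic_on - {1} \<and> (\<forall>s. Re s > 1 \<longrightarrow> f s = (\<Sum>n. 1 / of_nat (Suc n) powr s)) \<and> f (1::complex) = (0::complex)"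
    by (intro exI[of _ "\<lambda>s. G s / (s - 1)"]) (use hol ser in auto)
next
  fix f g :: "complex \<Rightarrow> complex"
  assume f: "f holomorphic_on - {1} \<and> (\<forall>s. Re s > 1 \<longrightarrow> f s = (\<Sum>n. 1 / of_nat (Suc n) powr s)) \<and> f 1 = 0"
    and g: "g holomorphic_on - {1} \<and> (\<forall>s. Re s > 1 \<longrightarrow> g s = (\<Sum>n. 1 / of_nat (Suc n) powr s)) \<and> g 1 = 0"
  show "f = g"
  proof
    fix z
    show "f z = g z"
    proof (cases "z = 1")
      case False
      show ?thesis
        by (rule holomorphic_eq_of_eq_Re_gt_1[of f "- {1}" g])
           (use f g False in \<open>auto intro: connected_punctured_universe\<close>)
    qed (use f g in auto)
  qed
qed

text \<open>
  The Riemann zeta function is the analytic continuation of its Dirichlet series to the plane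
  punctured at the pole \<open>1\<close>; the value \<open>0\<close> at the pole is a convention that makes
  the function unique (see \<open>zeta_ex1\<close>).
\<close>

definition zeta :: "complex \<Rightarrow> complex" where
  "zeta = (THE f. f holomorphic_on - {1} \<and>
     (\<forall>s. Re s > 1 \<longrightarrow> f s = (\<Sum>n. 1 / of_nat (Suc n) powr s)) \<and> f 1 = 0)"

lemma zeta_holomorphic: "zeta holomorphic_on - {1}"
  and zeta_series: "Re s > 1 \<Longrightarrow> zeta s = (\<Sum>n. 1 / of_nat (Suc n) powr s)"
  and zeta_1: "zeta 1 = 0"
  using theI'[OF zeta_ex1] unfolding zeta_def[symmetric] by auto

text \<open>The point \<open>1\<close> must be excluded because \<open>zeta 1 = 0\<close> is an artefact.\<close>

definition nontrivial_zeta_zeros :: "complex set" where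
  "nontrivial_zeta_zeros = {s. s \<noteq> 1 \<and> zeta s = 0 \<and> 0 \<le> Re s \<and> Re s \<le> 1}"

definition riemann_hypothesis :: bool where
  "riemann_hypothesis \<longleftrightarrow> (\<forall>s\<in>nontrivial_zeta_zeros. Re s = 1/2)"

definition nonreal_zeta_deriv_zeros :: "complex set" where
  "nonreal_zeta_deriv_zeros = {s. Im s \<noteq> 0 \<and> deriv zeta s = 0}"

text \<open>
  The sequence lists the non-trivial zeros in the upper half-plane by non-decreasing ordinate, each
  zero as many times as its multiplicity. Indices start at \<open>0\<close>, so \<open>\<rho> n\<close> is the
  \<open>(n + 1)\<close>-st zero. As a zero has positive order, \<open>card\<close> here is never the \<open>0\<close>
  assigned to infinite sets.
\<close>

definition upper_zeta_zeros_enumeration :: "(nat \<Rightarrow> complex) \<Rightarrow> bool" where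
  "upper_zeta_zeros_enumeration \<rho> \<longleftrightarrow>
     (\<forall>n. \<rho> n \<in> nontrivial_zeta_zeros \<and> Im (\<rho> n) > 0) \<and>
     (\<forall>z\<in>nontrivial_zeta_zeros. Im z > 0 \<longrightarrow> int (card {n. \<rho> n = z}) = zorder zeta z) \<and>
     incseq (\<lambda>n. Im (\<rho> n))"

end

theory Submission
  imports Defs
begin

text \<open>
  The contrapositive is proved. Suppose that the gaps between consecutive ordinates satisfy
  \<open>(\<gamma>\<^sub>n\<^sub>+\<^sub>1 - \<gamma>\<^sub>n) ln \<gamma>\<^sub>n \<ge> c > 0\<close> from some point on. Then all high zeros are simple and, near height \<open>t\<close>, they are
  \<open>\<eta>\<close>-separated with \<open>\<eta>\<close> of order \<open>1 / L\<close>, where \<open>L = ln t\<close>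
  (\<open>separated_zeros_if_large_gaps\<close>).
  Let \<open>s = 1/2 + \<delta> + i t\<close> be a zero of the derivative. The zeros \<open>z\<close> of zeta in a fixed disc around \<open>2 + i t\<close>
  account for the logarithmic derivative up to a holomorphic remainder,
  \<open>\<zeta>'/\<zeta> = F + \<Sum> 1 / (s - z)\<close> with \<open>F = O(L)\<close> (\<open>logderiv_zeta_near_zeros\<close>), and
  \<open>Re F \<le> - L / 4\<close> at \<open>1/2 + i t\<close> (\<open>Re_regular_part_le\<close>). Let \<open>z\<^sub>0\<close> be the zero nearest to \<open>s\<close>. The separation
  bounds the sum of \<open>1 / |s - z|\<close> over the other zeros by \<open>O(L ln L)\<close>, and the sum of
  \<open>1 / |s - z|\<^sup>2\<close> by \<open>O(L\<^sup>2)\<close>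
  (\<open>far_zeros_sums_le\<close>). At \<open>s\<close> the left-hand side vanishes, and this says two contradictory things
  about the nearest zero if \<open>\<delta> L (ln L)\<^sup>2\<close> is small: taking absolute values, \<open>1 / |s - z\<^sub>0|\<close>
  is at most \<open>O(L ln L)\<close>, while taking real parts, \<open>\<delta> / |s - z\<^sub>0|\<^sup>2\<close> is at least
  \<open>L / 16\<close>. Together they force
  \<open>\<delta> \<ge> e / (L (ln L)\<^sup>2)\<close> for a constant \<open>e > 0\<close> (\<open>deriv_zeros_away_from_line\<close>).

  The bound \<open>F = O(L)\<close> follows from polynomial growth of zeta (\<open>zeta_growth\<close>), a lower bound at
  \<open>2 + i t\<close>, and the Borel--Caratheodory inequality; the number of zeros in the disc is \<open>O(L)\<close> simply because they
  are separated. The sign of \<open>Re F\<close> comes from the functional equation: on the critical line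
  \<open>Re (\<zeta>'/\<zeta>)\<close> equals a digamma term of size \<open>- L / 2\<close>
  (\<open>Re_zeta_logderiv_critical_line\<close>, \<open>Re_Digamma_ge\<close>), and the terms \<open>1 / (s - z)\<close> are purely
  imaginary there.

  For the functional equation, the function \<open>1/x - 1/(e\<^sup>x - 1)\<close> is written in two ways as
  \<open>\<Sum>\<^sub>n \<integral> (k(x,u) - k(x,n)) du\<close> with \<open>u\<close> running over \<open>(n - 1, n)\<close> and \<open>k\<close> decreasing in \<open>u\<close>: with
  \<open>k(x,u) = exp (- u x)\<close>, and, by the partial fractions of the hyperbolic cotangent, with
  \<open>k(x,u) = 2 x / (x\<^sup>2 + (2 \<pi> u)\<^sup>2)\<close>. The Mellin transform in \<open>x\<close> of either kernel is a multiple of a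
  power \<open>u powr (- w)\<close>, with \<open>w = s\<close> and \<open>w = 1 - s\<close> respectively, and
  \<open>\<Sum>\<^sub>n \<integral> (u powr (- w) - n powr (- w)) du = - \<zeta> w\<close> (\<open>mellin_zeta\<close>). For
  real \<open>s\<close> in \<open>(0, 1)\<close> all integrands are nonnegative, so every interchange is Tonelli's theorem; analytic
  continuation extends the result to the critical strip.
\<close>

section \<open>The zeta function to the right of the imaginary axis\<close>

text \<open>
  The first-order remainder series from the construction of the continuation converges for \<open>Re s > 0\<close>, so the identity
  that it satisfies for \<open>Re s > 1\<close> persists there. The partial sum formula and the growth bound are read off from it.
\<close>

lemma zeta_eq_remainder:
  obtains R where "R holomorphic_on {s. Re s > 0}"
    "\<And>s. Re s > 0 \<Longrightarrow> (\<lambda>n. of_nat (Suc (Suc n)) powr (1 - s) - of_nat (Suc n) powr (1 - s)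
        - (1 - s) * of_nat (Suc n) powr (- s)) sums R s"
    "\<And>s. Re s > 0 \<Longrightarrow> (s - 1) * zeta s = (if s = 1 then 0 else 1 + R s)"
proof -
  obtain R where R: "R holomorphic_on {s. Re s > 0}"
    and sums: "\<And>s. Re s > 0 \<Longrightarrow> (\<lambda>n. of_nat (Suc (Suc n)) powr (1 - s) -
        (\<Sum>i\<le>Suc 0. ((1 - s) gchoose i) * of_nat (Suc n) powr (1 - s - of_nat i))) sums R s"
    using remainder_series[of 0] by auto
  have sums': "(\<lambda>n. of_nat (Suc (Suc n)) powr (1 - s) - of_nat (Suc n) powr (1 - s)
        - (1 - s) * of_nat (Suc n) powr (- s)) sums R s" if "Re s > 0" for s
    using sums[OF that] by (simp add: diff_diff_eq)
  have right: "(s - 1) * zeta s = 1 + R s" if s: "Re s > 1" for s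
  proof -
    let ?a = "\<lambda>n. of_nat (Suc n) powr (1 - s) :: complex"
    obtain Z where Z: "\<And>s. Re s > 1 \<Longrightarrow> (\<lambda>n. of_nat (Suc n) powr (-s)) sums Z s"
      using dirichlet_series by blast
    have "zeta s = Z s"
      using zeta_series[OF s] sums_unique[OF Z[OF s]]
      by (simp add: powr_minus divide_inverse del: of_nat_Suc)
    then have Zs: "(\<lambda>n. of_nat (Suc n) powr (-s)) sums zeta s" using Z[OF s] by simp
    have "(\<lambda>n. ?a (Suc n) - ?a n) sums (0 - ?a 0)"
      by (rule telescope_sums[OF tendsto_Suc_powr_zero[OF s]])
    then have "(\<lambda>n. (?a (Suc n) - ?a n) - (1 - s) * of_nat (Suc n) powr (-s)) sums (- 1 - (1 - s) * zeta s)"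
      by (intro sums_diff sums_mult Zs) simp
    then have "R s = - 1 - (1 - s) * zeta s"
      using sums'[of s] s sums_unique2 by fastforce
    then show ?thesis by (simp add: algebra_simps)
  qed
  have eq: "zeta s = (1 + R s) / (s - 1)" if "Re s > 0" "s \<noteq> 1" for s
  proof (rule holomorphic_eq_of_eq_Re_gt_1[of zeta "{s. Re s > 0} - {1}" "\<lambda>s. (1 + R s) / (s - 1)"])
    show "zeta holomorphic_on {s. 0 < Re s} - {1}"
      by (rule holomorphic_on_subset[OF zeta_holomorphic]) auto
    show "(\<lambda>s. (1 + R s) / (s - 1)) holomorphic_on {s. 0 < Re s} - {1}"
      by (intro holomorphic_intros holomorphic_on_subset[OF R]) auto
    show "open ({s. 0 < Re s} - {1})"
      by (intro open_Diff open_Re_gt) auto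
    show "connected ({s::complex. 0 < Re s} - {1})"
      by (intro connected_open_delete open_Re_gt convex_connected convex_halfspace_Re_gt) auto
    show "zeta s = (1 + R s) / (s - 1)" if "1 < Re s" for s
    proof -
      have "s - 1 \<noteq> 0" using that by auto
      then show ?thesis using right[OF that] by (metis nonzero_mult_div_cancel_left)
    qed
  qed (use that in auto)
  show ?thesis
    by (rule that[OF R sums']) (use eq in auto)
qed

lemma zeta_partial_sums_tendsto:
  assumes "Re s > 0" "s \<noteq> 1"
  shows "(\<lambda>N. (\<Sum>n<N. of_nat (Suc n) powr (- s)) - of_nat (Suc N) powr (1 - s) / (1 - s)) \<longlonglongrightarrow> zeta s"
proof -
  obtain R where "R holomorphic_on {s. Re s > 0}"
    and R0: "\<And>s. Re s > 0 \<Longrightarrow> (\<lambda>n. of_nat (Suc (Suc n)) powr (1 - s) - of_nat (Suc n) powr (1 - s)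
        - (1 - s) * of_nat (Suc n) powr (- s)) sums R s"
     "\<And>s. Re s > 0 \<Longrightarrow> (s - 1) * zeta s = (if s = 1 then 0 else 1 + R s)"
    by (rule zeta_eq_remainder) (rule that)
  note R = R0(1)[OF assms(1)] R0(2)[OF assms(1), unfolded if_not_P[OF assms(2)]]
  have *: "(\<Sum>n<N. of_nat (Suc (Suc n)) powr (1 - s) - of_nat (Suc n) powr (1 - s)
        - (1 - s) * of_nat (Suc n) powr (- s)) = of_nat (Suc N) powr (1 - s) - 1
        - (1 - s) * (\<Sum>n<N. of_nat (Suc n) powr (- s))" for N
    by (induction N) (simp_all add: algebra_simps)
  have "(\<lambda>N. (1 + (of_nat (Suc N) powr (1 - s) - 1 - (1 - s) * (\<Sum>n<N. of_nat (Suc n) powr (- s)))) / (s - 1))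
      \<longlonglongrightarrow> (1 + R s) / (s - 1)"
    using R(1) assms(2) unfolding sums_def * by (intro tendsto_intros) auto
  moreover have "(1 + R s) / (s - 1) = zeta s" using R(2) assms(2) by (simp add: field_simps)
  moreover have "(1 + (of_nat (Suc N) powr (1 - s) - 1 - (1 - s) * (\<Sum>n<N. of_nat (Suc n) powr (- s)))) / (s - 1)
      = (\<Sum>n<N. of_nat (Suc n) powr (- s)) - of_nat (Suc N) powr (1 - s) / (1 - s)" for N
    using assms(2) by (simp add: divide_simps) (simp add: algebra_simps)
  ultimately show ?thesis by simp
qed

lemma zeta_cnj:
  assumes "Re s > 0"
  shows "zeta (cnj s) = cnj (zeta s)"
proof (cases "s = 1")
  case False
  have *: "cnj (of_nat (Suc n) powr z) = of_nat (Suc n) powr cnj z" for n z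
    by (subst cnj_powr) (simp_all del: of_nat_Suc)
  have "(\<lambda>N. cnj ((\<Sum>n<N. of_nat (Suc n) powr (- s)) - of_nat (Suc N) powr (1 - s) / (1 - s)))
          \<longlonglongrightarrow> cnj (zeta s)"
    by (intro tendsto_cnj zeta_partial_sums_tendsto assms False)
  then have "(\<lambda>N. (\<Sum>n<N. of_nat (Suc n) powr (- cnj s)) - of_nat (Suc N) powr (1 - cnj s) / (1 - cnj s))
          \<longlonglongrightarrow> cnj (zeta s)"
    by (simp add: * del: of_nat_Suc)
  moreover have "cnj s \<noteq> 1" using False by (metis complex_cnj_cnj complex_cnj_one)
  ultimately show ?thesis
    using zeta_partial_sums_tendsto[of "cnj s"] assms LIMSEQ_unique by fastforce
qed (simp add: zeta_1)

lemma deriv_zeta_cnj: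
  assumes "Re s > 0" "s \<noteq> 1"
  shows "deriv zeta (cnj s) = cnj (deriv zeta s)"
proof -
  have "(zeta has_field_derivative deriv zeta s) (at s)"
    using assms holomorphic_derivI[OF zeta_holomorphic, of s] by auto
  then have "((cnj \<circ> zeta \<circ> cnj) has_field_derivative cnj (deriv zeta s)) (at (cnj s))"
    using has_field_derivative_cnj_cnj by fastforce
  then have "(zeta has_field_derivative cnj (deriv zeta s)) (at (cnj s))"
  proof (rule has_field_derivative_transform_within_open[OF _ open_Re_gt[of 0]])
    fix x assume "x \<in> {s. 0 < Re s}"
    then show "(cnj \<circ> zeta \<circ> cnj) x = zeta x" using zeta_cnj[of x] by simp
  qed (use assms in auto)
  then show ?thesis by (rule DERIV_imp_deriv)
qed

text \<open>
  Each term of the remainder series is \<open>O(|s| |s - 1| n powr (- Re s - 1))\<close> by the second-order Taylor bound, so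
  \<open>(s - 1) \<zeta> s\<close> grows at most quadratically.
\<close>

lemma zeta_growth:
  obtains C where "C \<ge> 1" "\<And>s. Re s \<ge> 1/10 \<Longrightarrow> \<bar>Im s\<bar> \<ge> 1 \<Longrightarrow> norm (zeta s) \<le> C * norm s"
proof -
  obtain R where "R holomorphic_on {s. Re s > 0}"
    and R: "\<And>s. Re s > 0 \<Longrightarrow> (\<lambda>n. of_nat (Suc (Suc n)) powr (1 - s) - of_nat (Suc n) powr (1 - s)
        - (1 - s) * of_nat (Suc n) powr (- s)) sums R s" 
     "\<And>s. Re s > 0 \<Longrightarrow> (s - 1) * zeta s = (if s = 1 then 0 else 1 + R s)"
    by (rule zeta_eq_remainder) (rule that)
  define A where "A = (\<Sum>n. real (Suc n) powr (-11/10))"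
  have summ: "summable (\<lambda>n. real (Suc n) powr (-11/10))" by (rule summable_Suc_powr) simp
  have A0: "A \<ge> 0" unfolding A_def by (intro suminf_nonneg summ) auto
  show ?thesis
  proof (rule that[of "1 + A"])
    fix s assume s: "Re s \<ge> 1/10" "\<bar>Im s\<bar> \<ge> 1"
    have s1: "norm (s - 1) \<ge> 1" and s0: "norm s \<ge> 1"
      using abs_Im_le_cmod[of "s - 1"] abs_Im_le_cmod[of s] s by auto
    have step: "norm (of_nat (Suc (Suc n)) powr (1 - s) - of_nat (Suc n) powr (1 - s)
        - (1 - s) * of_nat (Suc n) powr (- s)) \<le> norm s * norm (s - 1) * real (Suc n) powr (-11/10)" for n
    proof -
      have a: "norm (of_nat (Suc (Suc n)) powr (1 - s) - (\<Sum>i\<le>1. ((1 - s) gchoose i) * of_nat (Suc n) powr (1 - s - of_nat i)))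
     \<le> norm ((1 - s) gchoose Suc 1) * (fact (Suc 1) / fact 1) * real (Suc n) powr (Re (1 - s) - real 1 - 1)"
        by (rule powr_taylor_bound) (use s in auto)
      have b: "norm ((1 - s) gchoose Suc 1) * (fact (Suc 1) / fact 1) = norm s * norm (s - 1)"
      proof -
        have "2 * ((1 - s) gchoose Suc 1) = (1 - s) * (- s)"
          using gbinomial_Suc_fact[of 1 "1 - s"] by (simp add: fact_numeral)
        then have "norm (2 * ((1 - s) gchoose Suc 1)) = norm (1 - s) * norm s"
          by (simp only: norm_mult norm_minus_cancel)
        then show ?thesis by (simp add: norm_mult norm_minus_commute mult.commute)
      qed
      have c: "real (Suc n) powr (Re (1 - s) - real 1 - 1) \<le> real (Suc n) powr (-11/10)"
        by (intro powr_mono) (use s in auto)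
      have "norm (of_nat (Suc (Suc n)) powr (1 - s) - (\<Sum>i\<le>1. ((1 - s) gchoose i) * of_nat (Suc n) powr (1 - s - of_nat i)))
         \<le> norm s * norm (s - 1) * real (Suc n) powr (-11/10)"
        by (rule order_trans[OF a[unfolded b] mult_left_mono[OF c]]) simp
      then show ?thesis by (simp add: diff_diff_eq)
    qed
    have "norm (R s) \<le> (\<Sum>n. norm s * norm (s - 1) * real (Suc n) powr (-11/10))"
    proof -
      have "R s = (\<Sum>n. of_nat (Suc (Suc n)) powr (1 - s) - of_nat (Suc n) powr (1 - s)
        - (1 - s) * of_nat (Suc n) powr (- s))" using R(1)[of s] s by (simp add: sums_iff)
      moreover have "norm (\<Sum>n. of_nat (Suc (Suc n)) powr (1 - s) - of_nat (Suc n) powr (1 - s)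
        - (1 - s) * of_nat (Suc n) powr (- s)) \<le> (\<Sum>n. norm s * norm (s - 1) * real (Suc n) powr (-11/10))"
        by (rule norm_suminf_le[OF step summable_mult[OF summ]])
      ultimately show ?thesis by simp
    qed
    also have "\<dots> = norm s * norm (s - 1) * A"
      unfolding A_def by (rule suminf_mult[OF summ])
    finally have RA: "norm (R s) \<le> norm s * norm (s - 1) * A" .
    have "(s - 1) * zeta s = 1 + R s" using R(2)[of s] s by auto
    then have "norm (s - 1) * norm (zeta s) = norm (1 + R s)" by (metis norm_mult)
    also have "\<dots> \<le> 1 + norm s * norm (s - 1) * A" using RA norm_triangle_ineq[of 1 "R s"] by simp
    also have "\<dots> \<le> norm s * norm (s - 1) + norm s * norm (s - 1) * A"
      using s1 s0 mult_mono[of 1 "norm s" 1 "norm (s - 1)"] by simp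
    also have "\<dots> = norm (s - 1) * ((1 + A) * norm s)" by (simp add: algebra_simps)
    finally show "norm (zeta s) \<le> (1 + A) * norm s" using s1
      by (auto simp: mult_le_cancel_left)
  qed (use A0 in auto)
qed

text \<open>
  Here \<open>|\<zeta> s - 1| \<le> \<pi>\<^sup>2 / 6 - 1 \<le> 4 / 5\<close>.
\<close>

lemma zeta_lower_bound_Re_2:
  assumes "Re s = 2"
  shows "norm (zeta s) \<ge> 1/5"
proof -
  have eq: "(\<lambda>n. 1 / (real n + 1)\<^sup>2) sums (pi\<^sup>2 / 6)" using inverse_squares_sums by (simp add: add.commute)
  have nrm: "norm (1 / of_nat (Suc n) powr s :: complex) = 1 / (real n + 1)\<^sup>2" for n
  proof -
    have "norm (of_nat (Suc n) powr s :: complex) = real (Suc n) powr 2"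
      by (subst norm_powr_real_powr) (auto simp: assms)
    then show ?thesis by (simp add: norm_divide add.commute)
  qed
  have summ: "summable (\<lambda>n. 1 / of_nat (Suc n) powr s :: complex)"
    by (rule summable_norm_cancel) (simp only: nrm sums_summable[OF eq])
  have "(\<lambda>n. 1 / (real (Suc n) + 1)\<^sup>2) sums (pi\<^sup>2 / 6 - 1)"
    using eq by (subst sums_Suc_iff) simp
  then have tl: "(\<lambda>n. norm (1 / of_nat (Suc (Suc n)) powr s :: complex)) sums (pi\<^sup>2 / 6 - 1)"
    by (simp only: nrm)
  have "zeta s = 1 + (\<Sum>n. 1 / of_nat (Suc (Suc n)) powr s)"
    using zeta_series[of s] suminf_split_head[OF summ] assms by simp
  moreover have "norm (\<Sum>n. 1 / of_nat (Suc (Suc n)) powr s :: complex) \<le> pi\<^sup>2 / 6 - 1"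
    using summable_norm[OF sums_summable[OF tl]] sums_unique[OF tl] by simp
  moreover have "pi\<^sup>2 / 6 - 1 \<le> 4/5"
  proof -
    have "pi < 3.2" using pi_approx by simp
    then have "pi\<^sup>2 \<le> 3.2\<^sup>2" by (intro power_mono) auto
    then show ?thesis by (simp add: power2_eq_square)
  qed
  ultimately show ?thesis
    using norm_triangle_ineq4[of "zeta s" "\<Sum>n. 1 / of_nat (Suc (Suc n)) powr s"] by simp
qed

section \<open>Absence of zeros with real part greater than 1\<close>

text \<open>
  What is left of the positive integers after the sieve of Eratosthenes has removed the multiples of \<open>P\<close>.
\<close>

definition unsieved :: "nat set \<Rightarrow> nat set" where
  "unsieved P = {n. n > 0 \<and> (\<forall>p\<in>P. \<not> p dvd n)}"

lemma summable_on_nat_powr: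
  assumes "Re s > 1"
  shows "(\<lambda>n. of_nat n powr (- s) :: complex) summable_on A"
proof -
  have "(\<lambda>n. norm (of_nat n powr (- s) :: complex)) summable_on UNIV"
  proof (subst summable_on_UNIV_nonneg_real_iff)
    have "summable (\<lambda>n. real n powr (- Re s))"
      using assms by (simp add: summable_real_powr_iff)
    moreover have "norm (of_nat n powr (- s) :: complex) = real n powr (- Re s)" for n
      by (cases "n = 0") (auto simp: norm_powr_real_powr)
    ultimately show "summable (\<lambda>n. norm (of_nat n powr (- s) :: complex))" by simp
  qed auto
  then have "(\<lambda>n. of_nat n powr (- s) :: complex) summable_on UNIV"
    by (rule abs_summable_summable)
  then show ?thesis
    by (rule summable_on_subset_banach) simp
qed

lemma zeta_eq_infsum:
  assumes "Re s > 1"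
  shows "zeta s = infsum (\<lambda>n. of_nat n powr (- s)) {0<..}"
proof -
  have bij: "bij_betw Suc UNIV {0<..}"
    by (rule bij_betwI[of _ _ _ "\<lambda>n. n - 1"]) auto
  have s': "(\<lambda>n. of_nat (Suc n) powr (- s) :: complex) summable_on UNIV"
    using summable_on_reindex_bij_betw[OF bij, of "\<lambda>n. of_nat n powr (- s) :: complex"]
      summable_on_nat_powr[OF assms] by simp
  have "infsum (\<lambda>n. of_nat n powr (- s) :: complex) {0<..} = infsum (\<lambda>n. of_nat (Suc n) powr (- s)) UNIV"
    using infsum_reindex_bij_betw[OF bij, of "\<lambda>n. of_nat n powr (- s) :: complex"] by simp
  also have "\<dots> = (\<Sum>n. of_nat (Suc n) powr (- s))"
    using has_sum_imp_sums[OF has_sum_infsum[OF s']] by (simp add: sums_iff)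
  finally show ?thesis
    using zeta_series[OF assms] by (simp add: powr_minus divide_inverse del: of_nat_Suc)
qed

text \<open>
  The multiples of \<open>p\<close> that survive the sieve by \<open>P\<close> are exactly \<open>p\<close> times the survivors, so they contribute the
  factor \<open>p powr (- s)\<close>.
\<close>

lemma sieve_step:
  assumes s: "Re s > 1" and p: "prime p" and P: "\<And>q. q \<in> P \<Longrightarrow> prime q" "p \<notin> P"
  shows "infsum (\<lambda>n. of_nat n powr (- s)) (unsieved (insert p P))
       = (1 - of_nat p powr (- s)) * (infsum (\<lambda>n. of_nat n powr (- s)) (unsieved P) :: complex)"
proof -
  let ?f = "\<lambda>n. of_nat n powr (- s) :: complex"
  have p0: "p > 0" using p by (simp add: prime_gt_0_nat)
  have inj: "inj_on ((*) p) (unsieved P)" using p0 by (auto simp: inj_on_def)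
  have ndvd: "\<not> q dvd p" if "q \<in> P" for q
    using P that p primes_dvd_imp_eq by blast
  have split: "unsieved P = unsieved (insert p P) \<union> (*) p ` unsieved P"
  proof (intro equalityI subsetI)
    fix n assume n: "n \<in> unsieved P"
    show "n \<in> unsieved (insert p P) \<union> (*) p ` unsieved P"
    proof (cases "p dvd n")
      case True
      then obtain m where m: "n = p * m" by blast
      then have "m \<in> unsieved P" using n by (auto simp: unsieved_def)
      then show ?thesis using m by blast
    qed (use n in \<open>auto simp: unsieved_def\<close>)
  next
    fix n assume "n \<in> unsieved (insert p P) \<union> (*) p ` unsieved P"
    then show "n \<in> unsieved P"
      using P p0 ndvd by (auto simp: unsieved_def prime_dvd_mult_iff)
  qed
  have disj: "unsieved (insert p P) \<inter> (*) p ` unsieved P = {}"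
    by (auto simp: unsieved_def)
  have "infsum ?f (unsieved P) = infsum ?f (unsieved (insert p P)) + infsum ?f ((*) p ` unsieved P)"
    by (subst split, rule infsum_Un_disjoint[OF _ _ disj]) (rule summable_on_nat_powr[OF s])+
  also have "infsum ?f ((*) p ` unsieved P) = infsum (\<lambda>m. of_nat p powr (- s) * ?f m) (unsieved P)"
    unfolding infsum_reindex[OF inj] o_def
    by (intro infsum_cong) (auto simp: powr_times_real)
  also have "\<dots> = of_nat p powr (- s) * infsum ?f (unsieved P)"
    by (rule infsum_cmult_right) (rule summable_on_nat_powr[OF s])
  finally show ?thesis by (simp add: algebra_simps)
qed

lemma sieve_product:
  assumes s: "Re s > 1" and "finite P" "\<And>q. q \<in> P \<Longrightarrow> prime q"
  shows "infsum (\<lambda>n. of_nat n powr (- s)) (unsieved P) = (\<Prod>p\<in>P. 1 - of_nat p powr (- s)) * zeta s"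
  using assms(2,3)
proof (induction P rule: finite_induct)
  case empty
  have "unsieved {} = {0<..}" by (auto simp: unsieved_def)
  then show ?case using zeta_eq_infsum[OF s] by simp
next
  case (insert p P)
  then show ?case using sieve_step[OF s, of p P] by simp
qed

text \<open>
  Sieve by all primes below \<open>N\<close>. If zeta vanished, the sum over the survivors would be \<open>0\<close>; but the survivors
  are \<open>1\<close> and integers \<open>\<ge> N\<close>, whose contribution tends to \<open>0\<close>.
\<close>

lemma zeta_nonzero_Re_gt_1:
  assumes s: "Re s > 1"
  shows "zeta s \<noteq> 0"
proof
  assume z: "zeta s = 0"
  let ?f = "\<lambda>n. of_nat n powr (- s) :: complex"
  let ?g = "\<lambda>n. real n powr (- Re s)"
  have nf: "norm (?f n) = ?g n" for n by (cases "n = 0") (auto simp: norm_powr_real_powr)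
  have sg: "summable ?g" using s by (simp add: summable_real_powr_iff)
  have gsum: "?g summable_on A" for A
    using summable_on_subset_banach[of ?g UNIV A] sg summable_on_UNIV_nonneg_real_iff[of ?g] by auto
  have bound: "1 \<le> (\<Sum>n. ?g (n + N))" if N: "N \<ge> 2" for N
  proof -
    define P where "P = {p. prime p \<and> p < N}"
    have fin: "finite P" unfolding P_def by simp
    have 1: "1 \<in> unsieved P" by (auto simp: unsieved_def P_def)
    have sub: "unsieved P - {1} \<subseteq> {N..}"
    proof
      fix n assume n: "n \<in> unsieved P - {1}"
      then obtain p where p: "prime p" "p dvd n" using prime_factor_nat[of n] by auto
      then have "\<not> p < N" using n by (auto simp: unsieved_def P_def)
      moreover have "p \<le> n" using p n by (intro dvd_imp_le) (auto simp: unsieved_def)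
      ultimately show "n \<in> {N..}" by simp
    qed
    have "0 = infsum ?f (unsieved P)"
      using sieve_product[OF s fin] z by (simp add: P_def)
    also have "\<dots> = infsum ?f (insert 1 (unsieved P - {1}))" using 1 by (simp add: insert_absorb)
    also have "\<dots> = ?f 1 + infsum ?f (unsieved P - {1})"
      by (rule infsum_insert) (auto intro: summable_on_nat_powr[OF s])
    finally have "infsum ?f (unsieved P - {1}) = -1" by (simp add: eq_neg_iff_add_eq_0 add.commute)
    then have "1 = norm (infsum ?f (unsieved P - {1}))" by simp
    also have "\<dots> \<le> infsum ?g (unsieved P - {1})"
      using norm_infsum_bound[of ?f "unsieved P - {1}"] by (simp add: nf gsum)
    also have "\<dots> \<le> infsum ?g {N..}"
      by (rule infsum_mono2[OF gsum gsum sub]) auto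
    also have "\<dots> = infsum (\<lambda>n. ?g (n + N)) UNIV"
      by (rule infsum_reindex_bij_betw[symmetric], rule bij_betwI[of _ _ _ "\<lambda>n. n - N"]) auto
    also have "\<dots> = (\<Sum>n. ?g (n + N))"
    proof (rule infsumI, rule norm_summable_imp_has_sum)
      have "summable (\<lambda>n. ?g (n + N))" using sg by (subst summable_iff_shift)
      then show "summable (\<lambda>n. norm (?g (n + N)))" "(\<lambda>n. ?g (n + N)) sums (\<Sum>n. ?g (n + N))"
        by (simp_all add: summable_sums del: of_nat_add)
    qed
    finally show ?thesis .
  qed
  have "(\<lambda>N. \<Sum>n. ?g (n + N)) \<longlonglongrightarrow> 0" by (rule suminf_exist_split2[OF sg])
  then have "\<forall>\<^sub>F N in sequentially. (\<Sum>n. ?g (n + N)) < 1" by (rule order_tendstoD) simp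
  then have "\<forall>\<^sub>F N in sequentially. (\<Sum>n. ?g (n + N)) < 1 \<and> N \<ge> 2"
    by (intro eventually_conj eventually_ge_at_top)
  then obtain N where "(\<Sum>n. ?g (n + N)) < 1" "N \<ge> 2"
    by (auto simp: eventually_sequentially)
  then show False using bound[of N] by simp
qed

section \<open>Mellin transforms of decreasing kernels\<close>

text \<open>
  In this arrangement each term is the nonnegative integral of \<open>u powr (- w) - (n + 1) powr (- w)\<close> over
  \<open>(n, n + 1)\<close>, which is what allows Tonelli's theorem below. The power \<open>0 powr (1 - w) = 0\<close> for \<open>n = 0\<close> is the
  correct value of the antiderivative.
\<close>

lemma zeta_real_sums:
  fixes w :: real
  assumes w: "0 < w" "w < 1"
  shows "Im (zeta (of_real w)) = 0"
    and "(\<lambda>n. (real (Suc n) powr (1 - w) - real n powr (1 - w)) / (1 - w) - real (Suc n) powr (- w))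
           sums (- Re (zeta (of_real w)))"
proof -
  have cw: "Re (complex_of_real w) > 0" "complex_of_real w \<noteq> 1" using w by auto
  have "cnj (zeta (of_real w)) = zeta (of_real w)" using zeta_cnj[OF cw(1)] by simp
  then show "Im (zeta (of_real w)) = 0" by (simp add: complex_eq_iff)
  have pw: "(of_nat (Suc n) :: complex) powr of_real y = of_real (real (Suc n) powr y)" for n y
    by (subst powr_of_real[symmetric]) auto
  have "(\<lambda>N. Re ((\<Sum>n<N. of_nat (Suc n) powr (- of_real w)) - of_nat (Suc N) powr (1 - of_real w) / (1 - of_real w)))
          \<longlonglongrightarrow> Re (zeta (of_real w))"
    by (intro tendsto_Re zeta_partial_sums_tendsto cw)
  also have "(\<lambda>N. Re ((\<Sum>n<N. of_nat (Suc n) powr (- of_real w)) - of_nat (Suc N) powr (1 - of_real w) / (1 - of_real w)))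
      = (\<lambda>N. (\<Sum>n<N. real (Suc n) powr (- w)) - real (Suc N) powr (1 - w) / (1 - w))" (is "?l = ?r")
  proof
    fix N
    have "(\<Sum>n<N. (of_nat (Suc n) :: complex) powr (- of_real w)) - of_nat (Suc N) powr (1 - of_real w) / (1 - of_real w)
       = of_real ((\<Sum>n<N. real (Suc n) powr (- w)) - real (Suc N) powr (1 - w) / (1 - w))"
      unfolding of_real_diff of_real_sum of_real_divide pw[symmetric] by simp
    then show "?l N = ?r N" by (simp only: Re_complex_of_real)
  qed
  finally have lim: "(\<lambda>N. (\<Sum>n<N. real (Suc n) powr (- w)) - real (Suc N) powr (1 - w) / (1 - w))
          \<longlonglongrightarrow> Re (zeta (of_real w))" .
  \<comment> \<open>The partial sums of the continuation formula end at the power of \<open>N + 1\<close>, those of the claim at the power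
    of \<open>N\<close>; the difference vanishes in the limit because \<open>1 - w < 1\<close>.\<close>
  have gap: "(\<lambda>N. (real (Suc N) powr (1 - w) - real N powr (1 - w)) / (1 - w)) \<longlonglongrightarrow> 0"
    using w by real_asymp
  have "(\<lambda>N. - ((\<Sum>n<N. real (Suc n) powr (- w)) - real (Suc N) powr (1 - w) / (1 - w)) -
            (real (Suc N) powr (1 - w) - real N powr (1 - w)) / (1 - w)) \<longlonglongrightarrow> - Re (zeta (of_real w)) - 0"
    by (intro tendsto_diff tendsto_minus lim gap)
  moreover have "(\<Sum>n<N. (real (Suc n) powr (1 - w) - real n powr (1 - w)) / (1 - w) - real (Suc n) powr (- w))
     = - ((\<Sum>n<N. real (Suc n) powr (- w)) - real (Suc N) powr (1 - w) / (1 - w)) -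
            (real (Suc N) powr (1 - w) - real N powr (1 - w)) / (1 - w)" for N
    by (induction N) (simp_all add: diff_divide_distrib)
  ultimately show "(\<lambda>n. (real (Suc n) powr (1 - w) - real n powr (1 - w)) / (1 - w) - real (Suc n) powr (- w))
           sums (- Re (zeta (of_real w)))"
    unfolding sums_def by simp
qed

lemma has_integral_cell_powr:
  assumes w: "0 < w" "w < 1"
  shows "((\<lambda>u. u powr (- w) - real (Suc n) powr (- w)) has_integral
     ((real (Suc n) powr (1 - w) - real n powr (1 - w)) / (1 - w) - real (Suc n) powr (- w))) {real n<..<real (Suc n)}"
proof -
  have a: "((\<lambda>x. x powr (- w)) has_integral (c powr (1 - w) / (1 - w))) {0..c}" if "c \<ge> 0" for c
    using has_integral_powr_from_0[of "- w" c] w that by (simp add: add.commute)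
  have "((\<lambda>u. u powr (- w)) has_integral (real (Suc n) powr (1 - w) / (1 - w) - real n powr (1 - w) / (1 - w)))
      {real n..real (Suc n)}"
  proof -
    have i: "(\<lambda>u. u powr (- w)) integrable_on {real n..real (Suc n)}"
      by (rule integrable_on_subinterval[OF has_integral_integrable[OF a[of "real (Suc n)"]]]) auto
    have "integral {0..real n} (\<lambda>u. u powr (- w)) + integral {real n..real (Suc n)} (\<lambda>u. u powr (- w))
        = integral {0..real (Suc n)} (\<lambda>u. u powr (- w))"
      by (rule Henstock_Kurzweil_Integration.integral_combine)
         (auto intro: has_integral_integrable[OF a[of "real (Suc n)"]] simp del: of_nat_Suc)
    then have "integral {real n..real (Suc n)} (\<lambda>u. u powr (- w)) =
        real (Suc n) powr (1 - w) / (1 - w) - real n powr (1 - w) / (1 - w)"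
      using integral_unique[OF a[of "real n"]] integral_unique[OF a[of "real (Suc n)"]] by simp
    then show ?thesis using i by (metis integrable_integral)
  qed
  then have "((\<lambda>u. u powr (- w) - real (Suc n) powr (- w)) has_integral
     (real (Suc n) powr (1 - w) / (1 - w) - real n powr (1 - w) / (1 - w) - real (Suc n) powr (- w))) {real n..real (Suc n)}"
    using has_integral_const_real[of "real (Suc n) powr (- w)" "real n" "real (Suc n)"]
    by (intro has_integral_diff) auto
  then show ?thesis by (simp add: has_integral_Icc_iff_Ioo diff_divide_distrib)
qed

text \<open>
  The left-hand side is the Mellin transform of \<open>\<Sum>\<^sub>n \<integral> (k(x,u) - k(x,n+1)) du\<close>. Since \<open>k\<close> is decreasing in
  \<open>u\<close>, everything is nonnegative and the \<open>x\<close>-integral may be taken first, where it turns \<open>k(x,u)\<close> into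
  \<open>c u powr (- w)\<close>.
\<close>

lemma mellin_zeta:
  fixes k :: "real \<Rightarrow> real \<Rightarrow> real" and I :: "real \<Rightarrow> nat \<Rightarrow> real"
  assumes w: "0 < w" "w < 1" and c: "c \<ge> 0"
    and meas [measurable]: "(\<lambda>(x, u). k x u) \<in> borel_measurable (borel \<Otimes>\<^sub>M borel)"
    and nonneg: "\<And>x u. x > 0 \<Longrightarrow> u > 0 \<Longrightarrow> k x u \<ge> 0"
    and mono: "\<And>x u v. x > 0 \<Longrightarrow> 0 < u \<Longrightarrow> u \<le> v \<Longrightarrow> k x v \<le> k x u"
    and cell: "\<And>x n. x > 0 \<Longrightarrow> (k x has_integral I x n) {real n..real (Suc n)}"
    and h: "\<And>x. x > 0 \<Longrightarrow> (\<lambda>n. I x n - k x (real (Suc n))) sums h x"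
    and mellin: "\<And>u. u > 0 \<Longrightarrow>
       (\<integral>\<^sup>+x. ennreal (x powr (s - 1) * k x u) * indicator {0<..} x \<partial>lborel) = ennreal (c * u powr (- w))"
  shows "(\<integral>\<^sup>+x. ennreal (x powr (s - 1) * h x) * indicator {0<..} x \<partial>lborel)
           = ennreal (c * (- Re (zeta (of_real w))))"
proof -
  define T where "T = (\<lambda>n x u. ennreal (x powr (s - 1) * (k x u - k x (real (Suc n)))) *
      indicator {real n<..<real (Suc n)} u * indicator {0<..} x)"
  have T [measurable]: "(\<lambda>(x, u). T n x u) \<in> borel_measurable (borel \<Otimes>\<^sub>M borel)" for n
    unfolding T_def by measurable
  have inner: "(\<integral>\<^sup>+x. T n x u \<partial>lborel) =
      ennreal c * (ennreal (u powr (- w) - real (Suc n) powr (- w)) * indicator {real n<..<real (Suc n)} u)" for n u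
  proof (cases "u \<in> {real n<..<real (Suc n)}")
    case True
    then have u: "u > 0" "u \<le> real (Suc n)" by (auto intro: le_less_trans[of 0 "real n"])
    let ?f = "\<lambda>u x. ennreal (x powr (s - 1) * k x u) * indicator {0<..} x"
    have [measurable]: "k x \<in> borel_measurable borel" "(\<lambda>x. k x u) \<in> borel_measurable borel" for x u
      using meas by measurable
    have "(\<integral>\<^sup>+x. T n x u \<partial>lborel) = (\<integral>\<^sup>+x. ?f u x - ?f (real (Suc n)) x \<partial>lborel)"
      by (intro nn_integral_cong)
         (use True nonneg in \<open>auto simp: T_def right_diff_distrib ennreal_minus indicator_def simp del: of_nat_Suc\<close>)
    also have "\<dots> = (\<integral>\<^sup>+x. ?f u x \<partial>lborel) - (\<integral>\<^sup>+x. ?f (real (Suc n)) x \<partial>lborel)"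
    proof (rule nn_integral_diff)
      show "(\<integral>\<^sup>+x. ?f (real (Suc n)) x \<partial>lborel) \<noteq> \<infinity>"
        by (subst mellin) auto
      show "AE x in lborel. ?f (real (Suc n)) x \<le> ?f u x"
        using u mono by (intro AE_I2) (auto simp: indicator_def intro!: ennreal_leI mult_left_mono simp del: of_nat_Suc)
    qed measurable
    also have "\<dots> = ennreal (c * u powr (- w)) - ennreal (c * real (Suc n) powr (- w))"
      by (subst (1 2) mellin) (use u in auto)
    also have "\<dots> = ennreal c * ennreal (u powr (- w) - real (Suc n) powr (- w))"
      using c by (simp add: ennreal_minus right_diff_distrib ennreal_mult'[symmetric] del: of_nat_Suc)
    finally show ?thesis using True by simp
  qed (simp add: T_def)
  have nonneg_cell: "(real (Suc n) powr (1 - w) - real n powr (1 - w)) / (1 - w) - real (Suc n) powr (- w) \<ge> 0" for n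
    by (rule has_integral_nonneg[OF has_integral_cell_powr[OF w]]) (use w in \<open>auto intro!: powr_mono2'\<close>)
  have cell_powr: "(\<integral>\<^sup>+u. ennreal (u powr (- w) - real (Suc n) powr (- w)) * indicator {real n<..<real (Suc n)} u \<partial>lborel)
      = ennreal ((real (Suc n) powr (1 - w) - real n powr (1 - w)) / (1 - w) - real (Suc n) powr (- w))" for n
    by (rule nn_integral_has_integral_lebesgue'[OF _ has_integral_cell_powr[OF w]]) (use w in \<open>auto intro!: powr_mono2'\<close>)
  have "ennreal (x powr (s - 1) * h x) * indicator {0<..} x = (\<Sum>n. \<integral>\<^sup>+u. T n x u \<partial>lborel)" for x
  proof (cases "x > 0")
    case True
    have [measurable]: "k x \<in> borel_measurable borel"
      using meas by measurable
    have "((\<lambda>u. k x u - k x (real (Suc n))) has_integral I x n - k x (real (Suc n))) {real n..real (Suc n)}" for n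
      using has_integral_const_real[of "k x (real (Suc n))" "real n" "real (Suc n)"]
      by (intro has_integral_diff cell True) auto
    then have K: "((\<lambda>u. k x u - k x (real (Suc n))) has_integral I x n - k x (real (Suc n))) {real n<..<real (Suc n)}" for n
      by (simp add: has_integral_Icc_iff_Ioo)
    then have J: "(\<integral>\<^sup>+u. ennreal (k x u - k x (real (Suc n))) * indicator {real n<..<real (Suc n)} u \<partial>lborel)
         = ennreal (I x n - k x (real (Suc n)))" for n
      using True by (intro nn_integral_has_integral_lebesgue') (auto intro!: mono)
    have "(\<integral>\<^sup>+u. T n x u \<partial>lborel) = (\<integral>\<^sup>+u. ennreal (x powr (s - 1)) *
        (ennreal (k x u - k x (real (Suc n))) * indicator {real n<..<real (Suc n)} u) \<partial>lborel)" for n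
      by (intro nn_integral_cong) (use True in \<open>auto simp: T_def ennreal_mult' indicator_def\<close>)
    also have "\<dots> n = ennreal (x powr (s - 1)) * ennreal (I x n - k x (real (Suc n)))" for n
      by (subst nn_integral_cmult) (auto simp only: J, measurable)
    finally have "(\<Sum>n. \<integral>\<^sup>+u. T n x u \<partial>lborel) = (\<Sum>n. ennreal (x powr (s - 1)) * ennreal (I x n - k x (real (Suc n))))"
      by simp
    also have "\<dots> = ennreal (x powr (s - 1)) * ennreal (h x)"
    proof -
      have "I x n - k x (real (Suc n)) \<ge> 0" for n
        by (rule has_integral_nonneg[OF K]) (use True mono in auto)
      then have "(\<Sum>n. ennreal (I x n - k x (real (Suc n)))) = ennreal (h x)"
        by (rule suminf_ennreal_eq[OF _ h[OF True]])
      then show ?thesis by (simp only: ennreal_suminf_cmult)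
    qed
    finally show ?thesis using True by (simp add: ennreal_mult')
  qed (simp add: T_def)
  then have "(\<integral>\<^sup>+x. ennreal (x powr (s - 1) * h x) * indicator {0<..} x \<partial>lborel)
      = (\<integral>\<^sup>+x. (\<Sum>n. \<integral>\<^sup>+u. T n x u \<partial>lborel) \<partial>lborel)" by simp
  also have "\<dots> = (\<Sum>n. \<integral>\<^sup>+x. (\<integral>\<^sup>+u. T n x u \<partial>lborel) \<partial>lborel)"
    by (rule nn_integral_suminf) measurable
  also have "\<dots> = (\<Sum>n. \<integral>\<^sup>+u. (\<integral>\<^sup>+x. T n x u \<partial>lborel) \<partial>lborel)"
    by (intro suminf_cong lborel_pair.Fubini') measurable
  also have "\<dots> = (\<Sum>n. ennreal c * ennreal ((real (Suc n) powr (1 - w) - real n powr (1 - w)) / (1 - w) - real (Suc n) powr (- w)))"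
    unfolding inner cell_powr[symmetric] by (subst nn_integral_cmult) auto
  also have "\<dots> = ennreal c * ennreal (- Re (zeta (of_real w)))"
    by (simp add: suminf_ennreal_eq[OF nonneg_cell zeta_real_sums(2)[OF w]] del: of_nat_Suc)
  finally show ?thesis by (simp only: ennreal_mult'[OF c])
qed

lemma nn_integral_powr_exp:
  fixes s a :: real
  assumes s: "s > 0" and a: "a > 0"
  shows "(\<integral>\<^sup>+x. ennreal (x powr (s - 1) * exp (- (a * x))) * indicator {0<..} x \<partial>lborel)
      = ennreal (Gamma s * a powr (- s))"
proof -
  have G: "ennreal (Gamma s) = (\<integral>\<^sup>+t. ennreal (indicator {0..} t * t powr (s - 1) / exp t) \<partial>lborel)"
    using Gamma_conv_nn_integral_real[OF s] .
  also have "\<dots> = a * (\<integral>\<^sup>+x. ennreal (indicator {0..} (a * x) * (a * x) powr (s - 1) / exp (a * x)) \<partial>lborel)"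
    using a by (subst nn_integral_real_affine[of _ a 0]) auto
  also have "(\<integral>\<^sup>+x. ennreal (indicator {0..} (a * x) * (a * x) powr (s - 1) / exp (a * x)) \<partial>lborel)
      = (\<integral>\<^sup>+x. ennreal (a powr (s - 1)) * (ennreal (x powr (s - 1) * exp (- (a * x))) * indicator {0<..} x) \<partial>lborel)"
    using a by (intro nn_integral_cong_AE AE_I[of _ _ "{0}"])
       (auto simp: indicator_def powr_mult exp_minus divide_inverse ennreal_mult'[symmetric] zero_le_mult_iff split: if_splits)
  also have "\<dots> = ennreal (a powr (s - 1)) * (\<integral>\<^sup>+x. ennreal (x powr (s - 1) * exp (- (a * x))) * indicator {0<..} x \<partial>lborel)"
    by (rule nn_integral_cmult) auto
  also have "ennreal a * (ennreal (a powr (s - 1)) * X) = ennreal (a powr s) * X" for X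
    using a by (simp add: mult.assoc[symmetric] ennreal_mult'[symmetric] powr_mult_base)
  finally have "ennreal (a powr (- s)) * ennreal (Gamma s) = ennreal (a powr (- s)) * (ennreal (a powr s) *
      (\<integral>\<^sup>+x. ennreal (x powr (s - 1) * exp (- (a * x))) * indicator {0<..} x \<partial>lborel))"
    by simp
  then show ?thesis
    using a s by (simp add: mult.assoc[symmetric] ennreal_mult'[symmetric] powr_add[symmetric] mult.commute Gamma_real_pos)
qed

lemma nn_integral_square_substitution:
  fixes f :: "real \<Rightarrow> real"
  assumes [measurable]: "f \<in> borel_measurable borel"
  shows "(\<integral>\<^sup>+z. ennreal (f z) * indicator {0<..} z \<partial>lborel)
       = (\<integral>\<^sup>+x. ennreal (f (x\<^sup>2) * (2 * x)) * indicator {0<..} x \<partial>lborel)"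
proof -
  let ?f = "\<lambda>(N::nat) z. ennreal (f z * indicator {0..(real N)\<^sup>2} z) * indicator {0<..} z"
  let ?g = "\<lambda>(N::nat) x. ennreal (f (x\<^sup>2) * (2 * x) * indicator {0..real N} x) * indicator {0<..} x"
  have "(\<lambda>N. \<integral>\<^sup>+z. ?f N z \<partial>lborel) \<longlonglongrightarrow> (\<integral>\<^sup>+z. ennreal (f z) * indicator {0<..} z \<partial>lborel)"
  proof (rule nn_integral_LIMSEQ)
    show "incseq ?f"
    proof (intro monoI le_funI)
      fix M N :: nat and z :: real assume "M \<le> N"
      then have "(real M)\<^sup>2 \<le> (real N)\<^sup>2" by (intro power_mono) auto
      then have "z \<le> (real N)\<^sup>2" if "z \<le> (real M)\<^sup>2" using that by (rule order_trans[rotated])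
      then show "?f M z \<le> ?f N z" by (auto simp: indicator_def)
    qed
    show "(\<lambda>N. ?f N z) \<longlonglongrightarrow> ennreal (f z) * indicator {0<..} z" for z
    proof (rule tendsto_eventually, use eventually_ge_at_top[of "nat \<lceil>max z 1\<rceil>"] in eventually_elim)
      fix N :: nat assume "nat \<lceil>max z 1\<rceil> \<le> N"
      then have "z \<le> real N" "1 \<le> real N" by linarith+
      then have "z \<le> (real N)\<^sup>2" using mult_mono[of 1 "real N" z "real N"] 
        by (cases "z \<ge> 0") (auto simp: power2_eq_square intro: order_trans[of z 0])
      then show "?f N z = ennreal (f z) * indicator {0<..} z" by (auto simp: indicator_def)
    qed
  qed measurable
  moreover have "(\<lambda>N. \<integral>\<^sup>+x. ?g N x \<partial>lborel) \<longlonglongrightarrow> (\<integral>\<^sup>+x. ennreal (f (x\<^sup>2) * (2 * x)) * indicator {0<..} x \<partial>lborel)"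
  proof (rule nn_integral_LIMSEQ)
    show "incseq ?g"
      by (intro monoI le_funI) (auto simp: indicator_def)
    show "(\<lambda>N. ?g N x) \<longlonglongrightarrow> ennreal (f (x\<^sup>2) * (2 * x)) * indicator {0<..} x" for x
    proof (rule tendsto_eventually, use eventually_ge_at_top[of "nat \<lceil>x\<rceil>"] in eventually_elim)
      fix N :: nat assume "nat \<lceil>x\<rceil> \<le> N"
      then have "x \<le> real N" by linarith
      then show "?g N x = ennreal (f (x\<^sup>2) * (2 * x)) * indicator {0<..} x" by (auto simp: indicator_def)
    qed
  qed measurable
  moreover have "(\<integral>\<^sup>+z. ?f N z \<partial>lborel) = (\<integral>\<^sup>+x. ?g N x \<partial>lborel)" for N
  proof -
    have "(\<integral>\<^sup>+z. ?f N z \<partial>lborel) = (\<integral>\<^sup>+z. ennreal (f z * indicator {0\<^sup>2..(real N)\<^sup>2} z) \<partial>lborel)"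
      by (intro nn_integral_cong_AE AE_I[of _ _ "{0}"]) (auto simp: indicator_def)
    also have "\<dots> = (\<integral>\<^sup>+x. ennreal (f (x\<^sup>2) * (2 * x) * indicator {0..real N} x) \<partial>lborel)"
      by (rule nn_integral_substitution)
         (auto intro!: derivative_eq_intros continuous_intros simp: set_borel_measurable_def)
    also have "\<dots> = (\<integral>\<^sup>+x. ?g N x \<partial>lborel)"
      by (intro nn_integral_cong_AE AE_I[of _ _ "{0}"]) (auto simp: indicator_def)
    finally show ?thesis .
  qed
  ultimately show ?thesis using LIMSEQ_unique by auto
qed

lemma square_powr:
  fixes x :: real
  assumes "x > 0"
  shows "(x\<^sup>2) powr b = x powr (2 * b)"
proof -
  have "x\<^sup>2 = x powr 2" using assms by simp
  then show ?thesis by (simp only: powr_powr)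
qed

lemma ennreal_mult_rotate:
  assumes "x \<ge> 0" "y \<ge> 0"
  shows "ennreal x * ennreal (y * z) = ennreal y * ennreal (z * x)"
  using assms by (simp add: ennreal_mult'[symmetric] mult_ac)

text \<open>
  Writing \<open>1 / (x\<^sup>2 + a\<^sup>2)\<close> as the integral of \<open>exp (- (x\<^sup>2 + a\<^sup>2) y)\<close> over \<open>y > 0\<close> separates the variables and
  leaves two Gamma integrals.
\<close>

lemma nn_integral_powr_rational:
  fixes s a :: real
  assumes s: "0 < s" "s < 1" and a: "a > 0"
  shows "(\<integral>\<^sup>+x. ennreal (x powr (s - 1) * (2 * x / (x\<^sup>2 + a\<^sup>2))) * indicator {0<..} x \<partial>lborel)
      = ennreal (Gamma ((1 + s) / 2) * Gamma ((1 - s) / 2) * a powr (s - 1))"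
proof -
  let ?F = "\<lambda>x y. ennreal (2 * x powr s * exp (- ((x\<^sup>2 + a\<^sup>2) * y))) * indicator {0<..} x * indicator {0<..} y"
  have "(\<integral>\<^sup>+x. ennreal (x powr (s - 1) * (2 * x / (x\<^sup>2 + a\<^sup>2))) * indicator {0<..} x \<partial>lborel)
      = (\<integral>\<^sup>+x. (\<integral>\<^sup>+y. ?F x y \<partial>lborel) \<partial>lborel)"
  proof (intro nn_integral_cong)
    fix x :: real
    show "ennreal (x powr (s - 1) * (2 * x / (x\<^sup>2 + a\<^sup>2))) * indicator {0<..} x = (\<integral>\<^sup>+y. ?F x y \<partial>lborel)"
    proof (cases "x > 0")
      case True
      have pos: "x\<^sup>2 + a\<^sup>2 > 0" using a by (simp add: add_nonneg_pos)
      have "(\<integral>\<^sup>+y. ?F x y \<partial>lborel) = (\<integral>\<^sup>+y. ennreal (2 * x powr s) *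
          (ennreal (y powr (1 - 1) * exp (- ((x\<^sup>2 + a\<^sup>2) * y))) * indicator {0<..} y) \<partial>lborel)"
        by (intro nn_integral_cong) (use True in \<open>auto simp: ennreal_mult'[symmetric] indicator_def\<close>)
      also have "\<dots> = ennreal (2 * x powr s) * ennreal (Gamma 1 * (x\<^sup>2 + a\<^sup>2) powr (- 1))"
        by (subst nn_integral_cmult, measurable) (subst nn_integral_powr_exp, use pos in auto)
      also have "\<dots> = ennreal (x powr (s - 1) * (2 * x / (x\<^sup>2 + a\<^sup>2)))"
      proof -
        have "x powr s = x powr (s - 1) * x"
          using True powr_add[of x "s - 1" 1] by simp
        moreover have "(x\<^sup>2 + a\<^sup>2) powr (- 1) = 1 / (x\<^sup>2 + a\<^sup>2)"
          using pos by (simp add: powr_minus_divide)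
        ultimately have "2 * x powr s * (Gamma 1 * (x\<^sup>2 + a\<^sup>2) powr (- 1)) = x powr (s - 1) * (2 * x / (x\<^sup>2 + a\<^sup>2))"
          by simp
        then show ?thesis by (simp only: ennreal_mult''[symmetric] ennreal_mult'[symmetric] powr_ge_zero zero_le_mult_iff zero_le_numeral simp_thms)
      qed
      finally show ?thesis using True by simp
    qed simp
  qed
  also have "\<dots> = (\<integral>\<^sup>+y. (\<integral>\<^sup>+x. ?F x y \<partial>lborel) \<partial>lborel)"
    by (rule lborel_pair.Fubini') measurable
  also have "\<dots> = (\<integral>\<^sup>+y. ennreal (Gamma ((1 + s) / 2)) * (ennreal (y powr ((1 - s) / 2 - 1) * exp (- (a\<^sup>2 * y))) * indicator {0<..} y) \<partial>lborel)"
  proof (intro nn_integral_cong)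
    fix y :: real
    show "(\<integral>\<^sup>+x. ?F x y \<partial>lborel) = ennreal (Gamma ((1 + s) / 2)) * (ennreal (y powr ((1 - s) / 2 - 1) * exp (- (a\<^sup>2 * y))) * indicator {0<..} y)"
    proof (cases "y > 0")
      case True
      let ?h = "\<lambda>z. z powr ((1 + s) / 2 - 1) * exp (- (y * z))"
      have "(\<integral>\<^sup>+x. ?F x y \<partial>lborel) = (\<integral>\<^sup>+x. ennreal (exp (- (a\<^sup>2 * y))) * (ennreal (?h (x\<^sup>2) * (2 * x)) * indicator {0<..} x) \<partial>lborel)"
      proof (intro nn_integral_cong)
        fix x :: real
        show "?F x y = ennreal (exp (- (a\<^sup>2 * y))) * (ennreal (?h (x\<^sup>2) * (2 * x)) * indicator {0<..} x)"
        proof (cases "x > 0")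
          case x: True
          have "(x\<^sup>2) powr ((1 + s) / 2 - 1) = x powr (s - 1)"
          proof -
            have "2 * ((1 + s) / 2 - 1) = s - 1" by (simp add: field_simps)
            then show ?thesis by (simp only: square_powr[OF x])
          qed
          moreover have "x powr s = x powr (s - 1) * x"
            using x powr_add[of x "s - 1" 1] by simp
          moreover have "exp (- ((x\<^sup>2 + a\<^sup>2) * y)) = exp (- (a\<^sup>2 * y)) * exp (- (y * x\<^sup>2))"
            by (simp add: exp_add[symmetric] ring_distribs mult.commute)
          ultimately have "2 * x powr s * exp (- ((x\<^sup>2 + a\<^sup>2) * y)) = exp (- (a\<^sup>2 * y)) * (?h (x\<^sup>2) * (2 * x))"
            by (simp only: mult_ac)
          moreover have "indicator {0<..} x = (1 :: ennreal)" "indicator {0<..} y = (1 :: ennreal)"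
            using x True by auto
          ultimately show ?thesis
            by (simp only: ennreal_mult'[OF exp_ge_zero] mult_1_right)
        next
          case False
          then have "indicator {0<..} x = (0 :: ennreal)" by simp
          then show ?thesis by (simp only: mult_zero_left mult_zero_right)
        qed
      qed
      also have "\<dots> = ennreal (exp (- (a\<^sup>2 * y))) * (\<integral>\<^sup>+x. ennreal (?h (x\<^sup>2) * (2 * x)) * indicator {0<..} x \<partial>lborel)"
        by (rule nn_integral_cmult) measurable
      also have "(\<integral>\<^sup>+x. ennreal (?h (x\<^sup>2) * (2 * x)) * indicator {0<..} x \<partial>lborel) = (\<integral>\<^sup>+z. ennreal (?h z) * indicator {0<..} z \<partial>lborel)"
        by (rule nn_integral_square_substitution[symmetric]) auto
      also have "\<dots> = ennreal (Gamma ((1 + s) / 2) * y powr (- ((1 + s) / 2)))"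
        by (rule nn_integral_powr_exp) (use s True in auto)
      also have "- ((1 + s) / 2) = (1 - s) / 2 - 1" by (simp add: field_simps)
      also have "ennreal (exp (- (a\<^sup>2 * y))) * ennreal (Gamma ((1 + s) / 2) * y powr ((1 - s) / 2 - 1))
          = ennreal (Gamma ((1 + s) / 2)) * ennreal (y powr ((1 - s) / 2 - 1) * exp (- (a\<^sup>2 * y)))"
        using s by (intro ennreal_mult_rotate) (auto intro!: less_imp_le Gamma_real_pos)
      finally show ?thesis using True by (simp only: indicator_simps greaterThan_iff mult_1_right)
    next
      case False
      then have "indicator {0<..} y = (0 :: ennreal)" by simp
      then show ?thesis by (simp only: mult_zero_left mult_zero_right nn_integral_const)
    qed
  qed
  also have "\<dots> = ennreal (Gamma ((1 + s) / 2)) * ennreal (Gamma ((1 - s) / 2) * (a\<^sup>2) powr (- ((1 - s) / 2)))"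
    by (subst nn_integral_cmult, measurable) (subst nn_integral_powr_exp, use s a in auto)
  also have "(a\<^sup>2) powr (- ((1 - s) / 2)) = a powr (s - 1)"
  proof -
    have "2 * (- ((1 - s) / 2)) = s - 1" by (simp add: field_simps)
    then show ?thesis by (simp only: square_powr[OF a])
  qed
  finally show ?thesis
    using s by (simp add: mult.assoc ennreal_mult' Gamma_real_pos less_imp_le)
qed

section \<open>The functional equation\<close>

text \<open>
  The difference of the digamma series at \<open>1 - z\<close> and \<open>1 + z\<close> for \<open>z = i x / (2 \<pi>)\<close> is the sum on the left, and the
  logarithmic derivative of the reflection formula evaluates it.
\<close>

lemma coth_partial_fractions:
  fixes x :: real
  assumes x: "x > 0"
  shows "(\<lambda>n. 2 * x / (x\<^sup>2 + (2 * pi * real (Suc n))\<^sup>2)) sums (1 / (exp x - 1) - 1 / x + 1 / 2)"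
proof -
  define y where "y = x / (2 * pi)"
  define z where "z = \<i> * complex_of_real y"
  have y: "y > 0" using x by (simp add: y_def)
  have nint: "z \<notin> \<int>\<^sub>\<le>\<^sub>0" "1 - z \<notin> \<int>\<^sub>\<le>\<^sub>0"
    using y by (auto simp: z_def complex_nonpos_Reals_iff complex_is_Int_iff dest!: nonpos_Ints_Int)
  have "((\<lambda>z. rGamma z * rGamma (1 - z)) has_field_derivative
      rGamma z * rGamma (1 - z) * (Digamma (1 - z) - Digamma z)) (at z)"
    using nint by (auto intro!: derivative_eq_intros simp: algebra_simps)
  moreover have "((\<lambda>z. rGamma z * rGamma (1 - z)) has_field_derivative cos (of_real pi * z)) (at z)"
    unfolding rGamma_reflection_complex by (auto intro!: derivative_eq_intros)
  ultimately have "rGamma z * rGamma (1 - z) * (Digamma (1 - z) - Digamma z) = cos (of_real pi * z)"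
    by (rule DERIV_unique)
  then have D: "sin (of_real pi * z) * (Digamma (1 - z) - Digamma z) = of_real pi * cos (of_real pi * z)"
    by (simp add: rGamma_reflection_complex field_simps)
  have z0: "z \<noteq> 0" "1 + z \<noteq> 0" "1 - z \<noteq> 0" using y by (auto simp: z_def complex_eq_iff)
  have "(\<lambda>n. (inverse (of_nat (Suc n)) - inverse ((1 - z) + of_nat n)) - (inverse (of_nat (Suc n)) - inverse ((1 + z) + of_nat n)))
      sums ((Digamma (1 - z) + euler_mascheroni) - (Digamma (1 + z) + euler_mascheroni))"
    unfolding Digamma_def diff_add_cancel
    by (intro sums_diff summable_sums summable_Digamma) (use z0 in auto)
  also have "(Digamma (1 - z) + euler_mascheroni) - (Digamma (1 + z) + euler_mascheroni) = Digamma (1 - z) - Digamma z - 1 / z"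
    using Digamma_plus1[OF z0(1)] by (simp add: add.commute)
  also have "(\<lambda>n. (inverse (of_nat (Suc n)) - inverse ((1 - z) + of_nat n)) - (inverse (of_nat (Suc n)) - inverse ((1 + z) + of_nat n)))
      = (\<lambda>n. - 2 * \<i> * of_real pi * of_real (2 * x / (x\<^sup>2 + (2 * pi * real (Suc n))\<^sup>2)))"
  proof
    fix n
    let ?m = "of_nat (Suc n) :: complex"
    have nz: "?m - z \<noteq> 0" "?m + z \<noteq> 0" using y by (auto simp: z_def complex_eq_iff)
    have "(inverse ?m - inverse ((1 - z) + of_nat n)) - (inverse ?m - inverse ((1 + z) + of_nat n))
        = inverse (?m + z) - inverse (?m - z)" by (simp add: algebra_simps)
    also have "\<dots> = - 2 * z / ((?m + z) * (?m - z))" using nz by (simp add: divide_simps) 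
    also have "(?m + z) * (?m - z) = of_real ((real (Suc n))\<^sup>2 + y\<^sup>2)"
      by (simp add: z_def algebra_simps power2_eq_square del: of_nat_Suc)
    also have "- 2 * z / of_real ((real (Suc n))\<^sup>2 + y\<^sup>2) = - 2 * \<i> * of_real (y / ((real (Suc n))\<^sup>2 + y\<^sup>2))"
      by (simp add: z_def del: of_nat_Suc)
    also have "y / ((real (Suc n))\<^sup>2 + y\<^sup>2) = pi * (2 * x / (x\<^sup>2 + (2 * pi * real (Suc n))\<^sup>2))"
    proof -
      have xy: "x = 2 * pi * y" by (simp add: y_def)
      have "x\<^sup>2 + (2 * pi * real (Suc n))\<^sup>2 = (2 * pi)\<^sup>2 * ((real (Suc n))\<^sup>2 + y\<^sup>2)"
        unfolding xy by (simp add: power_mult_distrib ring_distribs del: of_nat_Suc)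
      then show ?thesis unfolding xy by (simp add: power2_eq_square del: of_nat_Suc)
    qed
    finally show "(inverse (of_nat (Suc n)) - inverse ((1 - z) + of_nat n)) - (inverse (of_nat (Suc n)) - inverse ((1 + z) + of_nat n))
      = - 2 * \<i> * of_real pi * of_real (2 * x / (x\<^sup>2 + (2 * pi * real (Suc n))\<^sup>2))" by (simp del: of_nat_Suc)
  qed
  finally have S: "(\<lambda>n. - 2 * \<i> * of_real pi * of_real (2 * x / (x\<^sup>2 + (2 * pi * real (Suc n))\<^sup>2))) sums
      (Digamma (1 - z) - Digamma z - 1 / z)" .
  have "Digamma (1 - z) - Digamma z - 1 / z = - 2 * \<i> * of_real pi * of_real (1 / (exp x - 1) - 1 / x + 1 / 2)"
  proof -
    define E where "E = exp (x / 2)"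
    have E: "E > 1" using x by (simp add: E_def)
    have EE: "exp x = E * E" by (simp add: E_def exp_add[symmetric])
    have pz: "\<i> * (of_real pi * z) = of_real (- x / 2)" by (simp add: z_def y_def)
    have e1: "exp (\<i> * (of_real pi * z)) = of_real (inverse E)"
      unfolding pz exp_of_real by (simp add: E_def exp_minus)
    have e2: "exp (- (\<i> * (of_real pi * z))) = of_real E"
      unfolding pz of_real_minus[symmetric] exp_of_real by (simp add: E_def)
    have s: "sin (of_real pi * z) = of_real (inverse E - E) / (2 * \<i>)"
      unfolding sin_exp_eq e1 e2 by simp
    have c: "cos (of_real pi * z) = of_real (inverse E + E) / 2"
      unfolding cos_exp_eq e1 e2 by simp
    have ne: "inverse E - E \<noteq> 0" using E by (simp add: field_simps) (metis less_1_mult less_irrefl)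
    have "Digamma (1 - z) - Digamma z = of_real pi * cos (of_real pi * z) / sin (of_real pi * z)"
    proof -
      have "sin (of_real pi * z) \<noteq> 0" unfolding s using ne by (simp del: of_real_diff)
      then show ?thesis using D by (simp add: field_simps)
    qed
    also have "\<dots> = \<i> * of_real (pi * ((inverse E + E) / (inverse E - E)))"
      unfolding s c using ne by (simp add: divide_simps del: of_real_diff of_real_add) 
    also have "(inverse E + E) / (inverse E - E) = - 2 * (1 / (exp x - 1) + 1 / 2)"
    proof -
      have "E * E > 1" using E less_1_mult by blast
      then show ?thesis using E ne unfolding EE by (simp add: divide_simps) (simp add: algebra_simps)
    qed
    finally have "Digamma (1 - z) - Digamma z = \<i> * of_real (pi * (- 2 * (1 / (exp x - 1) + 1 / 2)))" .
    moreover have "1 / z = - 2 * \<i> * of_real (pi / x)"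
      using x by (simp add: z_def y_def field_simps)
    ultimately show ?thesis by (simp add: algebra_simps)
  qed
  with S have "(\<lambda>n. - 2 * \<i> * of_real pi * of_real (2 * x / (x\<^sup>2 + (2 * pi * real (Suc n))\<^sup>2))) sums
      (- 2 * \<i> * of_real pi * of_real (1 / (exp x - 1) - 1 / x + 1 / 2))" by simp
  then have "(\<lambda>n. complex_of_real (2 * x / (x\<^sup>2 + (2 * pi * real (Suc n))\<^sup>2))) sums of_real (1 / (exp x - 1) - 1 / x + 1 / 2)"
    by (subst (asm) sums_mult_iff) auto
  then show ?thesis by (simp only: sums_of_real_iff)
qed

lemma mellin_exp_kernel:
  assumes s: "0 < s" "s < 1"
  shows "(\<integral>\<^sup>+x. ennreal (x powr (s - 1) * (1 / x - 1 / (exp x - 1))) * indicator {0<..} x \<partial>lborel)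
           = ennreal (Gamma s * (- Re (zeta (of_real s))))"
proof (rule mellin_zeta[where k = "\<lambda>x u. exp (- (u * x))" and I = "\<lambda>x n. (exp (- (real n * x)) - exp (- (real (Suc n) * x))) / x"])
  fix x :: real and n :: nat assume x: "x > 0"
  have "((\<lambda>u. exp (- (u * x))) has_integral (- exp (- (real (Suc n) * x)) / x - (- exp (- (real n * x)) / x))) {real n..real (Suc n)}"
    using x by (intro fundamental_theorem_of_calculus)
      (auto intro!: derivative_eq_intros simp: has_real_derivative_iff_has_vector_derivative[symmetric])
  then show "((\<lambda>u. exp (- (u * x))) has_integral ((exp (- (real n * x)) - exp (- (real (Suc n) * x))) / x)) {real n..real (Suc n)}"
    by (simp add: diff_divide_distrib)
next
  fix x :: real assume x: "x > 0"
  have lim: "(\<lambda>n. exp (- (real n * x))) \<longlonglongrightarrow> 0" using x by real_asymp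
  have "(\<lambda>n. exp (- (real n * x)) - exp (- (real (Suc n) * x))) sums (exp (- (real 0 * x)) - 0)"
    by (rule telescope_sums'[OF lim])
  then have "(\<lambda>n. (exp (- (real n * x)) - exp (- (real (Suc n) * x))) / x) sums (1 / x)"
    using sums_divide by fastforce
  moreover have "(\<lambda>n. exp (- (real (Suc n) * x))) sums (1 / (exp x - 1))"
  proof -
    have "(\<lambda>n. exp (- x) * exp (- x) ^ n) sums (exp (- x) * (1 / (1 - exp (- x))))"
      by (intro sums_mult geometric_sums) (use x in auto)
    moreover have "exp (- x) * exp (- x) ^ n = exp (- (real (Suc n) * x))" for n
      by (simp add: exp_of_nat_mult[symmetric] exp_add[symmetric] algebra_simps)
    moreover have "exp (- x) * (1 / (1 - exp (- x))) = 1 / (exp x - 1)"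
      using x by (simp add: exp_minus divide_simps)
    ultimately show ?thesis by simp
  qed
  ultimately show "(\<lambda>n. (exp (- (real n * x)) - exp (- (real (Suc n) * x))) / x - exp (- (real (Suc n) * x))) sums (1 / x - 1 / (exp x - 1))"
    by (rule sums_diff)
next
  fix u :: real assume "u > 0"
  then show "(\<integral>\<^sup>+x. ennreal (x powr (s - 1) * exp (- (u * x))) * indicator {0<..} x \<partial>lborel) = ennreal (Gamma s * u powr (- s))"
    by (rule nn_integral_powr_exp[OF s(1)])
qed (use s in \<open>auto intro!: less_imp_le Gamma_real_pos\<close>)

lemma mellin_rational_kernel:
  assumes s: "0 < s" "s < 1"
  shows "(\<integral>\<^sup>+x. ennreal (x powr (s - 1) * (1 / x - 1 / (exp x - 1))) * indicator {0<..} x \<partial>lborel)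
           = ennreal (Gamma ((1 + s) / 2) * Gamma ((1 - s) / 2) * (2 * pi) powr (s - 1) * (- Re (zeta (of_real (1 - s)))))"
proof (rule mellin_zeta[where k = "\<lambda>x u. 2 * x / (x\<^sup>2 + (2 * pi * u)\<^sup>2)"
      and I = "\<lambda>x n. arctan (2 * pi * real (Suc n) / x) / pi - arctan (2 * pi * real n / x) / pi"])
  fix x :: real and n :: nat assume x: "x > 0"
  have "((\<lambda>u. arctan (2 * pi * u / x) / pi) has_real_derivative 2 * x / (x\<^sup>2 + (2 * pi * u)\<^sup>2)) (at u within A)" for u A
  proof -
    have pos: "x\<^sup>2 + (2 * pi * u)\<^sup>2 > 0" using x by (simp add: add_pos_nonneg)
    have "1 + (2 * pi * u / x)\<^sup>2 = (x\<^sup>2 + (2 * pi * u)\<^sup>2) / x\<^sup>2" using x by (simp add: field_simps power2_eq_square)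
    then have "inverse (1 + (2 * pi * u / x)\<^sup>2) * (2 * pi / x) / pi = 2 * x / (x\<^sup>2 + (2 * pi * u)\<^sup>2)"
      using x pos by (simp add: power2_eq_square)
    moreover have "((\<lambda>u. arctan (2 * pi * u / x) / pi) has_real_derivative inverse (1 + (2 * pi * u / x)\<^sup>2) * (2 * pi / x) / pi) (at u within A)"
      using x by (auto intro!: derivative_eq_intros)
    ultimately show ?thesis by simp
  qed
  then show "((\<lambda>u. 2 * x / (x\<^sup>2 + (2 * pi * u)\<^sup>2)) has_integral
      (arctan (2 * pi * real (Suc n) / x) / pi - arctan (2 * pi * real n / x) / pi)) {real n..real (Suc n)}"
    by (intro fundamental_theorem_of_calculus) (auto simp: has_real_derivative_iff_has_vector_derivative[symmetric])
next
  fix x :: real assume x: "x > 0"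
  have "(\<lambda>n. arctan (2 * pi * real n / x) / pi) \<longlonglongrightarrow> (pi / 2) / pi"
  proof (intro tendsto_divide tendsto_const filterlim_compose[OF tendsto_arctan_at_top])
    show "filterlim (\<lambda>n. 2 * pi * real n / x) at_top sequentially" using x by real_asymp
  qed auto
  then have "(\<lambda>n. arctan (2 * pi * real (Suc n) / x) / pi - arctan (2 * pi * real n / x) / pi) sums ((pi / 2) / pi - arctan (2 * pi * real 0 / x) / pi)"
    by (rule telescope_sums)
  then have "(\<lambda>n. arctan (2 * pi * real (Suc n) / x) / pi - arctan (2 * pi * real n / x) / pi) sums (1 / 2)" by simp
  from sums_diff[OF this coth_partial_fractions[OF x]]
  show "(\<lambda>n. arctan (2 * pi * real (Suc n) / x) / pi - arctan (2 * pi * real n / x) / pi - 2 * x / (x\<^sup>2 + (2 * pi * real (Suc n))\<^sup>2))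
     sums (1 / x - 1 / (exp x - 1))" by simp
next
  fix u :: real assume u: "u > 0"
  then have "2 * pi * u > 0" by simp
  from nn_integral_powr_rational[OF s this]
  show "(\<integral>\<^sup>+x. ennreal (x powr (s - 1) * (2 * x / (x\<^sup>2 + (2 * pi * u)\<^sup>2))) * indicator {0<..} x \<partial>lborel)
      = ennreal (Gamma ((1 + s) / 2) * Gamma ((1 - s) / 2) * (2 * pi) powr (s - 1) * u powr (- (1 - s)))"
    using u by (simp add: powr_mult mult.assoc)
next
  fix x u v :: real assume "x > 0" "0 < u" "u \<le> v"
  then show "2 * x / (x\<^sup>2 + (2 * pi * v)\<^sup>2) \<le> 2 * x / (x\<^sup>2 + (2 * pi * u)\<^sup>2)"
    by (intro divide_left_mono add_left_mono power_mono mult_pos_pos add_pos_nonneg) auto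
qed (use s in \<open>auto intro!: less_imp_le Gamma_real_pos mult_nonneg_nonneg\<close>)

lemma zeta_nonpos_unit_interval:
  assumes w: "0 < w" "w < 1"
  shows "Re (zeta (of_real w)) \<le> 0"
proof -
  have "0 \<le> - Re (zeta (of_real w))"
  proof (rule sums_le[OF _ sums_zero zeta_real_sums(2)[OF w]])
    fix n
    show "0 \<le> (real (Suc n) powr (1 - w) - real n powr (1 - w)) / (1 - w) - real (Suc n) powr (- w)"
      by (rule has_integral_nonneg[OF has_integral_cell_powr[OF w]]) (use w in \<open>auto intro!: powr_mono2'\<close>)
  qed
  then show ?thesis by simp
qed

lemma zeta_functional_equation_real:
  assumes s: "0 < s" "s < 1"
  shows "Gamma s * Re (zeta (of_real s)) = Gamma ((1 + s) / 2) * Gamma ((1 - s) / 2) * (2 * pi) powr (s - 1) * Re (zeta (of_real (1 - s)))"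
proof -
  have "ennreal (Gamma s * (- Re (zeta (of_real s)))) =
     ennreal (Gamma ((1 + s) / 2) * Gamma ((1 - s) / 2) * (2 * pi) powr (s - 1) * (- Re (zeta (of_real (1 - s)))))"
    using mellin_exp_kernel[OF s] mellin_rational_kernel[OF s] by simp
  moreover have "0 \<le> Gamma s * (- Re (zeta (of_real s)))"
    using zeta_nonpos_unit_interval[of s] Gamma_real_pos[of s] s by (intro mult_nonneg_nonneg) auto
  moreover have "0 \<le> Gamma ((1 + s) / 2) * Gamma ((1 - s) / 2) * (2 * pi) powr (s - 1) * (- Re (zeta (of_real (1 - s))))"
    using zeta_nonpos_unit_interval[of "1 - s"] Gamma_real_pos[of "(1 + s) / 2"] Gamma_real_pos[of "(1 - s) / 2"] s
    by (intro mult_nonneg_nonneg) auto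
  ultimately show ?thesis by (simp only: ennreal_inj mult_minus_right neg_equal_iff_equal)
qed

lemma not_nonpos_Ints_Re_pos: "Re z > 0 \<Longrightarrow> z \<notin> \<int>\<^sub>\<le>\<^sub>0"
  by (auto elim!: nonpos_Ints_cases)

lemma zeta_functional_equation_strip:
  assumes s: "0 < Re s" "Re s < 1"
  shows "Gamma s * zeta s = exp ((s - 1) * of_real (ln (2 * pi))) * Gamma ((1 + s) / 2) * Gamma ((1 - s) / 2) * zeta (1 - s)"
proof -
  define S where "S = {s. 0 < Re s} \<inter> {s. Re s < 1}"
  define D where "D = (\<lambda>s. Gamma s * zeta s - exp ((s - 1) * of_real (ln (2 * pi))) * Gamma ((1 + s) / 2) * Gamma ((1 - s) / 2) * zeta (1 - s))"
  have zeta1: "(\<lambda>s. zeta (1 - s)) holomorphic_on S"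
    by (rule holomorphic_on_compose_gen[OF _ zeta_holomorphic, unfolded o_def])
       (auto intro!: holomorphic_intros simp: S_def)
  have "D holomorphic_on S"
    unfolding D_def
    by (intro holomorphic_intros zeta1 holomorphic_on_subset[OF zeta_holomorphic])
       (auto simp: S_def not_nonpos_Ints_Re_pos)
  moreover have "open S" unfolding S_def by (intro open_Int open_halfspace_Re_gt open_halfspace_Re_lt)
  moreover have "connected S"
    unfolding S_def by (intro convex_connected convex_Int convex_halfspace_Re_gt convex_halfspace_Re_lt)
  moreover have "of_real ` {0<..<1} \<subseteq> S" by (auto simp: S_def)
  moreover have "1/2 \<in> S" by (simp add: S_def)
  moreover have "(1/2 :: complex) islimpt of_real ` {0<..<1}"
  proof -
    have "\<exists>x\<in>of_real ` {0<..<1}. x \<noteq> (1/2 :: complex) \<and> dist x (1/2) < e" if e: "e > 0" for e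
    proof (rule bexI[of _ "of_real (1/2 + min (e/2) (1/4))"])
      have "dist (complex_of_real (1/2 + min (e/2) (1/4))) (of_real (1/2)) = min (e/2) (1/4)"
        unfolding dist_of_real using e by (simp add: dist_real_def)
      moreover have "complex_of_real (1/2) = 1/2" by simp
      ultimately have "dist (complex_of_real (1/2 + min (e/2) (1/4))) (1/2) = min (e/2) (1/4)" by metis
      then show "of_real (1/2 + min (e/2) (1/4)) \<noteq> (1/2 :: complex) \<and> dist (complex_of_real (1/2 + min (e/2) (1/4))) (1/2) < e"
        using e dist_nz[of "complex_of_real (1/2 + min (e/2) (1/4))" "1/2"] by (auto simp del: of_real_add)
      have "1/2 + min (e/2) (1/4) \<in> {0<..<1::real}" using e by auto
      then show "of_real (1/2 + min (e/2) (1/4)) \<in> complex_of_real ` {0<..<1}" by (rule imageI)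
    qed
    then show ?thesis unfolding islimpt_approachable by blast
  qed
  moreover have "D z = 0" if "z \<in> of_real ` {0<..<1}" for z
  proof -
    obtain x where x: "z = of_real x" "0 < x" "x < 1" using \<open>z \<in> _\<close> by auto
    have z: "zeta (of_real x) = of_real (Re (zeta (of_real x)))" "zeta (of_real (1 - x)) = of_real (Re (zeta (of_real (1 - x))))"
      using zeta_real_sums(1)[of x] zeta_real_sums(1)[of "1 - x"] x by (auto simp: complex_eq_iff)
    have e: "exp ((of_real x - 1) * complex_of_real (ln (2 * pi))) = of_real ((2 * pi) powr (x - 1))"
      by (simp add: powr_def exp_of_real[symmetric])
    have g: "Gamma (of_real x) = complex_of_real (Gamma x)"
       "Gamma ((1 + of_real x) / 2) = complex_of_real (Gamma ((1 + x) / 2))"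
       "Gamma ((1 - of_real x) / 2) = complex_of_real (Gamma ((1 - x) / 2))"
      by (simp_all flip: Gamma_complex_of_real)
    have "complex_of_real (Gamma x * Re (zeta (of_real x))) = of_real (Gamma ((1 + x) / 2) * Gamma ((1 - x) / 2) * (2 * pi) powr (x - 1) * Re (zeta (of_real (1 - x))))"
      using zeta_functional_equation_real[OF x(2,3)] by (simp only:)
    then show ?thesis
      unfolding D_def x(1) e g of_real_mult z[symmetric] by simp
  qed
  ultimately have "D s = 0" by (rule analytic_continuation) (use s in \<open>auto simp: S_def\<close>)
  then show ?thesis by (simp add: D_def)
qed

text \<open>
  The classical \<open>\<pi> powr (- s / 2) \<Gamma>(s / 2) \<zeta> s\<close>; the exponential spares branch considerations.
\<close>

definition completed_zeta :: "complex \<Rightarrow> complex" where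
  "completed_zeta s = exp (- (s / 2) * of_real (ln pi)) * Gamma (s / 2) * zeta s"

text \<open>
  The duplication formula for \<open>\<Gamma>(s / 2) \<Gamma>((1 + s) / 2)\<close> turns the unsymmetric functional equation into this one.
\<close>

lemma completed_zeta_symmetric:
  assumes s: "0 < Re s" "Re s < 1"
  shows "completed_zeta s = completed_zeta (1 - s)"
proof -
  define l :: complex where "l = of_real (ln 2)"
  define p :: complex where "p = of_real (ln pi)"
  have sq: "of_real (sqrt pi) = exp (p / 2)"
  proof -
    have "sqrt pi = exp (ln pi / 2)" by (simp add: powr_half_sqrt[symmetric] powr_def)
    then show ?thesis by (simp add: p_def exp_of_real[symmetric])
  qed
  have lp: "of_real (ln (2 * pi)) = l + p" by (simp add: l_def p_def ln_mult)
  have "Gamma (s / 2) * Gamma (s / 2 + 1 / 2) = exp ((1 - 2 * (s / 2)) * of_real (ln 2)) * of_real (sqrt pi) * Gamma (2 * (s / 2))"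
    by (rule Gamma_legendre_duplication) (use s in \<open>auto intro!: not_nonpos_Ints_Re_pos\<close>)
  then have dup: "Gamma (s / 2) * Gamma ((1 + s) / 2) = exp ((1 - s) * l) * exp (p / 2) * Gamma s"
    by (simp add: l_def sq add_divide_distrib add.commute)
  have nz: "Gamma ((1 + s) / 2) \<noteq> 0"
    using s by (subst Gamma_eq_zero_iff) (auto intro!: not_nonpos_Ints_Re_pos)
  have "Gamma ((1 + s) / 2) * completed_zeta s = exp (- (s / 2) * p) * (Gamma (s / 2) * Gamma ((1 + s) / 2)) * zeta s"
    by (simp add: completed_zeta_def p_def)
  also have "\<dots> = exp (- (s / 2) * p) * exp ((1 - s) * l) * exp (p / 2) * (Gamma s * zeta s)"
    by (simp add: dup)
  also have "\<dots> = Gamma ((1 + s) / 2) * (exp (- (s / 2) * p) * exp ((1 - s) * l) * exp (p / 2) * exp ((s - 1) * (l + p))) * (Gamma ((1 - s) / 2) * zeta (1 - s))"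
    by (simp add: zeta_functional_equation_strip[OF s] lp)
  also have "exp (- (s / 2) * p) * exp ((1 - s) * l) * exp (p / 2) * exp ((s - 1) * (l + p)) = exp (- ((1 - s) / 2) * p)"
  proof -
    have "- (s / 2) * p + (1 - s) * l + p / 2 + (s - 1) * (l + p) = - ((1 - s) / 2) * p"
      by (simp add: field_simps)
    then show ?thesis by (simp only: exp_add[symmetric])
  qed
  also have "Gamma ((1 + s) / 2) * exp (- ((1 - s) / 2) * p) * (Gamma ((1 - s) / 2) * zeta (1 - s)) = Gamma ((1 + s) / 2) * completed_zeta (1 - s)"
    by (simp add: completed_zeta_def p_def)
  finally show ?thesis using nz by simp
qed

section \<open>The logarithmic derivative on the critical line\<close>

lemma Digamma_cnj:
  assumes "z \<noteq> 0"
  shows "Digamma (cnj z) = cnj (Digamma z)"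
proof -
  have "(\<lambda>m. cnj (of_real (ln (real m)) - (\<Sum>n<m. inverse (z + of_nat n)))) \<longlonglongrightarrow> cnj (Digamma z)"
    by (intro tendsto_cnj Digamma_LIMSEQ assms)
  then have "(\<lambda>m. of_real (ln (real m)) - (\<Sum>n<m. inverse (cnj z + of_nat n))) \<longlonglongrightarrow> cnj (Digamma z)"
    by simp
  moreover have "(\<lambda>m. of_real (ln (real m)) - (\<Sum>n<m. inverse (cnj z + of_nat n))) \<longlonglongrightarrow> Digamma (cnj z)"
    by (rule Digamma_LIMSEQ) (use assms in auto)
  ultimately show ?thesis by (rule LIMSEQ_unique[rotated])
qed

lemma completed_zeta_has_field_derivative:
  assumes s: "0 < Re s" "Re s < 1" and z: "zeta s \<noteq> 0"
  shows "(completed_zeta has_field_derivative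
     completed_zeta s * (- of_real (ln pi) / 2 + Digamma (s / 2) / 2 + deriv zeta s / zeta s)) (at s)"
proof -
  have d: "(zeta has_field_derivative deriv zeta s) (at s)"
  proof (rule holomorphic_derivI[OF zeta_holomorphic])
    show "s \<in> - {1}" using s by auto
  qed auto
  have "((\<lambda>s. exp (- (s / 2) * of_real (ln pi)) * Gamma (s / 2) * zeta s) has_field_derivative
     completed_zeta s * (- of_real (ln pi) / 2 + Digamma (s / 2) / 2 + deriv zeta s / zeta s)) (at s)"
    by (rule derivative_eq_intros d refl | (simp add: not_nonpos_Ints_Re_pos s; fail))+
       (use z in \<open>simp add: completed_zeta_def field_simps\<close>)
  then show ?thesis by (simp only: completed_zeta_def[abs_def])
qed

text \<open>
  The logarithmic derivative of the completed zeta function is odd under \<open>s \<mapsto> 1 - s\<close>. On the critical line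
  \<open>1 - s\<close> is the complex conjugate of \<open>s\<close>, so its real part vanishes there.
\<close>

lemma Re_zeta_logderiv_critical_line:
  assumes "zeta (Complex (1/2) t) \<noteq> 0"
  shows "Re (deriv zeta (Complex (1/2) t) / zeta (Complex (1/2) t)) = (ln pi - Re (Digamma (Complex (1/4) (t/2)))) / 2"
proof -
  define s where "s = Complex (1/2) t"
  define L where "L = (\<lambda>s. - of_real (ln pi) / 2 + Digamma (s / 2) / 2 + deriv zeta s / zeta s)"
  have s: "0 < Re s" "Re s < 1" "s \<noteq> 1" "s \<noteq> 0" and z: "zeta s \<noteq> 0" and s': "1 - s = cnj s"
    using assms by (auto simp: s_def complex_eq_iff)
  have z': "zeta (1 - s) \<noteq> 0" using zeta_cnj[OF s(1)] z by (simp add: s')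
  have nz: "completed_zeta s \<noteq> 0"
    using z not_nonpos_Ints_Re_pos[of "s / 2"] s by (simp add: completed_zeta_def Gamma_eq_zero_iff)
  have 1: "(completed_zeta has_field_derivative completed_zeta s * L s) (at s)"
    unfolding L_def using s z by (intro completed_zeta_has_field_derivative)
  have "(completed_zeta has_field_derivative completed_zeta (1 - s) * L (1 - s)) (at (1 - s))"
    unfolding L_def using s z' by (intro completed_zeta_has_field_derivative) auto
  then have "((\<lambda>w. completed_zeta (1 - w)) has_field_derivative completed_zeta (1 - s) * L (1 - s) * (- 1)) (at s)"
    by (rule DERIV_chain2) (auto intro!: derivative_eq_intros)
  then have "(completed_zeta has_field_derivative completed_zeta (1 - s) * L (1 - s) * (- 1)) (at s)"
  proof (rule has_field_derivative_transform_within_open)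
    show "open ({s. 0 < Re s} \<inter> {s. Re s < 1})" by (intro open_Int open_halfspace_Re_gt open_halfspace_Re_lt)
    show "completed_zeta (1 - w) = completed_zeta w" if "w \<in> {s. 0 < Re s} \<inter> {s. Re s < 1}" for w
      using completed_zeta_symmetric[of w] that by simp
  qed (use s in auto)
  from DERIV_unique[OF 1 this] have "completed_zeta s * L s = completed_zeta s * (- L (1 - s))"
    using completed_zeta_symmetric[of s] s by simp
  then have "L s = - L (1 - s)" using nz mult_left_cancel by blast
  also have "L (1 - s) = cnj (L s)"
    unfolding s' L_def using s Digamma_cnj[of "s / 2"] deriv_zeta_cnj[of s] zeta_cnj[of s] by simp
  finally have "Re (L s) = - Re (cnj (L s))" by (metis uminus_complex.sel(1))
  then have "Re (L s) = 0" by simp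
  moreover have "s / 2 = Complex (1/4) (t/2)" by (simp add: s_def complex_eq_iff)
  ultimately show ?thesis by (simp add: L_def s_def[symmetric])
qed

text \<open>
  The digamma function is the limit of \<open>ln m - \<Sum> 1 / (z + n)\<close> over \<open>n < m\<close>. The terms with \<open>n < t\<close> have real part
  \<open>O(1 / t)\<close>, so they contribute \<open>O(1)\<close> altogether; the remaining ones are at most \<open>1 / n\<close> and contribute
  \<open>ln m - ln t + O(1)\<close>.
\<close>

lemma Re_Digamma_ge:
  assumes t: "t \<ge> 1"
  shows "Re (Digamma (Complex (1/4) t)) \<ge> ln t - 9"
proof -
  define T where "T = nat \<lceil>t\<rceil>"
  have T: "real T \<ge> t" "real T \<le> t + 1" "T \<ge> 1" using t unfolding T_def by linarith+
  have term_Re: "Re (inverse (Complex (1/4) t + of_nat n)) = (real n + 1/4) / ((real n + 1/4)\<^sup>2 + t\<^sup>2)" for n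
    by (simp add: add.commute)
  have small: "Re (inverse (Complex (1/4) t + of_nat n)) \<le> 2 / t" if "n < T" for n
  proof -
    have "real n + 1 \<le> real T" using \<open>n < T\<close> by simp
    then have n2: "real n + 1/4 \<le> 2 * t" using T t by linarith
    have "(real n + 1/4) / ((real n + 1/4)\<^sup>2 + t\<^sup>2) \<le> (2 * t) / t\<^sup>2"
      using t n2 by (intro frac_le) auto
    then show ?thesis unfolding term_Re using t by (simp add: power2_eq_square)
  qed
  have large: "(\<Sum>n=T..<T+m. Re (inverse (Complex (1/4) t + of_nat n))) \<le> ln (real (T + m)) - ln (real T) + 1 / real T - 1 / real (T + m)" for m
  proof (induction m)
    case (Suc m)
    have n: "real (T + m) \<ge> 1" using T by simp
    have "Re (inverse (Complex (1/4) t + of_nat (T + m))) \<le> 1 / real (T + m)"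
    proof -
      have "(real (T + m) + 1/4) / ((real (T + m) + 1/4)\<^sup>2 + t\<^sup>2) \<le> (real (T + m) + 1/4) / (real (T + m) + 1/4)\<^sup>2"
        using n by (intro divide_left_mono mult_pos_pos add_pos_nonneg zero_less_power) auto
      also have "\<dots> = 1 / (real (T + m) + 1/4)" by (simp add: power2_eq_square)
      also have "\<dots> \<le> 1 / real (T + m)" using n by (intro frac_le) auto
      finally show ?thesis unfolding term_Re .
    qed
    \<comment> \<open>The reciprocals telescope along with the logarithms, which absorbs the error of comparing \<open>1 / n\<close> with
      \<open>ln (n + 1) - ln n\<close>.\<close>
    also have "\<dots> \<le> ln (real (T + Suc m)) - ln (real (T + m)) + 1 / real (T + m) - 1 / real (T + Suc m)"
    proof -
      let ?a = "real (T + m)"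
      have "ln (?a / (?a + 1)) \<le> ?a / (?a + 1) - 1" using n by (intro ln_le_minus_one) auto
      then have "1 / (?a + 1) \<le> ln (?a + 1) - ln ?a" using n by (simp add: ln_div field_simps)
      then show ?thesis by (simp add: add.commute)
    qed
    finally show ?case using Suc by simp
  qed auto
  have bound: "Re (of_real (ln (real m)) - (\<Sum>n<m. inverse (Complex (1/4) t + of_nat n))) \<ge> ln t - 9" if "m \<ge> T" for m
  proof -
    obtain k where k: "m = T + k" using \<open>m \<ge> T\<close> le_Suc_ex by blast
    have "(\<Sum>n<m. Re (inverse (Complex (1/4) t + of_nat n))) = (\<Sum>n<T. Re (inverse (Complex (1/4) t + of_nat n)))
        + (\<Sum>n=T..<T+k. Re (inverse (Complex (1/4) t + of_nat n)))"
      unfolding k by (metis (no_types, lifting) atLeast0LessThan le0 le_add1 sum.atLeastLessThan_concat)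
    also have "\<dots> \<le> (\<Sum>n<T. 2 / t) + (ln (real (T + k)) - ln (real T) + 1 / real T - 1 / real (T + k))"
      by (intro add_mono sum_mono small large) auto
    finally have "(\<Sum>n<m. Re (inverse (Complex (1/4) t + of_nat n))) \<le>
        (\<Sum>n<T. 2 / t) + (ln (real m) - ln (real T) + 1 / real T - 1 / real m)" unfolding k .
    moreover have "(\<Sum>n<T. 2 / t) \<le> 4" using T t by (simp add: field_simps)
    moreover have "1 / real T \<le> 1" using T by simp
    moreover have "1 / real m \<ge> 0" by simp
    moreover have "ln (real T) \<ge> ln t" using T t by (intro ln_mono) auto
    ultimately have "ln (real m) - (\<Sum>n<m. Re (inverse (Complex (1/4) t + of_nat n))) \<ge> ln t - 9" by linarith
    then show ?thesis by simp
  qed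
  have "(\<lambda>m. Re (of_real (ln (real m)) - (\<Sum>n<m. inverse (Complex (1/4) t + of_nat n)))) \<longlonglongrightarrow> Re (Digamma (Complex (1/4) t))"
    by (intro tendsto_Re Digamma_LIMSEQ) (simp add: complex_eq_iff)
  then show ?thesis
    by (rule tendsto_lowerbound) (use bound in \<open>auto intro: eventually_sequentiallyI[of T]\<close>)
qed

section \<open>Logarithmic derivatives and zeros in a disc\<close>

text \<open>
  The map \<open>w \<mapsto> w / (2 M - w)\<close> takes the half-plane \<open>Re w < M\<close> into the unit disc and fixes \<open>0\<close>, so the Schwarz
  lemma applies to the composition with \<open>f\<close>.
\<close>

lemma Borel_Caratheodory:
  fixes f :: "complex \<Rightarrow> complex"
  assumes f: "f holomorphic_on ball a R" "f a = 0" and Re: "\<And>z. z \<in> ball a R \<Longrightarrow> Re (f z) < M"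
    and r: "0 < r" "r < R" and z: "z \<in> cball a r"
  shows "norm (f z) \<le> 2 * M * r / (R - r)"
proof -
  have M: "M > 0" using Re[of a] f r by simp
  define g where "g = (\<lambda>w. f (a + of_real R * w))"
  define h where "h = (\<lambda>w. g w / (2 * of_real M - g w))"
  have in_ball: "a + of_real R * w \<in> ball a R" if "norm w < 1" for w
    using that r by (simp add: dist_norm norm_mult)
  have Reg: "Re (g w) < M" if "norm w < 1" for w
    using Re[OF in_ball[OF that]] by (simp add: g_def)
  have nz: "2 * of_real M - g w \<noteq> 0" if "norm w < 1" for w
    using Reg[OF that] M by (auto simp: complex_eq_iff)
  have "g holomorphic_on ball 0 1"
    unfolding g_def
    by (rule holomorphic_on_compose_gen[OF _ f(1), unfolded o_def])
       (use in_ball in \<open>auto intro!: holomorphic_intros\<close>)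
  then have "h holomorphic_on ball 0 1"
    unfolding h_def using nz by (intro holomorphic_intros) auto
  moreover have "h 0 = 0" using f(2) by (simp add: h_def g_def)
  moreover have "norm (h w) < 1" if w: "norm w < 1" for w
  proof -
    have "(norm (g w))\<^sup>2 < (norm (2 * of_real M - g w))\<^sup>2"
    proof -
      have "M * Re (g w) < M * M" using Reg[OF w] M by simp
      then show ?thesis unfolding cmod_power2 by (simp add: power2_eq_square algebra_simps)
    qed
    then have "norm (g w) < norm (2 * of_real M - g w)"
      by (rule power2_less_imp_less) simp
    moreover from this have "0 < norm (2 * of_real M - g w)" using norm_ge_zero[of "g w"] by linarith
    ultimately show ?thesis by (simp add: h_def norm_divide)
  qed
  ultimately have schwarz: "norm (h w) \<le> norm w" if "norm w < 1" for w
    using Schwarz_Lemma(1)[of h w] that by blast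
  define w where "w = (z - a) / of_real R"
  have zw: "f z = g w" using r by (simp add: g_def w_def)
  have w: "norm w \<le> r / R" using z r by (simp add: w_def norm_divide dist_norm norm_minus_commute divide_right_mono)
  then have w1: "norm w < 1" using r by (smt (verit) divide_less_eq_1_pos)
  have hw: "norm (h w) \<le> r / R" using schwarz[OF w1] w by linarith
  have rR: "r / R < 1" using r by simp
  have "g w * (1 + h w) = 2 * of_real M * h w"
    using nz[OF w1] by (simp add: h_def field_simps)
  then have "norm (g w) * norm (1 + h w) = 2 * M * norm (h w)"
    using M by (metis abs_of_pos norm_mult norm_numeral norm_of_real)
  moreover have "1 - r / R \<le> norm (1 + h w)"
    using norm_triangle_ineq2[of 1 "- h w"] hw by simp
  ultimately have "norm (g w) * (1 - r / R) \<le> 2 * M * (r / R)"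
    using M hw by (smt (verit) mult_left_mono norm_ge_zero)
  then have "R * (norm (g w) * (1 - r / R)) \<le> R * (2 * M * (r / R))"
    using r by (intro mult_left_mono) auto
  moreover have "R * (norm (g w) * (1 - r / R)) = norm (g w) * (R - r)" "R * (2 * M * (r / R)) = 2 * M * r"
    using r by (simp_all add: right_diff_distrib)
  ultimately have "norm (g w) * (R - r) \<le> 2 * M * r" by simp
  then show ?thesis using r by (simp add: zw pos_le_divide_eq)
qed

text \<open>
  A zero-free function on a disc has a logarithm \<open>h\<close>, and the hypothesis bounds the real part of \<open>h - h a\<close> by \<open>M\<close>.
  Borel--Caratheodory bounds \<open>h - h a\<close> itself on the disc of radius \<open>r'\<close>, and Cauchy's inequality on circles of
  radius \<open>r' - r\<close> then bounds its derivative, which is the logarithmic derivative of \<open>g\<close>.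
\<close>

lemma norm_logderiv_le:
  fixes g :: "complex \<Rightarrow> complex"
  assumes g: "g holomorphic_on ball a R" "\<And>z. z \<in> ball a R \<Longrightarrow> g z \<noteq> 0"
    and bound: "\<And>z. z \<in> ball a R \<Longrightarrow> norm (g z) \<le> exp M * norm (g a)"
    and r: "0 < r" "r < r'" "r' < R" and z: "z \<in> cball a r"
  shows "norm (deriv g z / g z) \<le> 2 * (M + 1) * r' / (R - r') / (r' - r)"
proof -
  have "\<exists>h. h holomorphic_on ball a R \<and> (\<forall>z\<in>ball a R. g z = exp (h z))"
    using contractible_imp_holomorphic_log[OF g(1) convex_imp_contractible[OF convex_ball]] g(2) by metis
  then obtain h where h: "h holomorphic_on ball a R" "\<And>z. z \<in> ball a R \<Longrightarrow> g z = exp (h z)" by blast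
  define k where "k = (\<lambda>z. h z - h a)"
  have aR: "a \<in> ball a R" using r by simp
  have k: "k holomorphic_on ball a R" unfolding k_def by (intro holomorphic_intros h)
  \<comment> \<open>The bound \<open>M + 1\<close> instead of \<open>M\<close> makes the inequality strict.\<close>
  have Rek: "Re (k z) < M + 1" if z: "z \<in> ball a R" for z
  proof -
    have "exp (Re (h z)) \<le> exp (M + Re (h a))"
      using bound[OF z] h(2)[OF z] h(2)[OF aR] by (simp add: exp_add)
    then show ?thesis by (simp add: k_def)
  qed
  have bk: "norm (k z) \<le> 2 * (M + 1) * r' / (R - r')" if "z \<in> cball a r'" for z
    by (rule Borel_Caratheodory[OF k _ Rek]) (use r that in \<open>auto simp: k_def\<close>)
  have zR: "z \<in> ball a R" using z r by auto
  have sub: "cball z (r' - r) \<subseteq> cball a r'"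
    using z by (intro subsetI) (simp, metis add_le_cancel_left dist_triangle le_diff_eq order_trans add.commute add_mono)
  have sub': "cball a r' \<subseteq> ball a R" using r by auto
  have "norm ((deriv ^^ 1) k z) \<le> fact 1 * (2 * (M + 1) * r' / (R - r')) / (r' - r) ^ 1"
  proof (rule Cauchy_inequality)
    show "k holomorphic_on ball z (r' - r)"
      using sub sub' ball_subset_cball[of z "r' - r"] by (intro holomorphic_on_subset[OF k]) blast
    show "continuous_on (cball z (r' - r)) k"
      using sub sub' by (intro holomorphic_on_imp_continuous_on holomorphic_on_subset[OF k]) auto
    show "norm (k x) \<le> 2 * (M + 1) * r' / (R - r')" if "norm (z - x) = r' - r" for x
    proof (rule bk)
      have "x \<in> cball z (r' - r)" using that by (simp add: dist_norm)
      then show "x \<in> cball a r'" using sub by blast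
    qed
  qed (use r in auto)
  moreover have "deriv k z = deriv g z / g z"
  proof -
    have dk: "(h has_field_derivative deriv k z) (at z)"
    proof -
      have "(k has_field_derivative deriv k z) (at z)" using holomorphic_derivI[OF k _ zR] by auto
      then have "((\<lambda>z. k z + h a) has_field_derivative deriv k z) (at z)" by (auto intro!: derivative_eq_intros)
      then show ?thesis by (simp add: k_def)
    qed
    have "((\<lambda>z. exp (h z)) has_field_derivative exp (h z) * deriv k z) (at z)"
      using dk by (auto intro!: derivative_eq_intros)
    then have "(g has_field_derivative g z * deriv k z) (at z)"
      using has_field_derivative_transform_within_open[of "\<lambda>z. exp (h z)" _ z "ball a R" g] h(2) zR by fastforce
    then show ?thesis using DERIV_imp_deriv g(2)[OF zR] by fastforce
  qed
  ultimately show ?thesis by simp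
qed

lemma factor_simple_zeros:
  fixes f :: "complex \<Rightarrow> complex"
  assumes "finite Z" and f: "f holomorphic_on S" "open S" and "Z \<subseteq> S"
    and "\<And>z. z \<in> Z \<Longrightarrow> f z = 0" "\<And>z. z \<in> Z \<Longrightarrow> deriv f z \<noteq> 0"
  shows "\<exists>g. g holomorphic_on S \<and> (\<forall>s\<in>S. f s = g s * (\<Prod>z\<in>Z. s - z)) \<and> (\<forall>z\<in>Z. g z \<noteq> 0)"
  using assms(1,4-)
proof (induction Z rule: finite_induct)
  case empty
  then show ?case using f by auto
next
  case (insert w Z)
  then obtain g where g: "g holomorphic_on S" "\<And>s. s \<in> S \<Longrightarrow> f s = g s * (\<Prod>z\<in>Z. s - z)" "\<And>z. z \<in> Z \<Longrightarrow> g z \<noteq> 0"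
    by auto
  have wS: "w \<in> S" and fw: "f w = 0" "deriv f w \<noteq> 0" using insert.prems by auto
  have P0: "(\<Prod>z\<in>Z. w - z) \<noteq> 0" using insert.hyps by auto
  have gw: "g w = 0" using g(2)[OF wS] fw P0 by simp
  define g1 where "g1 = (\<lambda>s. if s = w then deriv g w else (g s - g w) / (s - w))"
  have g1: "g1 holomorphic_on S" unfolding g1_def by (rule pole_lemma_open[OF g(1) f(2)])
  have g_eq: "g s = g1 s * (s - w)" for s using gw by (simp add: g1_def)
  have "deriv g w \<noteq> 0"
  proof
    assume d0: "deriv g w = 0"
    have "(\<lambda>s. \<Prod>z\<in>Z. s - z) field_differentiable (at w)"
      by (rule holomorphic_on_imp_differentiable_at[of _ UNIV]) (auto intro!: holomorphic_intros)
    then obtain p where p: "((\<lambda>s. \<Prod>z\<in>Z. s - z) has_field_derivative p) (at w)"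
      by (auto simp: field_differentiable_def)
    have "(g has_field_derivative 0) (at w)" using holomorphic_derivI[OF g(1) f(2) wS] d0 by metis
    from DERIV_mult[OF this p] gw have "((\<lambda>s. g s * (\<Prod>z\<in>Z. s - z)) has_field_derivative 0) (at w)" by simp
    then have "(f has_field_derivative 0) (at w)"
      by (rule has_field_derivative_transform_within_open[OF _ f(2) wS]) (simp add: g(2))
    then show False using DERIV_imp_deriv fw by blast
  qed
  then have "g1 z \<noteq> 0" if "z \<in> insert w Z" for z
    using that g(3)[of z] g_eq[of z] by (auto simp: g1_def)
  moreover have "f s = g1 s * (\<Prod>z\<in>insert w Z. s - z)" if "s \<in> S" for s
    using g(2)[OF that] g_eq[of s] insert.hyps by simp
  ultimately show ?case using g1 by blast
qed

lemma has_field_derivative_prod_diff: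
  fixes s :: complex
  assumes "finite Z" "s \<notin> Z"
  shows "((\<lambda>s. \<Prod>z\<in>Z. s - z) has_field_derivative (\<Prod>z\<in>Z. s - z) * (\<Sum>z\<in>Z. 1 / (s - z))) (at s)"
  using assms
proof (induction Z rule: finite_induct)
  case (insert w Z)
  have "((\<lambda>s. (s - w) * (\<Prod>z\<in>Z. s - z)) has_field_derivative
      (\<Prod>z\<in>insert w Z. s - z) * (\<Sum>z\<in>insert w Z. 1 / (s - z))) (at s)"
    by (rule derivative_eq_intros insert.IH refl)+ (use insert in \<open>auto simp: field_simps\<close>)
  then show ?case using insert.hyps by simp
qed auto

section \<open>Sums over separated points\<close>

text \<open>
  Rounding to the nearest integer is injective on a 1-separated set, and it at most doubles a number \<open>\<ge> 1/2\<close>; so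
  the sum is dominated by one term for each positive integer up to \<open>K\<close>.
\<close>

lemma sum_separated_pos_le:
  fixes X :: "real set" and \<phi> :: "real \<Rightarrow> real"
  assumes "finite X" and range: "\<And>x. x \<in> X \<Longrightarrow> 1/2 \<le> x \<and> x < real K + 1/2"
    and sep: "\<And>x y. x \<in> X \<Longrightarrow> y \<in> X \<Longrightarrow> x \<noteq> y \<Longrightarrow> \<bar>x - y\<bar> \<ge> 1"
    and nonneg: "\<And>x. x > 0 \<Longrightarrow> \<phi> x \<ge> 0" and mono: "\<And>x y. 0 < x \<Longrightarrow> x \<le> y \<Longrightarrow> \<phi> y \<le> \<phi> x"
  shows "(\<Sum>x\<in>X. \<phi> x) \<le> (\<Sum>m=1..K. \<phi> (real m / 2))"
proof -
  define m where "m = (\<lambda>x::real. nat \<lfloor>x + 1/2\<rfloor>)"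
  have m: "1 \<le> m x" "m x \<le> K" "real (m x) / 2 \<le> x" if "x \<in> X" for x
    using range[OF that] unfolding m_def by linarith+
  have inj: "inj_on m X"
  proof (rule inj_onI, rule ccontr)
    fix x y assume xy: "x \<in> X" "y \<in> X" "m x = m y" "x \<noteq> y"
    then have "\<lfloor>x + 1/2\<rfloor> = \<lfloor>y + 1/2\<rfloor>" using range[of x] range[of y] unfolding m_def by linarith
    then have "\<bar>x - y\<bar> < 1" by linarith
    then show False using sep[OF xy(1,2,4)] by simp
  qed
  have "(\<Sum>x\<in>X. \<phi> x) \<le> (\<Sum>x\<in>X. \<phi> (real (m x) / 2))"
    using m by (intro sum_mono mono) (auto simp: Suc_le_eq)
  also have "\<dots> = (\<Sum>k\<in>m ` X. \<phi> (real k / 2))" by (simp add: sum.reindex[OF inj])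
  also have "\<dots> \<le> (\<Sum>k=1..K. \<phi> (real k / 2))"
    using m by (intro sum_mono2 nonneg) auto
  finally show ?thesis .
qed

lemma sum_separated_le:
  fixes X :: "real set" and \<phi> :: "real \<Rightarrow> real"
  assumes X: "finite X" and range: "\<And>x. x \<in> X \<Longrightarrow> 1/2 \<le> \<bar>x\<bar> \<and> \<bar>x\<bar> < real K + 1/2"
    and sep: "\<And>x y. x \<in> X \<Longrightarrow> y \<in> X \<Longrightarrow> x \<noteq> y \<Longrightarrow> \<bar>x - y\<bar> \<ge> 1"
    and nonneg: "\<And>x. x > 0 \<Longrightarrow> \<phi> x \<ge> 0" and mono: "\<And>x y. 0 < x \<Longrightarrow> x \<le> y \<Longrightarrow> \<phi> y \<le> \<phi> x"
  shows "(\<Sum>x\<in>X. \<phi> \<bar>x\<bar>) \<le> 2 * (\<Sum>m=1..K. \<phi> (real m / 2))"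
proof -
  have XX: "X = {x\<in>X. x > 0} \<union> {x\<in>X. x < 0}" using range by force
  have "(\<Sum>x\<in>X. \<phi> \<bar>x\<bar>) = (\<Sum>x\<in>{x\<in>X. x > 0}. \<phi> \<bar>x\<bar>) + (\<Sum>x\<in>{x\<in>X. x < 0}. \<phi> \<bar>x\<bar>)"
    by (subst XX, rule sum.union_disjoint) (use X in auto)
  also have "(\<Sum>x\<in>{x\<in>X. x > 0}. \<phi> \<bar>x\<bar>) = (\<Sum>x\<in>{x\<in>X. x > 0}. \<phi> x)"
    by (intro sum.cong) auto
  also have "\<dots> \<le> (\<Sum>m=1..K. \<phi> (real m / 2))"
    by (rule sum_separated_pos_le) (use X range sep nonneg mono in force)+
  also have "(\<Sum>x\<in>{x\<in>X. x < 0}. \<phi> \<bar>x\<bar>) = (\<Sum>x\<in>uminus ` {x\<in>X. x < 0}. \<phi> x)"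
    by (subst sum.reindex) (auto intro!: sum.cong)
  also have "\<dots> \<le> (\<Sum>m=1..K. \<phi> (real m / 2))"
  proof (rule sum_separated_pos_le)
    show "\<And>x y. x \<in> uminus ` {x\<in>X. x < 0} \<Longrightarrow> y \<in> uminus ` {x\<in>X. x < 0} \<Longrightarrow> x \<noteq> y \<Longrightarrow> \<bar>x - y\<bar> \<ge> 1"
      using sep by (force simp: abs_minus_commute)
    show "\<And>x. x \<in> uminus ` {x\<in>X. x < 0} \<Longrightarrow> 1/2 \<le> x \<and> x < real K + 1/2"
      using range by force
  qed (use X nonneg mono in auto)
  finally show ?thesis by simp
qed

lemma harm_le: "K > 0 \<Longrightarrow> harm K \<le> 1 + ln (real K)"
  using euler_mascheroni_sequence_decreasing[of 1 K] by (simp add: harm_def)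

lemma sum_inverse_squares_le: "(\<Sum>m=1..K. 1 / (real m)\<^sup>2) \<le> 2"
proof -
  have "(\<Sum>m=1..Suc n. 1 / (real m)\<^sup>2) \<le> 2 - 1 / real (Suc n)" for n
  proof (induction n)
    case (Suc n)
    let ?k = "real (Suc n)"
    have "1 / (?k + 1)\<^sup>2 \<le> 1 / (?k * (?k + 1))"
      by (intro divide_left_mono) (auto simp: power2_eq_square)
    also have "\<dots> = 1 / ?k - 1 / (?k + 1)" by (simp add: field_simps)
    finally have "1 / (real (Suc (Suc n)))\<^sup>2 \<le> 1 / real (Suc n) - 1 / real (Suc (Suc n))"
      by (simp add: add.commute)
    then show ?case using Suc by simp
  qed auto
  then have "(\<Sum>m=1..Suc n. 1 / (real m)\<^sup>2) \<le> 2" for n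
    by (meson diff_le_self of_nat_0_le_iff order_trans zero_le_divide_1_iff diff_ge_0_iff_ge le_diff_eq add_increasing2 dual_order.refl)
  then show ?thesis by (cases K) auto
qed

section \<open>Multiplicity and discreteness of the zeros\<close>

lemma zeta_2_nonzero: "zeta 2 \<noteq> 0"
  using zeta_lower_bound_Re_2[of 2] by auto

lemma connected_minus_one: "connected (- {1 :: complex})"
  using connected_punctured_universe[of "1 :: complex"] by simp

text \<open>
  The order of the zeta function at a point other than \<open>1\<close> is the exponent in a genuine power factorisation, since the
  function is holomorphic and not identically zero there.
\<close>

lemma zorder_zeta_zero:
  assumes "zeta s = 0" "s \<noteq> 1"
  shows "zorder zeta s > 0" and "zorder zeta s = 1 \<Longrightarrow> deriv zeta s \<noteq> 0"
proof -
  have "open (- {1 :: complex})" by auto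
  then have ex: "(if zeta s = 0 then zorder zeta s > 0 else zorder zeta s = 0) \<and> (\<exists>r. r > 0 \<and> cball s r \<subseteq> - {1} \<and> zor_poly zeta s holomorphic_on cball s r
    \<and> (\<forall>w\<in>cball s r. zeta w = zor_poly zeta s w * (w - s) ^ nat (zorder zeta s) \<and> zor_poly zeta s w \<noteq> 0))"
    by (rule zorder_exist_zero[OF zeta_holomorphic _ connected_minus_one])
       (use assms zeta_2_nonzero in \<open>auto intro!: bexI[of _ 2]\<close>)
  then show "zorder zeta s > 0" using assms by simp
  assume z1: "zorder zeta s = 1"
  obtain r where r: "r > 0" "zor_poly zeta s holomorphic_on cball s r"
    and fac': "\<forall>w\<in>cball s r. zeta w = zor_poly zeta s w * (w - s) ^ nat (zorder zeta s) \<and> zor_poly zeta s w \<noteq> 0"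
    using ex by blast
  have fac: "zeta w = zor_poly zeta s w * (w - s)" if "w \<in> cball s r" for w
    using bspec[OF fac' that] z1 by simp
  have s0: "zor_poly zeta s s \<noteq> 0" using bspec[OF fac', of s] r by simp
  have "zor_poly zeta s holomorphic_on ball s r" by (rule holomorphic_on_subset[OF r(2)]) auto
  then have "(zor_poly zeta s has_field_derivative deriv (zor_poly zeta s) s) (at s)"
    by (rule holomorphic_derivI) (use r in auto)
  then have "((\<lambda>w. zor_poly zeta s w * (w - s)) has_field_derivative zor_poly zeta s s) (at s)"
    by (auto intro!: derivative_eq_intros)
  then have "(zeta has_field_derivative zor_poly zeta s s) (at s)"
    by (rule has_field_derivative_transform_within_open[of _ _ _ "ball s r"])
       (use r fac in auto)
  then show "deriv zeta s \<noteq> 0" using DERIV_imp_deriv s0 by metis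
qed

text \<open>
  A zero \<open>s\<close> is assumed so that comparison with the value at \<open>2\<close> shows that zeta is not constant.
\<close>

lemma finite_zeta_zeros_compact:
  assumes "compact K" "1 \<notin> K" "zeta s = 0" "s \<noteq> 1"
  shows "finite {z\<in>K. zeta z = 0}"
proof (rule holomorphic_compact_finite_zeros[OF zeta_holomorphic _ connected_minus_one])
  show "\<not> zeta constant_on - {1}"
  proof
    assume "zeta constant_on - {1}"
    then obtain c where c: "\<And>x. x \<in> - {1} \<Longrightarrow> zeta x = c" unfolding constant_on_def by blast
    show False using c[of s] c[of 2] assms zeta_2_nonzero by simp
  qed
qed (use assms in auto)

section \<open>The enumeration of the zeros\<close>

context
  fixes \<rho> :: "nat \<Rightarrow> complex"
  assumes RH: riemann_hypothesis and enum: "upper_zeta_zeros_enumeration \<rho>"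
begin

lemma rho_zero: "\<rho> n \<in> nontrivial_zeta_zeros" "Im (\<rho> n) > 0" "zeta (\<rho> n) = 0" "\<rho> n \<noteq> 1" "Re (\<rho> n) = 1/2"
proof -
  show "\<rho> n \<in> nontrivial_zeta_zeros" "Im (\<rho> n) > 0"
    using enum by (auto simp: upper_zeta_zeros_enumeration_def)
  then show "zeta (\<rho> n) = 0" "\<rho> n \<noteq> 1" "Re (\<rho> n) = 1/2"
    using RH by (auto simp: nontrivial_zeta_zeros_def riemann_hypothesis_def)
qed

lemma card_rho_eq:
  assumes "z \<in> nontrivial_zeta_zeros" "Im z > 0"
  shows "int (card {n. \<rho> n = z}) = zorder zeta z" "zorder zeta z > 0"
  using enum assms zorder_zeta_zero[of z]
  by (auto simp: upper_zeta_zeros_enumeration_def nontrivial_zeta_zeros_def)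

lemma rho_surj:
  assumes "z \<in> nontrivial_zeta_zeros" "Im z > 0"
  obtains n where "\<rho> n = z"
proof -
  have "card {n. \<rho> n = z} > 0" using card_rho_eq[OF assms] by linarith
  then have "{n. \<rho> n = z} \<noteq> {}" by (metis card.empty less_irrefl)
  then show ?thesis using that by blast
qed

text \<open>
  Under the Riemann hypothesis the zeros up to height \<open>T\<close> lie on a compact segment that avoids the pole, so they are
  finite in number, and each of them is listed only finitely often.
\<close>

lemma finite_ordinates_le: "finite {n. Im (\<rho> n) \<le> T}"
proof -
  define K where "K = (\<lambda>y. Complex (1/2) y) ` {0..T}"
  have "continuous_on {0..T} (\<lambda>y. Complex (1/2) y)"
    unfolding Complex_eq by (intro continuous_intros)
  then have "compact K" unfolding K_def by (rule compact_continuous_image) simp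
  moreover have "1 \<notin> K" by (auto simp: K_def complex_eq_iff)
  ultimately have fin: "finite {z\<in>K. zeta z = 0}"
    using finite_zeta_zeros_compact rho_zero(3,4)[of 0] by blast
  have "finite (\<rho> -` {z} )" for z
  proof (cases "\<exists>n. \<rho> n = z")
    case True
    then have "z \<in> nontrivial_zeta_zeros" "Im z > 0" using rho_zero by auto
    from card_rho_eq[OF this] have "card {n. \<rho> n = z} > 0" by linarith
    then have "finite {n. \<rho> n = z}" using card_gt_0_iff by blast
    then show ?thesis by (simp add: vimage_def)
  next
    case False
    then have "\<rho> -` {z} = {}" by auto
    then show ?thesis by simp
  qed
  then have "finite (\<Union>z\<in>{z\<in>K. zeta z = 0}. \<rho> -` {z})" using fin by blast
  moreover have "{n. Im (\<rho> n) \<le> T} \<subseteq> (\<Union>z\<in>{z\<in>K. zeta z = 0}. \<rho> -` {z})"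
  proof
    fix n assume "n \<in> {n. Im (\<rho> n) \<le> T}"
    then have "\<rho> n \<in> K" using rho_zero[of n]
      unfolding K_def by (intro image_eqI[of _ _ "Im (\<rho> n)"]) (auto simp: complex_eq_iff)
    then show "n \<in> (\<Union>z\<in>{z\<in>K. zeta z = 0}. \<rho> -` {z})" using rho_zero(3) by auto
  qed
  ultimately show ?thesis by (rule finite_subset[rotated])
qed

lemma eventually_ordinate_gt: "eventually (\<lambda>n. Im (\<rho> n) > T) sequentially"
proof -
  have "eventually (\<lambda>n. n \<notin> {n. Im (\<rho> n) \<le> T}) cofinite"
    using finite_ordinates_le[of T] by (simp add: eventually_cofinite)
  then show ?thesis by (simp add: cofinite_eq_sequentially not_le)
qed

lemma ordinates_mono: "m \<le> n \<Longrightarrow> Im (\<rho> m) \<le> Im (\<rho> n)"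
  using enum by (auto simp: upper_zeta_zeros_enumeration_def dest: incseqD)

text \<open>
  A multiple zero would be listed at two consecutive indices, with gap \<open>0\<close>. Two distinct zeros are separated by at
  least the gap that follows the lower one, and the logarithm of its ordinate is at most \<open>ln y\<close>.
\<close>

lemma separated_zeros_if_large_gaps:
  assumes c: "c > 0" and gap: "eventually (\<lambda>n. (Im (\<rho> (Suc n)) - Im (\<rho> n)) * ln (Im (\<rho> n)) \<ge> c) sequentially"
  obtains T where "T \<ge> 2"
    "\<And>z. z \<in> nontrivial_zeta_zeros \<Longrightarrow> Im z \<ge> T \<Longrightarrow> deriv zeta z \<noteq> 0"
    "\<And>z w y. z \<in> nontrivial_zeta_zeros \<Longrightarrow> w \<in> nontrivial_zeta_zeros \<Longrightarrow> z \<noteq> w \<Longrightarrow> T \<le> Im z \<Longrightarrow> T \<le> Im w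
        \<Longrightarrow> Im z \<le> y \<Longrightarrow> Im w \<le> y \<Longrightarrow> \<bar>Im z - Im w\<bar> \<ge> c / ln y"
proof -
  obtain N where N: "\<And>n. n \<ge> N \<Longrightarrow> (Im (\<rho> (Suc n)) - Im (\<rho> n)) * ln (Im (\<rho> n)) \<ge> c"
    using gap by (auto simp: eventually_sequentially)
  define T where "T = max 2 (Im (\<rho> N) + 1)"
  have gap_le: "Im (\<rho> m) - Im (\<rho> n) \<ge> c / ln y" if "n < m" "Im (\<rho> n) \<ge> T" "Im (\<rho> n) \<le> y" for n m y
  proof -
    have "N < n"
    proof (rule ccontr)
      assume "\<not> N < n"
      then have "Im (\<rho> n) \<le> Im (\<rho> N)" by (intro ordinates_mono) auto
      then show False using that by (simp add: T_def)
    qed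
    then have "c \<le> (Im (\<rho> (Suc n)) - Im (\<rho> n)) * ln (Im (\<rho> n))" by (intro N) auto
    also have "\<dots> \<le> (Im (\<rho> m) - Im (\<rho> n)) * ln y"
      using that ordinates_mono[of "Suc n" m] ordinates_mono[of n "Suc n"]
      by (intro mult_mono) (auto simp: T_def intro!: ln_ge_zero)
    finally show ?thesis using that by (subst pos_divide_le_eq) (auto simp: T_def intro!: ln_gt_zero)
  qed
  show ?thesis
  proof (rule that[of T])
    show "T \<ge> 2" by (simp add: T_def)
    fix z assume z: "z \<in> nontrivial_zeta_zeros" "Im z \<ge> T"
    have z0: "Im z > 0" using z by (simp add: T_def)
    have "card {n. \<rho> n = z} \<le> 1"
    proof -
      have "n = m" if "\<rho> n = z" "\<rho> m = z" for n m
      proof (rule ccontr)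
        assume "n \<noteq> m"
        then have "0 \<ge> c / ln (Im z)"
          using gap_le[of n m "Im z"] gap_le[of m n "Im z"] that z by (cases n m rule: linorder_cases) auto
        moreover have "ln (Im z) > 0" using z by (simp add: T_def)
        ultimately show False using c by (simp add: divide_le_0_iff)
      qed
      then have "{n. \<rho> n = z} \<subseteq> {SOME n. \<rho> n = z}" by (metis (mono_tags) insertI1 mem_Collect_eq someI subsetI)
      then show ?thesis using card_mono[of "{SOME n. \<rho> n = z}"] by simp
    qed
    then have "zorder zeta z = 1" using card_rho_eq[OF z(1) z0] by linarith
    then show "deriv zeta z \<noteq> 0"
      using zorder_zeta_zero(2)[of z] z by (auto simp: nontrivial_zeta_zeros_def)
  next
    fix z w y assume *: "z \<in> nontrivial_zeta_zeros" "w \<in> nontrivial_zeta_zeros" "z \<noteq> w" "T \<le> Im z" "T \<le> Im w" "Im z \<le> y" "Im w \<le> y"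
    then have "Im z > 0" "Im w > 0" by (auto simp: T_def)
    with * obtain n m where nm: "\<rho> n = z" "\<rho> m = w" using rho_surj by metis
    then show "\<bar>Im z - Im w\<bar> \<ge> c / ln y"
      using gap_le[of n m y] gap_le[of m n y] * by (cases n m rule: linorder_cases) auto
  qed
qed

end

section \<open>Zeros of the derivative next to separated zeros\<close>

text \<open>
  The radius \<open>17/10\<close> is between \<open>3/2\<close>, the distance from the centre to the critical line, and \<open>19/10\<close>, which
  still keeps the disc inside \<open>Re s \<ge> 1/10\<close>, where polynomial growth is available.
\<close>

definition near_zeros :: "real \<Rightarrow> complex set" where
  "near_zeros t = {z \<in> cball (Complex 2 t) (17/10). zeta z = 0}"

text \<open>
  What large gaps provide, freed from the enumeration: simple zeros above height \<open>T\<close>, with ordinates at distance at least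
  \<open>c / ln y\<close> below height \<open>y\<close>.
\<close>

locale separated_zeros =
  fixes c T :: real
  assumes RH: riemann_hypothesis and c: "c > 0" and T: "T \<ge> 2"
    and simple: "\<And>z. z \<in> nontrivial_zeta_zeros \<Longrightarrow> Im z \<ge> T \<Longrightarrow> deriv zeta z \<noteq> 0"
    and separated: "\<And>z w y. z \<in> nontrivial_zeta_zeros \<Longrightarrow> w \<in> nontrivial_zeta_zeros \<Longrightarrow> z \<noteq> w \<Longrightarrow> T \<le> Im z \<Longrightarrow> T \<le> Im w
        \<Longrightarrow> Im z \<le> y \<Longrightarrow> Im w \<le> y \<Longrightarrow> \<bar>Im z - Im w\<bar> \<ge> c / ln y"
begin

lemma near_zerosD:
  assumes t: "t \<ge> T + 2" and z: "z \<in> near_zeros t"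
  shows "Re z = 1/2" "\<bar>Im z - t\<bar> \<le> 17/10" "deriv zeta z \<noteq> 0" "z \<in> nontrivial_zeta_zeros" "T \<le> Im z" "Im z \<le> t + 2" "zeta z = 0"
proof -
  have d: "norm (z - Complex 2 t) \<le> 17/10" and z0: "zeta z = 0"
    using z by (auto simp: near_zeros_def dist_norm norm_minus_commute)
  have re: "\<bar>Re z - 2\<bar> \<le> 17/10" and im: "\<bar>Im z - t\<bar> \<le> 17/10"
    using abs_Re_le_cmod[of "z - Complex 2 t"] abs_Im_le_cmod[of "z - Complex 2 t"] d by auto
  have "Re z \<le> 1" using zeta_nonzero_Re_gt_1[of z] z0 by (meson not_le)
  then have nt: "z \<in> nontrivial_zeta_zeros" using re im z0 t T by (auto simp: nontrivial_zeta_zeros_def)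
  then show "Re z = 1/2" using RH by (auto simp: riemann_hypothesis_def)
  show "T \<le> Im z" "Im z \<le> t + 2" using im t by linarith+
  show "\<bar>Im z - t\<bar> \<le> 17/10" "z \<in> nontrivial_zeta_zeros" "zeta z = 0" by fact+
  show "deriv zeta z \<noteq> 0" using nt \<open>T \<le> Im z\<close> by (rule simple)
qed

lemma finite_near_zeros:
  assumes t: "t \<ge> T + 2"
  shows "finite (near_zeros t)"
proof (cases "near_zeros t = {}")
  case False
  then obtain s where s: "s \<in> near_zeros t" by blast
  have "s \<noteq> 1" "zeta s = 0" using near_zerosD(1,7)[OF t s] by auto
  moreover have "1 \<notin> cball (Complex 2 t) (17/10)"
    using abs_Im_le_cmod[of "Complex 2 t - 1"] t T by (auto simp: dist_norm)
  ultimately show ?thesis unfolding near_zeros_def by (intro finite_zeta_zeros_compact[OF compact_cball])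
qed auto

lemma ln_add_2_le:
  assumes "t \<ge> T + 2"
  shows "ln (t + 2) \<le> 2 * ln t" "ln t \<ge> 1"
proof -
  have t: "t \<ge> 4" using assms T by simp
  have "4 * t \<le> t * t" using t by (intro mult_right_mono) auto
  then have "t + 2 \<le> t * t" using t by linarith
  then have "ln (t + 2) \<le> ln (t * t)" using t by (intro ln_mono) auto
  then show "ln (t + 2) \<le> 2 * ln t" using t by (simp add: ln_mult)
  have "exp 1 \<le> (4::real)" using exp_le by simp
  then have "exp 1 \<le> t" using t by linarith
  then show "ln t \<ge> 1" using t by (simp add: ln_ge_iff)
qed

lemma near_zeros_separated:
  assumes t: "t \<ge> T + 2" and "z \<in> near_zeros t" "w \<in> near_zeros t" "z \<noteq> w"
  shows "\<bar>Im z - Im w\<bar> \<ge> c / (2 * ln t)"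
proof -
  have "c / (2 * ln t) \<le> c / ln (t + 2)"
    using ln_add_2_le[OF t] c T t by (intro divide_left_mono mult_pos_pos ln_gt_zero) auto
  also have "\<dots> \<le> \<bar>Im z - Im w\<bar>"
    using assms near_zerosD by (intro separated) auto
  finally show ?thesis .
qed

text \<open>
  Rescaled by the separation \<open>\<eta> = c / (2 ln t)\<close> and shifted to the right of \<open>1/2\<close>, the ordinates form a 1-separated set
  in an interval of length about \<open>4 / \<eta>\<close>.
\<close>

lemma card_near_zeros_le:
  assumes t: "t \<ge> T + 2"
  shows "real (card (near_zeros t)) \<le> (8 / c + 3) * ln t"
proof -
  define \<eta> where "\<eta> = c / (2 * ln t)"
  have \<eta>: "\<eta> > 0" using c ln_add_2_le[OF t] by (simp add: \<eta>_def)
  define h where "h = (\<lambda>z. (Im z - (t - 2)) / \<eta> + 1/2)"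
  define K where "K = nat \<lceil>4 / \<eta>\<rceil> + 1"
  have sep: "\<bar>h z - h w\<bar> \<ge> 1" if "z \<in> near_zeros t" "w \<in> near_zeros t" "z \<noteq> w" for z w
  proof -
    have "h z - h w = (Im z - Im w) / \<eta>" by (simp add: h_def diff_divide_distrib)
    then show ?thesis using near_zeros_separated[OF t that] \<eta> by (simp add: \<eta>_def[symmetric])
  qed
  have inj: "inj_on h (near_zeros t)"
  proof (rule inj_onI, rule ccontr)
    fix z w assume "z \<in> near_zeros t" "w \<in> near_zeros t" "h z = h w" "z \<noteq> w"
    then show False using sep[of z w] by simp
  qed
  have "(\<Sum>x\<in>h ` near_zeros t. 1) \<le> (\<Sum>m=1..K. 1 :: real)"
  proof (rule sum_separated_pos_le)
    show "finite (h ` near_zeros t)" using finite_near_zeros[OF t] by simp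
    show "1/2 \<le> x \<and> x < real K + 1/2" if "x \<in> h ` near_zeros t" for x
    proof -
      obtain z where z: "z \<in> near_zeros t" "x = h z" using \<open>x \<in> _\<close> by blast
      have b: "0 \<le> Im z - (t - 2)" "Im z - (t - 2) \<le> 4" using near_zerosD(2)[OF t z(1)] by linarith+
      have "0 \<le> (Im z - (t - 2)) / \<eta>" using b(1) \<eta> by (rule divide_nonneg_pos)
      moreover have "(Im z - (t - 2)) / \<eta> \<le> 4 / \<eta>" using b(2) \<eta> by (intro divide_right_mono) auto
      moreover have "4 / \<eta> < real K" unfolding K_def by linarith
      ultimately show ?thesis by (simp add: z(2) h_def)
    qed
    show "\<bar>x - y\<bar> \<ge> 1" if "x \<in> h ` near_zeros t" "y \<in> h ` near_zeros t" "x \<noteq> y" for x y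
      using that sep by auto
  qed auto
  then have "real (card (near_zeros t)) \<le> real K" by (simp add: card_image[OF inj])
  also have "real K \<le> 4 / \<eta> + 2"
  proof -
    have "4 / \<eta> \<ge> 0" using \<eta> by simp
    then show ?thesis unfolding K_def by linarith
  qed
  also have "4 / \<eta> = 8 / c * ln t" by (simp add: \<eta>_def)
  also have "8 / c * ln t + 2 \<le> (8 / c + 3) * ln t" using ln_add_2_le(2)[OF t] by (simp add: algebra_simps)
  finally show ?thesis .
qed

text \<open>
  Divide out the zeros in the disc: \<open>\<zeta> s = g s \<Prod> (s - z)\<close>. On the circle of radius \<open>37/20\<close> each factor
  \<open>|2 + i t - z| / |s - z|\<close> is at most \<open>12\<close>, so by the maximum principle \<open>|g s / g (2 + i t)|\<close> is at most a power of \<open>t\<close> times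
  \<open>12\<close> to the number of zeros, which is \<open>exp (O(ln t))\<close>. As \<open>g\<close> has no zeros in the disc of radius \<open>17/10\<close>, its
  logarithmic derivative \<open>F\<close> is \<open>O(ln t)\<close> on the disc of radius \<open>8/5\<close>.
\<close>

lemma logderiv_zeta_near_zeros:
  obtains C where "C \<ge> 1"
    "\<And>t. t \<ge> T + 2 \<Longrightarrow> \<exists>F. F holomorphic_on ball (Complex 2 t) (17/10) \<and>
       (\<forall>s\<in>cball (Complex 2 t) (16/10). norm (F s) \<le> C * ln t) \<and>
       (\<forall>s\<in>ball (Complex 2 t) (17/10). s \<notin> near_zeros t \<longrightarrow>
          deriv zeta s / zeta s = F s + (\<Sum>z\<in>near_zeros t. 1 / (s - z)))"
proof -
  obtain A where A: "A \<ge> 1" "\<And>s. Re s \<ge> 1/10 \<Longrightarrow> \<bar>Im s\<bar> \<ge> 1 \<Longrightarrow> norm (zeta s) \<le> A * norm s"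
    by (rule zeta_growth) (rule that)
  define C where "C = 1320 * (ln (5 * A) + 2 + (8 / c + 3) * ln 12 + 1)"
  have "C \<ge> 1320 * (0 + 2 + 0 + 1)"
    unfolding C_def using A c by (intro mult_left_mono add_mono mult_nonneg_nonneg) auto
  then have C1: "C \<ge> 1" by simp
  show ?thesis
  proof (rule that[OF C1])
    fix t assume t: "t \<ge> T + 2"
    let ?a = "Complex 2 t"
    let ?P = "\<lambda>s. \<Prod>z\<in>near_zeros t. s - z"
    define S where "S = ball ?a (19/10)"
    define Z where "Z = near_zeros t"
    have finZ: "finite Z" unfolding Z_def by (rule finite_near_zeros[OF t])
    have S: "Re s \<ge> 1/10" "\<bar>Im s\<bar> \<ge> 1" "norm s \<le> t + 4" if "s \<in> S" for s
    proof -
      have d: "norm (s - ?a) < 19/10" using that by (simp add: S_def dist_norm norm_minus_commute)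
      have "\<bar>Re s - 2\<bar> \<le> norm (s - ?a)" "\<bar>Im s - t\<bar> \<le> norm (s - ?a)"
        using abs_Re_le_cmod[of "s - ?a"] abs_Im_le_cmod[of "s - ?a"] by simp_all
      then show "Re s \<ge> 1/10" "\<bar>Im s\<bar> \<ge> 1" using d t T by linarith+
      have "norm s \<le> norm (s - ?a) + norm ?a" using norm_triangle_ineq[of "s - ?a" ?a] by simp
      moreover have "norm ?a \<le> 2 + t" using cmod_le[of ?a] t T by simp
      ultimately show "norm s \<le> t + 4" using d by linarith
    qed
    have S1: "S \<subseteq> - {1}" using S(2) by force
    have ZS: "Z \<subseteq> S" by (auto simp: Z_def S_def near_zeros_def)
    have "\<exists>g. g holomorphic_on S \<and> (\<forall>s\<in>S. zeta s = g s * (\<Prod>z\<in>Z. s - z)) \<and> (\<forall>z\<in>Z. g z \<noteq> 0)"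
    proof (rule factor_simple_zeros[OF finZ holomorphic_on_subset[OF zeta_holomorphic S1] _ ZS])
      show "open S" by (simp add: S_def)
      show "zeta z = 0" "deriv zeta z \<noteq> 0" if "z \<in> Z" for z
        using near_zerosD(3,7)[OF t, of z] that by (simp_all add: Z_def)
    qed
    then obtain g where g: "g holomorphic_on S" "\<And>s. s \<in> S \<Longrightarrow> zeta s = g s * (\<Prod>z\<in>Z. s - z)" "\<And>z. z \<in> Z \<Longrightarrow> g z \<noteq> 0"
      by blast
    have sub: "ball ?a (17/10) \<subseteq> S" by (auto simp: S_def)
    have gnz: "g s \<noteq> 0" if "s \<in> ball ?a (17/10)" for s
    proof (cases "s \<in> Z")
      case False
      then have "zeta s \<noteq> 0" using that by (auto simp: Z_def near_zeros_def)
      then show ?thesis using g(2)[of s] that sub by auto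
    qed (use g in auto)
    have aS: "?a \<in> S" by (simp add: S_def)
    have a_nz: "?a \<notin> Z" using near_zerosD(1)[OF t, of ?a] by (auto simp: Z_def)
    define N where "N = card Z"
    define M where "M = ln (5 * A) + 2 * ln t + real N * ln 12"
    have "4 * t \<le> t * t" using t T by (intro mult_right_mono) auto
    then have "t + 4 \<le> t * t" using t T by linarith
    moreover have "exp (ln t) = t" using t T by (intro exp_ln) auto
    ultimately have t4: "t + 4 \<le> exp (2 * ln t)" by (simp only: mult_2 exp_add)
    have expM: "exp M = 5 * A * exp (2 * ln t) * 12 ^ N"
    proof -
      have "exp (ln (5 * A)) = 5 * A" using A by (intro exp_ln) auto
      moreover have "exp (ln 12) = (12 :: real)" by simp
      ultimately show ?thesis by (simp only: M_def exp_add exp_of_nat_mult)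
    qed
    have bound: "norm (g s) \<le> exp M * norm (g ?a)" if s: "s \<in> ball ?a (185/100)" for s
    proof (rule maximum_modulus_frontier[of g "ball ?a (185/100)"])
      have cb: "cball ?a (185/100) \<subseteq> S" by (auto simp: S_def)
      then show "g holomorphic_on interior (ball ?a (185/100))"
        by (intro holomorphic_on_subset[OF g(1)]) auto
      show "continuous_on (closure (ball ?a (185/100))) g"
        using cb by (intro holomorphic_on_imp_continuous_on holomorphic_on_subset[OF g(1)]) auto
      fix w assume "w \<in> frontier (ball ?a (185/100))"
      then have w: "norm (?a - w) = 185/100" by (simp add: frontier_ball dist_norm)
      then have wS: "w \<in> S" by (simp add: S_def dist_norm)
      have far: "norm (?a - z) \<le> 12 * norm (w - z)" if "z \<in> Z" for z
      proof -
        have az: "norm (?a - z) \<le> 17/10" using that by (simp add: Z_def near_zeros_def dist_norm)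
        moreover have "norm (?a - w) \<le> norm (?a - z) + norm (w - z)"
          using norm_triangle_ineq4[of "?a - z" "w - z"] by simp
        ultimately have "norm (w - z) \<ge> 15/100" using w by linarith
        then show ?thesis using az by linarith
      qed
      have "norm (\<Prod>z\<in>Z. ?a - z) \<le> (\<Prod>z\<in>Z. 12 * norm (w - z))"
        unfolding prod_norm[symmetric] by (intro prod_mono) (use far in auto)
      also have "\<dots> = 12 ^ N * norm (\<Prod>z\<in>Z. w - z)"
        by (simp add: prod.distrib N_def prod_norm)
      finally have prods: "norm (\<Prod>z\<in>Z. ?a - z) \<le> 12 ^ N * norm (\<Prod>z\<in>Z. w - z)" .
      have "norm (g w) * norm (\<Prod>z\<in>Z. ?a - z) \<le> norm (g w) * (12 ^ N * norm (\<Prod>z\<in>Z. w - z))"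
        by (intro mult_left_mono prods) auto
      also have "\<dots> = 12 ^ N * norm (zeta w)" using g(2)[OF wS] by (simp add: norm_mult)
      also have "\<dots> \<le> 12 ^ N * (A * (t + 4))"
      proof -
        have "norm (zeta w) \<le> A * norm w" using S[OF wS] A by blast
        also have "\<dots> \<le> A * (t + 4)" using S(3)[OF wS] A by (intro mult_left_mono) auto
        finally show ?thesis by simp
      qed
      also have "\<dots> \<le> 12 ^ N * (A * exp (2 * ln t))" using t4 A by simp
      also have "\<dots> = exp M * (1/5)" by (simp add: expM)
      also have "\<dots> \<le> exp M * norm (zeta ?a)" using zeta_lower_bound_Re_2[of ?a] by simp
      also have "\<dots> = exp M * norm (g ?a) * norm (\<Prod>z\<in>Z. ?a - z)" using g(2)[OF aS] by (simp add: norm_mult)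
      finally have "norm (g w) * norm (\<Prod>z\<in>Z. ?a - z) \<le> exp M * norm (g ?a) * norm (\<Prod>z\<in>Z. ?a - z)" .
      moreover have "norm (\<Prod>z\<in>Z. ?a - z) > 0" using a_nz finZ by auto
      ultimately show "norm (g w) \<le> exp M * norm (g ?a)" by (simp add: mult_le_cancel_right)
    qed (use s in auto)
    define F where "F = (\<lambda>s. deriv g s / g s)"
    have "F holomorphic_on ball ?a (17/10)"
      unfolding F_def using gnz sub
      by (intro holomorphic_intros holomorphic_deriv holomorphic_on_subset[OF g(1)]) auto
    moreover have "norm (F s) \<le> C * ln t" if s: "s \<in> cball ?a (16/10)" for s
    proof -
      have "norm (F s) \<le> 2 * (M + 1) * (165/100) / (17/10 - 165/100) / (165/100 - 16/10)"
        unfolding F_def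
      proof (rule norm_logderiv_le)
        show "g holomorphic_on ball ?a (17/10)" by (rule holomorphic_on_subset[OF g(1) sub])
        show "norm (g z) \<le> exp M * norm (g ?a)" if "z \<in> ball ?a (17/10)" for z
          using that by (intro bound) auto
      qed (use gnz s in auto)
      \<comment> \<open>The radii \<open>r = 16/10\<close>, \<open>r' = 165/100\<close> and \<open>R = 17/10\<close> produce the factor \<open>1320\<close>.\<close>
      also have "\<dots> = 1320 * (M + 1)" by simp
      also have "\<dots> \<le> 1320 * (ln (5 * A) * ln t + 2 * ln t + (8 / c + 3) * ln t * ln 12 + ln t)"
        unfolding M_def N_def Z_def using card_near_zeros_le[OF t] ln_add_2_le(2)[OF t] A
        by (intro mult_left_mono add_mono mult_right_mono) (auto simp: mult_le_cancel_left1)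
      also have "\<dots> = C * ln t" by (simp add: C_def algebra_simps)
      finally show ?thesis .
    qed
    moreover have "deriv zeta s / zeta s = F s + (\<Sum>z\<in>Z. 1 / (s - z))" if s: "s \<in> ball ?a (17/10)" "s \<notin> Z" for s
    proof -
      have sS: "s \<in> S" using s sub by blast
      have pnz: "(\<Prod>z\<in>Z. s - z) \<noteq> 0" using s finZ by auto
      have "(g has_field_derivative deriv g s) (at s)"
        by (rule holomorphic_derivI[OF g(1) _ sS]) (simp add: S_def)
      from DERIV_mult[OF this has_field_derivative_prod_diff[OF finZ s(2)]]
      have "((\<lambda>s. g s * (\<Prod>z\<in>Z. s - z)) has_field_derivative
          deriv g s * (\<Prod>z\<in>Z. s - z) + (\<Prod>z\<in>Z. s - z) * (\<Sum>z\<in>Z. 1 / (s - z)) * g s) (at s)" .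
      then have "(zeta has_field_derivative
          deriv g s * (\<Prod>z\<in>Z. s - z) + (\<Prod>z\<in>Z. s - z) * (\<Sum>z\<in>Z. 1 / (s - z)) * g s) (at s)"
        by (rule has_field_derivative_transform_within_open[of _ _ _ S]) (use sS g(2) in \<open>auto simp: S_def\<close>)
      then have "deriv zeta s = deriv g s * (\<Prod>z\<in>Z. s - z) + (\<Prod>z\<in>Z. s - z) * (\<Sum>z\<in>Z. 1 / (s - z)) * g s"
        by (rule DERIV_imp_deriv)
      then show ?thesis
        unfolding g(2)[OF sS] F_def using pnz gnz[OF s(1)] by (simp add: add_divide_distrib)
    qed
    ultimately show "\<exists>F. F holomorphic_on ball (Complex 2 t) (17/10) \<and>
       (\<forall>s\<in>cball (Complex 2 t) (16/10). norm (F s) \<le> C * ln t) \<and>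
       (\<forall>s\<in>ball (Complex 2 t) (17/10). s \<notin> near_zeros t \<longrightarrow>
          deriv zeta s / zeta s = F s + (\<Sum>z\<in>near_zeros t. 1 / (s - z)))"
      unfolding Z_def by blast
  qed
qed

text \<open>
  At points of the critical line that are not zeros the terms \<open>1 / (s - z)\<close> have real part \<open>0\<close>, so \<open>Re F\<close> is the real
  part of the logarithmic derivative of zeta. The point \<open>1/2 + i t\<close> itself may be a zero and is reached by continuity.
  The height \<open>exp 60\<close> makes \<open>ln t / 4\<close> larger than the additive constants.
\<close>

lemma Re_regular_part_le:
  assumes t: "t \<ge> T + 2" "t \<ge> exp 60"
    and F: "F holomorphic_on ball (Complex 2 t) (17/10)"
      "\<And>s. s \<in> ball (Complex 2 t) (17/10) \<Longrightarrow> s \<notin> near_zeros t \<Longrightarrow>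
          deriv zeta s / zeta s = F s + (\<Sum>z\<in>near_zeros t. 1 / (s - z))"
  shows "Re (F (Complex (1/2) t)) \<le> - ln t / 4"
proof -
  let ?B = "ball (Complex 2 t) (17/10)"
  have t4: "t \<ge> 4" using t T by simp
  have in_ball: "Complex (1/2) y \<in> ?B" if "\<bar>y - t\<bar> < 1/10" for y
  proof -
    have "norm (Complex 2 t - Complex (1/2) y) \<le> \<bar>3/2\<bar> + \<bar>t - y\<bar>"
      using cmod_le[of "Complex 2 t - Complex (1/2) y"] by simp
    then show ?thesis using that by (simp add: dist_norm abs_minus_commute)
  qed
  have "isCont (\<lambda>y. Complex (1/2) y) t"
    unfolding Complex_eq by (intro continuous_intros)
  moreover have "isCont F (Complex (1/2) t)"
    using holomorphic_on_imp_continuous_on[OF F(1)] in_ball[of t] by (simp add: continuous_on_eq_continuous_at)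
  ultimately have "isCont (\<lambda>y. F (Complex (1/2) y)) t"
    by (rule isCont_o2)
  then have lim1: "((\<lambda>y. Re (F (Complex (1/2) y))) \<longlongrightarrow> Re (F (Complex (1/2) t))) (at t)"
    by (intro tendsto_Re) (simp add: isCont_def)
  have lim2: "((\<lambda>y. (ln pi - (ln (y / 2) - 9)) / 2) \<longlongrightarrow> (ln pi - (ln (t / 2) - 9)) / 2) (at t)"
    using t4 by (intro tendsto_intros) auto
  have "eventually (\<lambda>y. \<forall>z\<in>near_zeros t. y \<noteq> Im z) (at t)"
    by (intro eventually_ball_finite ballI finite_near_zeros[OF t(1)] eventually_neq_at_within)
  moreover have "eventually (\<lambda>y. \<bar>y - t\<bar> < 1/10) (at t)"
    using eventually_at_ball[of "1/10" t UNIV] by (simp add: dist_real_def abs_minus_commute)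
  ultimately have "eventually (\<lambda>y. Re (F (Complex (1/2) y)) \<le> (ln pi - (ln (y / 2) - 9)) / 2) (at t)"
  proof eventually_elim
    case (elim y)
    let ?s = "Complex (1/2) y"
    have s: "?s \<in> ?B" "?s \<notin> near_zeros t" using in_ball elim by auto
    then have nz: "zeta ?s \<noteq> 0" by (auto simp: near_zeros_def)
    have "Re (\<Sum>z\<in>near_zeros t. 1 / (?s - z)) = 0"
      unfolding Re_sum
    proof (rule sum.neutral, rule ballI)
      fix z assume "z \<in> near_zeros t"
      then have "Re z = 1/2" by (rule near_zerosD(1)[OF t(1)])
      then show "Re (1 / (?s - z)) = 0" by (simp add: Re_divide)
    qed
    then have "Re (F ?s) = Re (deriv zeta ?s / zeta ?s)" using F(2)[OF s] by simp
    also have "\<dots> = (ln pi - Re (Digamma (Complex (1/4) (y/2)))) / 2"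
      by (rule Re_zeta_logderiv_critical_line[OF nz])
    also have "\<dots> \<le> (ln pi - (ln (y / 2) - 9)) / 2"
    proof -
      have "y / 2 \<ge> 1" using elim t4 by linarith
      from Re_Digamma_ge[OF this] show ?thesis by simp
    qed
    finally show ?case .
  qed
  then have "Re (F (Complex (1/2) t)) \<le> (ln pi - (ln (t / 2) - 9)) / 2"
    by (intro tendsto_le[OF trivial_limit_at lim2 lim1])
  also have "\<dots> \<le> - ln t / 4"
  proof -
    have "ln t \<ge> 60" using t(2) t4 by (simp add: ln_ge_iff)
    moreover have "ln (t / 2) = ln t - ln 2" using t4 by (simp add: ln_div)
    moreover have "ln pi \<le> 3" using ln_le_minus_one[of pi] pi_less_4 by simp
    moreover have "ln (2::real) \<le> 1" using ln_le_minus_one[of "2::real"] by simp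
    ultimately show ?thesis by simp
  qed
  finally show ?thesis .
qed

text \<open>
  Rescaled by the separation \<open>\<eta> = c / (2 ln t)\<close>, the distances from \<open>t\<close> become a 1-separated set bounded by \<open>4 / \<eta>\<close>, and all but
  the nearest zero are at distance at least \<open>1/2\<close>. The sums are then at most a harmonic sum of length \<open>O(ln t)\<close> and a partial
  sum of \<open>\<Sum> 1 / m\<^sup>2\<close>.
\<close>

lemma far_zeros_sums_le:
  assumes t: "t \<ge> T + 2" and z0: "z0 \<in> near_zeros t"
    and nearest: "\<forall>z\<in>near_zeros t. \<bar>Im z0 - t\<bar> \<le> \<bar>Im z - t\<bar>"
  shows "(\<Sum>z\<in>near_zeros t - {z0}. 1 / \<bar>Im z - t\<bar>) \<le> (8 / c) * (2 + ln (8 / c + 1)) * ln t * (1 + ln (ln t))"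
    and "(\<Sum>z\<in>near_zeros t - {z0}. 1 / (Im z - t)\<^sup>2) \<le> 64 / c\<^sup>2 * (ln t)\<^sup>2"
    and "\<And>z. z \<in> near_zeros t - {z0} \<Longrightarrow> Im z \<noteq> t"
proof -
  define L where "L = ln t"
  have L: "L \<ge> 1" using ln_add_2_le[OF t] by (simp add: L_def)
  define \<eta> where "\<eta> = c / (2 * L)"
  have \<eta>: "\<eta> > 0" using c L by (simp add: \<eta>_def)
  define h where "h = (\<lambda>z. (Im z - t) / \<eta>)"
  define Y where "Y = near_zeros t - {z0}"
  define K where "K = nat \<lceil>4 / \<eta>\<rceil>"
  have finY: "finite Y" using finite_near_zeros[OF t] by (simp add: Y_def)
  have sep: "\<bar>h z - h w\<bar> \<ge> 1" if "z \<in> Y" "w \<in> Y" "z \<noteq> w" for z w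
  proof -
    have "h z - h w = (Im z - Im w) / \<eta>" by (simp add: h_def diff_divide_distrib)
    moreover have "\<bar>Im z - Im w\<bar> \<ge> \<eta>"
      using near_zeros_separated[OF t, of z w] that by (simp add: \<eta>_def L_def Y_def)
    ultimately show ?thesis using \<eta> by simp
  qed
  have inj: "inj_on h Y"
  proof (rule inj_onI, rule ccontr)
    fix z w assume "z \<in> Y" "w \<in> Y" "h z = h w" "z \<noteq> w"
    then show False using sep[of z w] by simp
  qed
  have range: "1/2 \<le> \<bar>x\<bar> \<and> \<bar>x\<bar> < real K + 1/2" if "x \<in> h ` Y" for x
  proof -
    obtain z where z: "z \<in> Y" "x = h z" using \<open>x \<in> _\<close> by blast
    then have zn: "z \<in> near_zeros t" "z0 \<noteq> z" by (auto simp: Y_def)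
    have "\<bar>Im z0 - Im z\<bar> \<ge> \<eta>"
      using near_zeros_separated[OF t z0 zn] by (simp add: \<eta>_def L_def)
    then have "\<eta> / 2 \<le> \<bar>Im z - t\<bar>" using bspec[OF nearest zn(1)] by linarith
    then have "1/2 \<le> \<bar>x\<bar>" using \<eta> by (simp add: z(2) h_def field_simps)
    moreover have "\<bar>x\<bar> \<le> 4 / \<eta>"
      using near_zerosD(2)[OF t zn(1)] \<eta> by (simp add: z(2) h_def divide_right_mono)
    moreover have "4 / \<eta> \<le> real K" unfolding K_def by linarith
    ultimately show ?thesis by linarith
  qed
  have K: "K > 0" using \<eta> by (simp add: K_def)
  have separated_sum: "(\<Sum>z\<in>Y. \<phi> \<bar>h z\<bar>) \<le> 2 * (\<Sum>m=1..K. \<phi> (real m / 2))"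
    if "\<And>x. x > 0 \<Longrightarrow> \<phi> x \<ge> 0" "\<And>x y. 0 < x \<Longrightarrow> x \<le> y \<Longrightarrow> \<phi> y \<le> \<phi> x" for \<phi> :: "real \<Rightarrow> real"
  proof -
    have "(\<Sum>x\<in>h ` Y. \<phi> \<bar>x\<bar>) \<le> 2 * (\<Sum>m=1..K. \<phi> (real m / 2))"
      by (rule sum_separated_le) (use finY range sep that in auto)
    then show ?thesis by (simp add: sum.reindex[OF inj])
  qed
  have "(\<Sum>z\<in>Y. 1 / \<bar>Im z - t\<bar>) = (\<Sum>z\<in>Y. 1 / \<bar>h z\<bar>) / \<eta>"
    unfolding sum_divide_distrib using \<eta> by (intro sum.cong) (auto simp: h_def)
  also have "\<dots> \<le> (2 * (\<Sum>m=1..K. 1 / (real m / 2))) / \<eta>"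
    using \<eta> by (intro divide_right_mono separated_sum[of "\<lambda>x. 1 / x"]) (auto intro!: divide_left_mono)
  also have "(\<Sum>m=1..K. 1 / (real m / 2)) = 2 * harm K"
    unfolding harm_def sum_distrib_left by (intro sum.cong refl) (simp add: inverse_eq_divide)
  also have "2 * (2 * harm K) / \<eta> \<le> 4 * ((2 + ln (8 / c + 1)) * (1 + ln L)) / \<eta>"
  proof -
    have "real K \<le> 4 / \<eta> + 1"
    proof -
      have "4 / \<eta> \<ge> 0" using \<eta> by simp
      then show ?thesis unfolding K_def by linarith
    qed
    also have "4 / \<eta> = 8 / c * L" by (simp add: \<eta>_def)
    also have "8 / c * L + 1 \<le> (8 / c + 1) * L" using L by (simp add: algebra_simps)
    finally have "ln (real K) \<le> ln ((8 / c + 1) * L)" using K by (intro ln_mono) auto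
    also have "\<dots> = ln (8 / c + 1) + ln L"
    proof (rule ln_mult_pos)
      show "8 / c + 1 > 0" using c by (intro add_pos_pos) auto
      show "L > 0" using L by simp
    qed
    finally have "harm K \<le> 1 + (ln (8 / c + 1) + ln L)" using harm_le[OF K] by linarith
    also have "\<dots> \<le> (2 + ln (8 / c + 1)) * (1 + ln L)"
    proof -
      have "ln (8 / c + 1) \<ge> 0" using c by (intro ln_ge_zero) auto
      moreover have "ln L \<ge> 0" using L by (intro ln_ge_zero) auto
      ultimately have "ln (8 / c + 1) * ln L \<ge> 0" "ln L \<ge> 0" by auto
      then show ?thesis by (simp add: algebra_simps)
    qed
    finally show ?thesis using \<eta> by (intro divide_right_mono) auto
  qed
  also have "4 * ((2 + ln (8 / c + 1)) * (1 + ln L)) / \<eta> = (8 / c) * (2 + ln (8 / c + 1)) * L * (1 + ln L)"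
    by (simp add: \<eta>_def)
  finally show "(\<Sum>z\<in>near_zeros t - {z0}. 1 / \<bar>Im z - t\<bar>) \<le> (8 / c) * (2 + ln (8 / c + 1)) * ln t * (1 + ln (ln t))"
    by (simp only: L_def Y_def)
  have "(\<Sum>z\<in>Y. 1 / (Im z - t)\<^sup>2) = (\<Sum>z\<in>Y. 1 / \<bar>h z\<bar>\<^sup>2) / \<eta>\<^sup>2"
    unfolding sum_divide_distrib using \<eta> by (intro sum.cong) (auto simp: h_def power_divide)
  also have "\<dots> \<le> (2 * (\<Sum>m=1..K. 1 / (real m / 2)\<^sup>2)) / \<eta>\<^sup>2"
    using \<eta> by (intro divide_right_mono separated_sum[of "\<lambda>x. 1 / x\<^sup>2"]) (auto intro!: divide_left_mono power_mono)
  also have "(\<Sum>m=1..K. 1 / (real m / 2)\<^sup>2) = 4 * (\<Sum>m=1..K. 1 / (real m)\<^sup>2)"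
    unfolding sum_distrib_left by (intro sum.cong refl) (simp add: power_divide)
  also have "2 * (4 * (\<Sum>m=1..K. 1 / (real m)\<^sup>2)) / \<eta>\<^sup>2 \<le> 2 * (4 * 2) / \<eta>\<^sup>2"
    by (intro divide_right_mono mult_left_mono sum_inverse_squares_le) auto
  also have "2 * (4 * 2) / \<eta>\<^sup>2 = 64 / c\<^sup>2 * L\<^sup>2"
    by (simp add: \<eta>_def power_divide power_mult_distrib)
  finally show "(\<Sum>z\<in>near_zeros t - {z0}. 1 / (Im z - t)\<^sup>2) \<le> 64 / c\<^sup>2 * (ln t)\<^sup>2"
    by (simp only: L_def Y_def)
  show "Im z \<noteq> t" if "z \<in> near_zeros t - {z0}" for z
  proof
    assume "Im z = t"
    then have "0 \<in> h ` Y" using that by (intro image_eqI[of _ _ z]) (auto simp: h_def Y_def)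
    from range[OF this] show False by simp
  qed
qed

text \<open>
  If the claimed inequality fails at a zero \<open>s\<close> of the derivative, then \<open>s\<close> is so close to the line that \<open>Re F\<close> at \<open>s\<close> is
  still negative of order \<open>L\<close>. In \<open>0 = F s + \<Sum> 1 / (s - z)\<close> the real part shows that the nearest zero \<open>z0\<close> is at
  distance \<open>r\<close> with \<open>L r\<^sup>2 = O(\<delta>)\<close>, and the absolute value shows \<open>1 / r = O(L ln L)\<close>; here \<open>\<delta> = Re s - 1/2\<close>. The case
  \<open>\<delta> \<le> 0\<close> is included, because then the real part of the sum could not be positive.
\<close>

lemma deriv_zeros_away_from_line:
  obtains e t0 where "e > 0" "\<And>s. deriv zeta s = 0 \<Longrightarrow> Im s \<ge> t0 \<Longrightarrow>
     \<bar>Re s - 1/2\<bar> * ln (Im s) * (ln (ln (Im s)))\<^sup>2 \<ge> e"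
proof -
  obtain C where C: "C \<ge> 1" and ex: "\<And>t. t \<ge> T + 2 \<Longrightarrow> \<exists>F. F holomorphic_on ball (Complex 2 t) (17/10) \<and>
       (\<forall>s\<in>cball (Complex 2 t) (16/10). norm (F s) \<le> C * ln t) \<and>
       (\<forall>s\<in>ball (Complex 2 t) (17/10). s \<notin> near_zeros t \<longrightarrow>
          deriv zeta s / zeta s = F s + (\<Sum>z\<in>near_zeros t. 1 / (s - z)))"
    by (rule logderiv_zeta_near_zeros) (rule that)
  define D where "D = C + 2 * ((8 / c) * (2 + ln (8 / c + 1)))"
  have "(8 / c) * (2 + ln (8 / c + 1)) \<ge> 0"
  proof -
    have "ln (8 / c + 1) \<ge> 0" using c by (intro ln_ge_zero) auto
    then show ?thesis using c by simp
  qed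
  then have D: "D \<ge> 1" "(8 / c) * (2 + ln (8 / c + 1)) \<ge> 0" using C unfolding D_def by linarith+
  \<comment> \<open>The four bounds keep the segment from \<open>1/2 + i t\<close> to \<open>s\<close> inside the disc, the variation of \<open>F\<close> along it at most \<open>1/8\<close>,
    the far zeros' share of the real part at most \<open>L / 16\<close>, and the final inequality contradictory.\<close>
  define e where "e = min (min (1/20) (1 / (160 * C))) (min (c\<^sup>2 / 1024) (1 / (16 * D\<^sup>2)))"
  have pos: "1 / (160 * C) > 0" "c\<^sup>2 / 1024 > 0" "1 / (16 * D\<^sup>2) > 0" using C c D by auto
  have e: "e > 0" "e \<le> 1/20" "e \<le> 1 / (160 * C)" "e \<le> c\<^sup>2 / 1024" "e \<le> 1 / (16 * D\<^sup>2)"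
    using pos unfolding e_def by linarith+
  show ?thesis
  proof (rule that[of e "max (T + 2) (exp 60)"], fact e)
    fix s assume ds: "deriv zeta s = 0" and big: "Im s \<ge> max (T + 2) (exp 60)"
    define t where "t = Im s"
    define \<delta> where "\<delta> = Re s - 1/2"
    define L where "L = ln t"
    define l where "l = ln L"
    have t: "t \<ge> T + 2" "t \<ge> exp 60" using big by (auto simp: t_def)
    have t4: "t \<ge> 4" using t T by simp
    have "L \<ge> 60" using t t4 by (simp add: L_def ln_ge_iff)
    then have L: "L \<ge> 60" "L > 0" by auto
    have "exp 1 \<le> L" using exp_le L by linarith
    then have l: "l \<ge> 1" using L by (simp add: l_def ln_ge_iff)
    have s: "s = Complex (1/2 + \<delta>) t" by (simp add: t_def \<delta>_def complex_eq_iff)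
    show "\<bar>Re s - 1/2\<bar> * ln (Im s) * (ln (ln (Im s)))\<^sup>2 \<ge> e"
    proof (rule ccontr)
      assume "\<not> ?thesis"
      then have small: "\<bar>\<delta>\<bar> * L * l\<^sup>2 < e" by (simp add: \<delta>_def L_def l_def t_def)
      have l2: "l\<^sup>2 \<ge> 1" using l by simp
      have dL: "\<bar>\<delta>\<bar> * L < e"
        using small mult_left_mono[OF l2, of "\<bar>\<delta>\<bar> * L"] L by simp
      have d: "\<bar>\<delta>\<bar> < 1/20"
        using dL mult_left_mono[of 1 L "\<bar>\<delta>\<bar>"] L e(2) by simp
      obtain F where F: "F holomorphic_on ball (Complex 2 t) (17/10)"
        and Fb: "\<And>s. s \<in> cball (Complex 2 t) (16/10) \<Longrightarrow> norm (F s) \<le> C * L"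
        and Feq: "\<And>s. s \<in> ball (Complex 2 t) (17/10) \<Longrightarrow> s \<notin> near_zeros t \<Longrightarrow>
          deriv zeta s / zeta s = F s + (\<Sum>z\<in>near_zeros t. 1 / (s - z))"
        using ex[OF t(1)] unfolding L_def by blast
      let ?s0 = "Complex (1/2) t"
      have on_line: "cball w (1/20) \<subseteq> cball (Complex 2 t) (16/10)" if "w \<in> closed_segment ?s0 s" for w
      proof
        have "w \<in> cball ?s0 (1/20)"
        proof -
          have "closed_segment ?s0 s \<subseteq> cball ?s0 (1/20)"
          proof (rule closed_segment_subset)
            have "norm (?s0 - s) \<le> \<bar>\<delta>\<bar>" using cmod_le[of "?s0 - s"] by (simp add: s)
            then show "s \<in> cball ?s0 (1/20)" using d by (simp add: dist_norm)
          qed auto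
          then show ?thesis using that by blast
        qed
        moreover have "norm (Complex 2 t - ?s0) \<le> 3/2"
          using cmod_le[of "Complex 2 t - ?s0"] by simp
        moreover fix v assume "v \<in> cball w (1/20)"
        ultimately have "dist ?s0 w \<le> 1/20" "dist (Complex 2 t) ?s0 \<le> 3/2" "dist w v \<le> 1/20"
          by (simp_all add: dist_norm)
        then have "dist (Complex 2 t) v \<le> 16/10"
          using dist_triangle[of "Complex 2 t" v w] dist_triangle[of "Complex 2 t" w ?s0] by linarith
        then show "v \<in> cball (Complex 2 t) (16/10)" by simp
      qed
      have sub: "cball (Complex 2 t) (16/10) \<subseteq> ball (Complex 2 t) (17/10)" by auto
      \<comment> \<open>Cauchy's inequality on circles of radius \<open>1/20\<close>, which stay in the disc where \<open>F\<close> is bounded.\<close>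
      have dF: "norm (deriv F w) \<le> 20 * C * L" if w: "w \<in> closed_segment ?s0 s" for w
      proof -
        have "norm ((deriv ^^ 1) F w) \<le> fact 1 * (C * L) / (1/20) ^ 1"
        proof (rule Cauchy_inequality)
          have "cball w (1/20) \<subseteq> ball (Complex 2 t) (17/10)" using on_line[OF w] sub by blast
          then show "F holomorphic_on ball w (1/20)" "continuous_on (cball w (1/20)) F"
            using ball_subset_cball[of w "1/20"]
            by (auto intro!: holomorphic_on_imp_continuous_on holomorphic_on_subset[OF F])
          show "norm (F x) \<le> C * L" if "norm (w - x) = 1/20" for x
          proof (rule Fb)
            have "x \<in> cball w (1/20)" using that by (simp add: dist_norm)
            then show "x \<in> cball (Complex 2 t) (16/10)" using on_line[OF w] by blast
          qed
        qed auto
        then show ?thesis by simp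
      qed
      have "norm (F s - F ?s0) \<le> 20 * C * L * norm (s - ?s0)"
      proof (rule field_differentiable_bound[of "closed_segment ?s0 s"])
        fix w assume w: "w \<in> closed_segment ?s0 s"
        have "w \<in> ball (Complex 2 t) (17/10)" using on_line[OF w] sub by (metis centre_in_cball subset_iff zero_le_divide_1_iff zero_le_numeral)
        then show "(F has_field_derivative deriv F w) (at w within closed_segment ?s0 s)"
          by (rule holomorphic_derivI[OF F open_ball])
        show "norm (deriv F w) \<le> 20 * C * L" by (rule dF[OF w])
      qed auto
      also have "norm (s - ?s0) \<le> \<bar>\<delta>\<bar>" using cmod_le[of "s - ?s0"] by (simp add: s)
      also have "20 * C * L * \<bar>\<delta>\<bar> \<le> 1/8"
      proof -
        have "20 * C * (\<bar>\<delta>\<bar> * L) \<le> 20 * C * (1 / (160 * C))"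
          using dL e(3) C by (intro mult_left_mono) auto
        then show ?thesis using C by (simp add: mult_ac)
      qed
      finally have "norm (F s - F ?s0) \<le> 1/8" using C L by (simp add: mult_left_mono)
      then have "Re (F s) - Re (F ?s0) \<le> 1/8" using complex_Re_le_cmod[of "F s - F ?s0"] by simp
      moreover have "Re (F ?s0) \<le> - L / 4"
        unfolding L_def by (rule Re_regular_part_le[OF t F Feq])
      ultimately have ReF: "Re (F s) \<le> - L / 8" using L by linarith
      have s_in: "s \<in> cball (Complex 2 t) (16/10)"
        using on_line[of s] by (metis centre_in_cball ends_in_segment(2) subset_iff zero_le_divide_1_iff zero_le_numeral)
      have s_nz: "s \<notin> near_zeros t" using near_zerosD(3)[OF t(1)] ds by blast
      have zero: "F s + (\<Sum>z\<in>near_zeros t. 1 / (s - z)) = 0"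
        using Feq[of s] s_nz s_in sub ds by auto
      have fin: "finite (near_zeros t)" by (rule finite_near_zeros[OF t(1)])
      have "near_zeros t \<noteq> {}" using zero ReF L by auto
      then obtain z0 where z0: "z0 \<in> near_zeros t" "\<forall>z\<in>near_zeros t. \<bar>Im z0 - t\<bar> \<le> \<bar>Im z - t\<bar>"
        using fin arg_min_if_finite[of "near_zeros t" "\<lambda>z. \<bar>Im z - t\<bar>"] by (metis linorder_not_less)
      note far = far_zeros_sums_le[OF t(1) z0, folded L_def l_def]
      let ?Y = "near_zeros t - {z0}"
      have diff: "s - z = Complex \<delta> (t - Im z)" if "z \<in> near_zeros t" for z
        using near_zerosD(1)[OF t(1) that] by (simp add: s complex_eq_iff)
      have Re_term: "Re (1 / (s - z)) = \<delta> / (norm (s - z))\<^sup>2" if "z \<in> near_zeros t" for z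
        by (simp add: diff[OF that] Re_divide cmod_power2)
      have sum_split: "(\<Sum>z\<in>near_zeros t. f z) = f z0 + (\<Sum>z\<in>?Y. f z)" for f :: "complex \<Rightarrow> complex"
        by (rule sum.remove[OF fin z0(1)])
      define r where "r = norm (s - z0)"
      have r: "r > 0" using s_nz z0(1) by (auto simp: r_def)
      have "\<delta> / r\<^sup>2 + (\<Sum>z\<in>?Y. \<delta> / (norm (s - z))\<^sup>2) = - Re (F s)"
      proof -
        have "Re (F s) + Re (1 / (s - z0)) + (\<Sum>z\<in>?Y. Re (1 / (s - z))) = 0"
          using arg_cong[OF zero, of Re] by (simp add: sum_split)
        moreover have "(\<Sum>z\<in>?Y. Re (1 / (s - z))) = (\<Sum>z\<in>?Y. \<delta> / (norm (s - z))\<^sup>2)"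
          by (intro sum.cong refl Re_term) auto
        ultimately show ?thesis using Re_term[OF z0(1)] by (simp add: r_def)
      qed
      moreover have "(\<Sum>z\<in>?Y. \<delta> / (norm (s - z))\<^sup>2) \<le> L / 16"
      proof -
        have "(\<Sum>z\<in>?Y. \<delta> / (norm (s - z))\<^sup>2) \<le> (\<Sum>z\<in>?Y. \<bar>\<delta>\<bar> * (1 / (Im z - t)\<^sup>2))"
        proof (rule sum_mono)
          fix z assume z: "z \<in> ?Y"
          have "(norm (s - z))\<^sup>2 \<ge> (Im z - t)\<^sup>2"
            using diff[of z] z by (simp add: cmod_power2 power2_commute)
          moreover have "(Im z - t)\<^sup>2 > 0" using far(3)[OF z] by simp
          ultimately have "\<bar>\<delta>\<bar> / (norm (s - z))\<^sup>2 \<le> \<bar>\<delta>\<bar> / (Im z - t)\<^sup>2"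
            by (intro divide_left_mono mult_pos_pos) auto
          moreover have "\<delta> / (norm (s - z))\<^sup>2 \<le> \<bar>\<delta>\<bar> / (norm (s - z))\<^sup>2" by (intro divide_right_mono) auto
          ultimately show "\<delta> / (norm (s - z))\<^sup>2 \<le> \<bar>\<delta>\<bar> * (1 / (Im z - t)\<^sup>2)" by simp
        qed
        also have "\<dots> \<le> \<bar>\<delta>\<bar> * (64 / c\<^sup>2 * L\<^sup>2)"
          unfolding sum_distrib_left[symmetric] by (intro mult_left_mono far(2)) auto
        also have "\<dots> = 64 / c\<^sup>2 * (\<bar>\<delta>\<bar> * L) * L" by (simp add: power2_eq_square)
        also have "\<dots> \<le> 64 / c\<^sup>2 * (c\<^sup>2 / 1024) * L"
          using dL e(4) L by (intro mult_right_mono mult_left_mono) auto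
        also have "\<dots> = L / 16" using c by simp
        finally show ?thesis .
      qed
      ultimately have "L / 16 \<le> \<delta> / r\<^sup>2" using ReF by linarith
      then have low: "L * r\<^sup>2 \<le> 16 * \<bar>\<delta>\<bar>" using r by (simp add: field_simps)
      have "1 / r \<le> D * (L * l)"
      proof -
        have "1 / (s - z0) = - F s - (\<Sum>z\<in>?Y. 1 / (s - z))"
          using zero sum_split[of "\<lambda>z. 1 / (s - z)"] by (simp add: algebra_simps eq_neg_iff_add_eq_0)
        then have "norm (1 / (s - z0)) \<le> norm (F s) + norm (\<Sum>z\<in>?Y. 1 / (s - z))"
          using norm_triangle_ineq4[of "- F s" "\<Sum>z\<in>?Y. 1 / (s - z)"] by simp
        also have "norm (F s) \<le> C * L" by (rule Fb[OF s_in])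
        also have "norm (\<Sum>z\<in>?Y. 1 / (s - z)) \<le> (\<Sum>z\<in>?Y. 1 / \<bar>Im z - t\<bar>)"
        proof (rule order_trans[OF norm_sum sum_mono])
          fix z assume z: "z \<in> ?Y"
          have "\<bar>Im z - t\<bar> \<le> norm (s - z)" using abs_Im_le_cmod[of "s - z"] by (simp add: t_def abs_minus_commute)
          then show "norm (1 / (s - z)) \<le> 1 / \<bar>Im z - t\<bar>"
            using far(3)[OF z] by (simp add: norm_divide frac_le)
        qed
        also have "\<dots> \<le> (8 / c) * (2 + ln (8 / c + 1)) * L * (1 + l)" by (rule far(1))
        also have "C * L + (8 / c) * (2 + ln (8 / c + 1)) * L * (1 + l) \<le>
            C * (L * l) + (8 / c) * (2 + ln (8 / c + 1)) * (2 * (L * l))"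
        proof (rule add_mono)
          show "C * L \<le> C * (L * l)" using C L l by (intro mult_left_mono) auto
          have "L * (1 + l) \<le> 2 * (L * l)" using L l by (simp add: algebra_simps)
          then show "(8 / c) * (2 + ln (8 / c + 1)) * L * (1 + l) \<le> (8 / c) * (2 + ln (8 / c + 1)) * (2 * (L * l))"
            unfolding mult.assoc[of _ L] by (intro mult_left_mono D(2))
        qed
        also have "\<dots> = D * (L * l)" by (simp add: D_def algebra_simps)
        finally show ?thesis by (simp add: r_def norm_divide)
      qed
      then have "1 \<le> D * (L * l) * r" using r by (simp add: field_simps)
      then have "1 \<le> (D * (L * l) * r)\<^sup>2" by simp
      also have "\<dots> = D\<^sup>2 * L * l\<^sup>2 * (L * r\<^sup>2)" by (simp add: power_mult_distrib power2_eq_square)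
      also have "\<dots> \<le> D\<^sup>2 * L * l\<^sup>2 * (16 * \<bar>\<delta>\<bar>)" using L by (intro mult_left_mono low) auto
      also have "\<dots> = 16 * D\<^sup>2 * (\<bar>\<delta>\<bar> * L * l\<^sup>2)" by simp
      also have "\<dots> < 16 * D\<^sup>2 * e" using small D by (intro mult_strict_left_mono) auto
      also have "\<dots> \<le> 16 * D\<^sup>2 * (1 / (16 * D\<^sup>2))" using e(5) by (intro mult_left_mono) auto
      also have "\<dots> = 1" using D by simp
      finally show False by simp
    qed
  qed
qed

end

theorem theorem3:
  fixes \<rho> :: "nat \<Rightarrow> complex"
  assumes RH: "riemann_hypothesis"
    and enum: "upper_zeta_zeros_enumeration \<rho>"
    and deriv_zeros:
      "Liminf (Im going_to at_top within nonreal_zeta_deriv_zeros)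
         (\<lambda>z. ereal ((Re z - 1/2) * ln (Im z) * (ln (ln (Im z)))\<^sup>2)) = 0"
  shows "liminf (\<lambda>n. ereal ((Im (\<rho> (Suc n)) - Im (\<rho> n)) * ln (Im (\<rho> n)))) = 0"
proof (rule ccontr)
  let ?g = "\<lambda>n. (Im (\<rho> (Suc n)) - Im (\<rho> n)) * ln (Im (\<rho> n))"
  assume ne: "\<not> ?thesis"
  have "eventually (\<lambda>n. ereal 0 \<le> ereal (?g n)) sequentially"
    using eventually_ordinate_gt[OF RH enum, of 1]
  proof eventually_elim
    case (elim n)
    then show ?case using ordinates_mono[OF RH enum, of n "Suc n"] by simp
  qed
  then have "ereal 0 \<le> liminf (\<lambda>n. ereal (?g n))" by (rule Liminf_bounded)
  with ne have "0 < liminf (\<lambda>n. ereal (?g n))" by (simp add: zero_ereal_def[symmetric] less_le)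
  then obtain c where c: "0 < ereal c" "ereal c < liminf (\<lambda>n. ereal (?g n))"
    using ereal_dense2 by blast
  then have gap: "eventually (\<lambda>n. ?g n \<ge> c) sequentially"
    using less_LiminfD[OF c(2)] by (auto elim!: eventually_mono)
  have c0: "c > 0" using c(1) by simp
  obtain T where T: "T \<ge> 2"
    "\<And>z. z \<in> nontrivial_zeta_zeros \<Longrightarrow> Im z \<ge> T \<Longrightarrow> deriv zeta z \<noteq> 0"
    "\<And>z w y. z \<in> nontrivial_zeta_zeros \<Longrightarrow> w \<in> nontrivial_zeta_zeros \<Longrightarrow> z \<noteq> w \<Longrightarrow> T \<le> Im z \<Longrightarrow> T \<le> Im w
        \<Longrightarrow> Im z \<le> y \<Longrightarrow> Im w \<le> y \<Longrightarrow> \<bar>Im z - Im w\<bar> \<ge> c / ln y"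
    by (rule separated_zeros_if_large_gaps[OF RH enum c0 gap]) (rule that)
  interpret separated_zeros c T
    by unfold_locales (fact RH c0 T)+
  obtain e t0 where e: "e > 0" and away: "\<And>s. deriv zeta s = 0 \<Longrightarrow> Im s \<ge> t0 \<Longrightarrow>
     \<bar>Re s - 1/2\<bar> * ln (Im s) * (ln (ln (Im s)))\<^sup>2 \<ge> e"
    by (rule deriv_zeros_away_from_line) (rule that)
  let ?F = "Im going_to at_top within nonreal_zeta_deriv_zeros"
  let ?f = "\<lambda>z. (Re z - 1/2) * ln (Im z) * (ln (ln (Im z)))\<^sup>2"
  \<comment> \<open>The limit inferior \<open>0\<close> excludes values below \<open>- e\<close>, so the lower bound for the absolute value becomes one for the
    value itself.\<close>
  have "eventually (\<lambda>z. ereal (- e) < ereal (?f z)) ?F"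
    by (rule less_LiminfD) (use deriv_zeros e in simp)
  moreover have "eventually (\<lambda>z. z \<in> nonreal_zeta_deriv_zeros \<and> Im z \<ge> max t0 1) ?F"
    unfolding going_to_within_def eventually_inf_principal
    by (rule eventually_mono[OF eventually_filtercomapI[OF eventually_ge_at_top[of "max t0 1"]]]) auto
  ultimately have "eventually (\<lambda>z. ereal e \<le> ereal (?f z)) ?F"
  proof eventually_elim
    case (elim z)
    then have "deriv zeta z = 0" "Im z \<ge> t0" "Im z \<ge> 1" by (auto simp: nonreal_zeta_deriv_zeros_def)
    then have "\<bar>?f z\<bar> \<ge> e" using away[of z] by (simp add: abs_mult)
    then show ?case using elim by simp
  qed
  then have "ereal e \<le> Liminf ?F (\<lambda>z. ereal (?f z))" by (rule Liminf_bounded)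
  then show False using deriv_zeros e by simp
qed

end
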